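(* Let $(M,\mathcal I)$ be the hyperbolic Monge-Ampère system on a $5$-manifold $M$ with differential ideal $\mathcal I=\langle\theta^0,\theta^1\wedge\theta^2,\theta^3\wedge\theta^4\rangle$, where $(\theta^0,\dots,\theta^4)$ is a coframing and $F$ is a function with $F\neq0$ satisfying $$\begin{aligned} d\theta^0&=\theta^0\wedge(2\theta^1-F\theta^2+2\theta^3-F\theta^4)+\theta^1\wedge\theta^2+\theta^3\wedge\theta^4,\\ d\theta^1&=-F\theta^0\wedge(\theta^2+\theta^4)-\theta^1\wedge\theta^4+\theta^2\wedge\theta^3+(F+1)\theta^2\wedge\theta^4,\\ d\theta^2&=-2F\theta^0\wedge\theta^2-\theta^1\wedge\theta^2-\theta^1\wedge\theta^4+\theta^2\wedge\theta^3+(1-F)\theta^2\wedge\theta^4+\theta^3\wedge\theta^4,\\ d\theta^3&=F\theta^0\wedge(\theta^2+\theta^4)+\theta^1\wedge\theta^4-\theta^2\wedge\theta^3+(F-1)\theta^2\wedge\theta^4,\\ d\theta^4&=-2F\theta^0\wedge\theta^4+\theta^1\wedge\theta^2-\theta^1\wedge\theta^4+\theta^2\wedge\theta^3+(F+1)\theta^2\wedge\theta^4-\theta^3\wedge\theta^4,\\ dF&=2F^2(2\theta^0-\theta^2-\theta^4)+2F(\theta^1+\theta^3). \end{aligned}$$ Then, up to a contact transformation, $(M,\mathcal I)$ corresponds to the hyperbolic Monge-Ampère PDE $$(A^2-B^2)(z_{xx}-z_{yy})+4AB\,z_{xy}+(A^2+B^2)^2=0,\qquad A=z_x-y,\quad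 B=z_y+x.$$
   Context: The correspondence is local. A Monge-Ampère PDE for $z(x,y)$ is encoded as an exterior differential system on an open subset of $\mathbb R^5$ with coordinates $(x,y,z,p,q)$ generated by the contact form $dz-p\,dx-q\,dy$, its exterior derivative, and a $2$-form $\Omega$ whose vanishing on surfaces $z=z(x,y),\ p=z_x,\ q=z_y$ (with $dx\wedge dy\neq0$) is the PDE. Here this is on the open set where $A=p-y$ and $B=q+x$ do not vanish simultaneously. A system corresponds to a PDE up to a contact transformation if there is a local diffeomorphism carrying its differential ideal to that of the PDE. *)

theory Defs
  imports "HOL-Analysis.Analysis" "HOL-Library.Function_Algebras"
begin

section \<open>Smooth maps\<close>

text \<open>Meant for open \<open>S\<close>; in finite dimension this is the usual class \<open>C\<^sup>k\<close>.\<close>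

primrec Ck_on ::
    "nat \<Rightarrow> 'a::real_normed_vector set \<Rightarrow> ('a \<Rightarrow> 'b::real_normed_vector) \<Rightarrow> bool" where
  "Ck_on 0 S f \<longleftrightarrow> continuous_on S f"
| "Ck_on (Suc k) S f \<longleftrightarrow> (\<forall>x\<in>S. f differentiable at x) \<and>
     (\<forall>v. Ck_on k S (\<lambda>x. frechet_derivative f (at x) v))"

definition smooth_on :: "'a::real_normed_vector set \<Rightarrow> ('a \<Rightarrow> 'b::real_normed_vector) \<Rightarrow> bool" where
  "smooth_on S f \<longleftrightarrow> (\<forall>k. Ck_on k S f)"

definition diffeomorphism ::
    "'a::real_normed_vector set \<Rightarrow> 'b::real_normed_vector set \<Rightarrow> ('a \<Rightarrow> 'b) \<Rightarrow> bool" where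
  "diffeomorphism V W g \<longleftrightarrow> open V \<and> open W \<and> bij_betw g V W \<and>
     smooth_on V g \<and> smooth_on W (inv_into V g)"


section \<open>Differential forms on open subsets of a Euclidean space\<close>

text \<open>
  An element of the exterior algebra of the dual of \<open>'a\<close> is a function on lists of vectors; its
  restriction to lists of length \<open>k\<close> is its component of degree \<open>k\<close>.  A field of such elements may
  take arbitrary values outside the open set under consideration, so forms on \<open>U\<close> are only ever
  compared at points of \<open>U\<close>.  Sums and differences are the pointwise ones of
  \<open>Function_Algebras\<close>.
\<close>

type_synonym 'a multiform = "'a list \<Rightarrow> real"
type_synonym 'a form = "'a \<Rightarrow> 'a multiform"

definition alternating_multilinear :: "'a::real_vector multiform \<Rightarrow> bool" where
  "alternating_multilinear \<omega> \<longleftrightarrow>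
     (\<forall>us ws. linear (\<lambda>v. \<omega> (us @ v # ws))) \<and> (\<forall>vs. \<not> distinct vs \<longrightarrow> \<omega> vs = 0)"

definition forms_on :: "'a::real_normed_vector set \<Rightarrow> 'a form set" where
  "forms_on U = {\<omega>. (\<forall>x\<in>U. alternating_multilinear (\<omega> x)) \<and> (\<forall>vs. smooth_on U (\<lambda>x. \<omega> x vs))}"

definition k_forms_on :: "nat \<Rightarrow> 'a::real_normed_vector set \<Rightarrow> 'a form set" where
  "k_forms_on k U = {\<omega> \<in> forms_on U. \<forall>x\<in>U. \<forall>vs. length vs \<noteq> k \<longrightarrow> \<omega> x vs = 0}"

text \<open>
  The wedge product as a sum over shuffles: \<open>S\<close> is the set of positions of the arguments fed to
  the first factor, and the exponent counts the inversions of the shuffle.  There are no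
  factorials, so \<open>(\<alpha> \<and> \<beta>)(v, w) = \<alpha>(v) \<beta>(w) - \<alpha>(w) \<beta>(v)\<close> for forms of degree one.
\<close>

definition wedge :: "'a form \<Rightarrow> 'a form \<Rightarrow> 'a form" (infixr "\<and>\<^sub>w" 75) where
  "(\<alpha> \<and>\<^sub>w \<beta>) = (\<lambda>x vs. \<Sum>S\<in>Pow {..<length vs}.
     (- 1) ^ card {(i, j). i \<in> S \<and> j < i \<and> j \<notin> S} *
     \<alpha> x (nths vs S) * \<beta> x (nths vs ({..<length vs} - S)))"

definition scale_form :: "('a \<Rightarrow> real) \<Rightarrow> 'a form \<Rightarrow> 'a form" (infixr "\<cdot>" 73) where
  "(f \<cdot> \<omega>) = (\<lambda>x vs. f x * \<omega> x vs)"

definition ext_d :: "'a::real_normed_vector form \<Rightarrow> 'a form" where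
  "ext_d \<omega> = (\<lambda>x vs. \<Sum>i<length vs. (- 1) ^ i *
     frechet_derivative (\<lambda>y. \<omega> y (take i vs @ drop (Suc i) vs)) (at x) (vs ! i))"

definition zero_form :: "('a \<Rightarrow> real) \<Rightarrow> 'a form" where
  "zero_form f = (\<lambda>x vs. if vs = [] then f x else 0)"

abbreviation differential :: "('a::real_normed_vector \<Rightarrow> real) \<Rightarrow> 'a form" where
  "differential f \<equiv> ext_d (zero_form f)"

definition pullback ::
    "('a::real_normed_vector \<Rightarrow> 'b::real_normed_vector) \<Rightarrow> 'b form \<Rightarrow> 'a form" where
  "pullback f \<omega> = (\<lambda>x vs. \<omega> (f x) (map (frechet_derivative f (at x)) vs))"

text \<open>
  The ideal of the algebra of forms on \<open>U\<close> generated by a set of homogeneous forms (for such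
  generators left and two-sided ideals coincide).  Both ideals used below are generated
  algebraically and are closed under \<open>ext_d\<close>: modulo the form of degree one and its exterior
  derivative, every form of degree three in dimension five is already in the ideal.
\<close>

definition generated_ideal ::
    "'a::real_normed_vector set \<Rightarrow> 'a form set \<Rightarrow> 'a form set" where
  "generated_ideal U G = {\<omega> \<in> forms_on U. \<exists>T \<beta>. finite T \<and> T \<subseteq> G \<and> (\<forall>\<gamma>\<in>T. \<beta> \<gamma> \<in> forms_on U) \<and>
     (\<forall>x\<in>U. \<omega> x = (\<Sum>\<gamma>\<in>T. \<beta> \<gamma> \<and>\<^sub>w \<gamma>) x)}"


section \<open>Smooth manifolds, functions and forms in charts\<close>

type_synonym ('m, 'a) chart = "'m set \<times> ('m \<Rightarrow> 'a)"

definition chart_image :: "('m, 'a) chart \<Rightarrow> 'a set" where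
  "chart_image c = snd c ` fst c"

definition in_chart :: "('m, 'a) chart \<Rightarrow> ('m \<Rightarrow> 'b) \<Rightarrow> 'a \<Rightarrow> 'b" where
  "in_chart c f = f \<circ> inv_into (fst c) (snd c)"

definition overlap :: "('m, 'a) chart \<Rightarrow> ('m, 'a) chart \<Rightarrow> 'a set" where
  "overlap c c' = snd c ` (fst c \<inter> fst c')"

definition smooth_manifold :: "'m topology \<Rightarrow> ('m, 'a::euclidean_space) chart set \<Rightarrow> bool" where
  "smooth_manifold X \<A> \<longleftrightarrow> Hausdorff_space X \<and> second_countable X \<and>
     (\<Union>c\<in>\<A>. fst c) = topspace X \<and>
     (\<forall>c\<in>\<A>. openin X (fst c) \<and> open (chart_image c) \<and>
        homeomorphic_map (subtopology X (fst c)) (top_of_set (chart_image c)) (snd c)) \<and>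
     (\<forall>c\<in>\<A>. \<forall>c'\<in>\<A>. smooth_on (overlap c c') (in_chart c (snd c')))"

definition smooth_function :: "('m, 'a::euclidean_space) chart set \<Rightarrow> ('m \<Rightarrow> real) \<Rightarrow> bool" where
  "smooth_function \<A> f \<longleftrightarrow> (\<forall>c\<in>\<A>. smooth_on (chart_image c) (in_chart c f))"

text \<open>
  A form on a manifold is the family of its coordinate expressions in the charts, which have to
  be compatible with the changes of coordinates.
\<close>

type_synonym ('m, 'a) manifold_form = "('m, 'a) chart \<Rightarrow> 'a form"

definition manifold_k_forms ::
    "nat \<Rightarrow> ('m, 'a::euclidean_space) chart set \<Rightarrow> ('m, 'a) manifold_form set" where
  "manifold_k_forms k \<A> = {\<omega>. (\<forall>c\<in>\<A>. \<omega> c \<in> k_forms_on k (chart_image c)) \<and>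
     (\<forall>c\<in>\<A>. \<forall>c'\<in>\<A>. \<forall>x\<in>overlap c c'. \<omega> c x = pullback (in_chart c (snd c')) (\<omega> c') x)}"

definition coframing ::
    "('m, 'a::euclidean_space) chart set \<Rightarrow> (nat \<Rightarrow> ('m, 'a) manifold_form) \<Rightarrow> bool" where
  "coframing \<A> \<theta> \<longleftrightarrow> (\<forall>i<DIM('a). \<theta> i \<in> manifold_k_forms 1 \<A>) \<and>
     (\<forall>c\<in>\<A>. \<forall>x\<in>chart_image c. \<forall>a. (\<forall>v. (\<Sum>i<DIM('a). a i * \<theta> i c x [v]) = 0) \<longrightarrow>
        (\<forall>i<DIM('a). a i = 0))"


section \<open>The structure equations\<close>

text \<open>
  Numerals, powers and sums to the left of \<open>\<cdot>\<close> are those of real-valued functions.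
\<close>

definition structure_equations ::
    "'a::real_normed_vector set \<Rightarrow> (nat \<Rightarrow> 'a form) \<Rightarrow> ('a \<Rightarrow> real) \<Rightarrow> bool" where
  "structure_equations U \<theta> F \<longleftrightarrow> (\<forall>x\<in>U.
     ext_d (\<theta> 0) x =
       (\<theta> 0 \<and>\<^sub>w (2 \<cdot> \<theta> 1 - F \<cdot> \<theta> 2 + 2 \<cdot> \<theta> 3 - F \<cdot> \<theta> 4) + \<theta> 1 \<and>\<^sub>w \<theta> 2 + \<theta> 3 \<and>\<^sub>w \<theta> 4) x \<and>
     ext_d (\<theta> 1) x =
       (- (F \<cdot> \<theta> 0 \<and>\<^sub>w (\<theta> 2 + \<theta> 4)) - \<theta> 1 \<and>\<^sub>w \<theta> 4 + \<theta> 2 \<and>\<^sub>w \<theta> 3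
         + (F + 1) \<cdot> \<theta> 2 \<and>\<^sub>w \<theta> 4) x \<and>
     ext_d (\<theta> 2) x =
       (- ((2 * F) \<cdot> \<theta> 0 \<and>\<^sub>w \<theta> 2) - \<theta> 1 \<and>\<^sub>w \<theta> 2 - \<theta> 1 \<and>\<^sub>w \<theta> 4 + \<theta> 2 \<and>\<^sub>w \<theta> 3
         + (1 - F) \<cdot> \<theta> 2 \<and>\<^sub>w \<theta> 4 + \<theta> 3 \<and>\<^sub>w \<theta> 4) x \<and>
     ext_d (\<theta> 3) x =
       (F \<cdot> \<theta> 0 \<and>\<^sub>w (\<theta> 2 + \<theta> 4) + \<theta> 1 \<and>\<^sub>w \<theta> 4 - \<theta> 2 \<and>\<^sub>w \<theta> 3
         + (F - 1) \<cdot> \<theta> 2 \<and>\<^sub>w \<theta> 4) x \<and>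
     ext_d (\<theta> 4) x =
       (- ((2 * F) \<cdot> \<theta> 0 \<and>\<^sub>w \<theta> 4) + \<theta> 1 \<and>\<^sub>w \<theta> 2 - \<theta> 1 \<and>\<^sub>w \<theta> 4 + \<theta> 2 \<and>\<^sub>w \<theta> 3
         + (F + 1) \<cdot> \<theta> 2 \<and>\<^sub>w \<theta> 4 - \<theta> 3 \<and>\<^sub>w \<theta> 4) x \<and>
     differential F x =
       ((2 * F ^ 2) \<cdot> (2 \<cdot> \<theta> 0 - \<theta> 2 - \<theta> 4) + (2 * F) \<cdot> (\<theta> 1 + \<theta> 3)) x)"


section \<open>Second-order equations for a function of two variables\<close>

abbreviation partial :: "2 \<Rightarrow> (real^2 \<Rightarrow> real) \<Rightarrow> real^2 \<Rightarrow> real" where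
  "partial i z \<equiv> \<lambda>u. frechet_derivative z (at u) (axis i 1)"

text \<open>The coordinates \<open>(x, y, z, p, q)\<close> of \<open>real^5\<close> are the components 1 to 5.\<close>

definition jet1 :: "(real^2 \<Rightarrow> real) \<Rightarrow> real^2 \<Rightarrow> real^5" where
  "jet1 z u = vector [u $ 1, u $ 2, z u, partial 1 z u, partial 2 z u]"

definition contact_form :: "(real^5) form" where
  "contact_form = differential (\<lambda>w. w $ 3)
     - (\<lambda>w. w $ 4) \<cdot> differential (\<lambda>w. w $ 1) - (\<lambda>w. w $ 5) \<cdot> differential (\<lambda>w. w $ 2)"

text \<open>
  An equation is a predicate \<open>P z u\<close> saying that the function \<open>z\<close> satisfies it at the point \<open>u\<close>.
  The two-form \<open>\<Omega>\<close> on \<open>W\<close> encodes it if, at each point of each surface given by a function \<open>z\<close>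
  with its first partial derivatives, the restriction of \<open>\<Omega>\<close> vanishes iff the equation holds.
\<close>

definition encodes_pde ::
    "(real^5) set \<Rightarrow> (real^5) form \<Rightarrow> ((real^2 \<Rightarrow> real) \<Rightarrow> real^2 \<Rightarrow> bool) \<Rightarrow> bool" where
  "encodes_pde W \<Omega> P \<longleftrightarrow> \<Omega> \<in> k_forms_on 2 W \<and>
     (\<forall>D z. open D \<and> smooth_on D z \<and> jet1 z ` D \<subseteq> W \<longrightarrow>
        (\<forall>u\<in>D. pullback (jet1 z) \<Omega> u = 0 \<longleftrightarrow> P z u))"

text \<open>
  \<open>G\<close> gives, in each chart, generators of a differential ideal on the manifold.  Around each
  point there has to be a local diffeomorphism \<open>g \<circ> snd c\<close> of the manifold into \<open>W\<close> that
  identifies this ideal with the one of the equation.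
\<close>

definition corresponds_to_pde ::
    "'m topology \<Rightarrow> ('m, real^5) chart set \<Rightarrow> ('m, real^5) manifold_form set \<Rightarrow>
     (real^5) set \<Rightarrow> ((real^2 \<Rightarrow> real) \<Rightarrow> real^2 \<Rightarrow> bool) \<Rightarrow> bool" where
  "corresponds_to_pde X \<A> G W P \<longleftrightarrow> (\<exists>\<Omega>. encodes_pde W \<Omega> P \<and>
     (\<forall>m\<in>topspace X. \<exists>c\<in>\<A>. \<exists>V g. m \<in> fst c \<and> snd c m \<in> V \<and> V \<subseteq> chart_image c \<and>
        g ` V \<subseteq> W \<and> diffeomorphism V (g ` V) g \<and>
        (\<forall>\<omega>\<in>forms_on (g ` V).
           \<omega> \<in> generated_ideal (g ` V) {contact_form, ext_d contact_form, \<Omega>} \<longleftrightarrow>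
           pullback g \<omega> \<in> generated_ideal V ((\<lambda>\<gamma>. \<gamma> c) ` G))))"

end

theory Submission
  imports Defs
begin

text \<open>
  The structure equations can be integrated by quadratures.  Their symmetry algebra is solvable (in the
  final coordinates it consists of the translations in \<open>x\<close>, \<open>y\<close>, \<open>z\<close>, corrected in \<open>z\<close>, and the
  rotation of the \<open>(x, y)\<close> plane), so the only existence theorem needed is the Poincare lemma for
  one-forms on a ball, applied four times.

  Let \<open>F > 0\<close>.  The form \<open>\<gamma> = \<theta>\<^sup>2 + \<theta>\<^sup>4 - \<theta>\<^sup>1 + \<theta>\<^sup>3\<close> is closed, hence \<open>\<gamma> = d\<phi>\<close>.  Let \<open>(A, B)\<close> be the vector
  with angle \<open>\<phi>\<close> and length \<open>\<surd>(2 F)\<close>.  Then the forms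
  \<open>(A (\<theta>\<^sup>2 + \<theta>\<^sup>4) - B (\<theta>\<^sup>4 - \<theta>\<^sup>2)) / 2\<close> and \<open>(B (\<theta>\<^sup>2 + \<theta>\<^sup>4) + A (\<theta>\<^sup>4 - \<theta>\<^sup>2)) / 2\<close> are closed; call them \<open>dx\<close> and
  \<open>dy\<close>.  Finally \<open>- 2 F \<theta>\<^sup>0 + (A + y) dx + (B - x) dy\<close> is closed; call it \<open>dz\<close>.  With \<open>p = A + y\<close> and
  \<open>q = B - x\<close> the form \<open>- 2 F \<theta>\<^sup>0\<close> becomes the contact form, and \<open>A = p - y\<close>, \<open>B = q + x\<close> are the
  quantities in the equation.  This is \<open>contact_coordinates\<close>.

  The five functions are coordinates because their differentials determine \<open>\<theta>\<^sup>0, \<dots>, \<theta>\<^sup>4\<close>.  In these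
  coordinates the derivative of the contact form and the two-form of the equation are pulled back
  to two independent combinations, with function coefficients, of the decomposable forms
  \<open>(\<theta>\<^sup>1 + F \<theta>\<^sup>0) \<and> \<theta>\<^sup>2\<close> and \<open>(\<theta>\<^sup>3 + F \<theta>\<^sup>0) \<and> \<theta>\<^sup>4\<close> (\<open>contact_diffeomorphism\<close>).  Modulo \<open>\<theta>\<^sup>0\<close> these are
  \<open>\<theta>\<^sup>1 \<and> \<theta>\<^sup>2\<close> and \<open>\<theta>\<^sup>3 \<and> \<theta>\<^sup>4\<close>, so the ideals agree (\<open>generated_ideal_contact_eq\<close>).

  For \<open>F < 0\<close> one uses that the structure equations are invariant under
  \<open>(\<theta>\<^sup>0, \<theta>\<^sup>1, \<theta>\<^sup>2, \<theta>\<^sup>3, \<theta>\<^sup>4, F) \<mapsto> (- \<theta>\<^sup>0, \<theta>\<^sup>3, - \<theta>\<^sup>4, \<theta>\<^sup>1, - \<theta>\<^sup>2, - F)\<close>, which preserves the ideal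
  (\<open>structured_coframe_exchange\<close>).

  The rest is the calculus behind these statements: smooth maps and their local inverses,
  associativity and the alternating property of the exterior product, and the behaviour of
  generated ideals under pullback.
\<close>


section \<open>Calculus of smooth maps\<close>

lemma frechet_derivative_eqI:
  "(f has_derivative f') (at x) \<Longrightarrow> frechet_derivative f (at x) = f'"
  by (metis frechet_derivative_at)

lemma Ck_on_cong:
  fixes f g :: "'a::real_normed_vector \<Rightarrow> 'b::real_normed_vector"
  assumes "open S" "\<And>x. x \<in> S \<Longrightarrow> f x = g x" "Ck_on k S f"
  shows "Ck_on k S g"
  using assms(2,3)
proof (induction k arbitrary: f g)
  case 0
  then show ?case by (simp cong: continuous_on_cong)
next
  case (Suc k)
  have der: "(g has_derivative frechet_derivative f (at x)) (at x)" if "x \<in> S" for x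
  proof -
    have "(f has_derivative frechet_derivative f (at x)) (at x)"
      using Suc.prems(2) that by (simp add: frechet_derivative_works[symmetric])
    then show ?thesis
      using has_derivative_transform_within_open[OF _ \<open>open S\<close> that] Suc.prems(1) by blast
  qed
  show ?case
    unfolding Ck_on.simps
  proof (intro conjI ballI allI)
    show "g differentiable at x" if "x \<in> S" for x
      using der[OF that] by (auto simp: differentiable_def)
    show "Ck_on k S (\<lambda>x. frechet_derivative g (at x) v)" for v
    proof (rule Suc.IH)
      show "Ck_on k S (\<lambda>x. frechet_derivative f (at x) v)"
        using Suc.prems(2) by simp
      show "frechet_derivative f (at x) v = frechet_derivative g (at x) v" if "x \<in> S" for x
        using frechet_derivative_eqI[OF der[OF that]] by simp
    qed
  qed
qed

lemma Ck_on_SucI: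
  fixes f :: "'a::real_normed_vector \<Rightarrow> 'b::real_normed_vector"
  assumes "open S" and der: "\<And>x. x \<in> S \<Longrightarrow> (f has_derivative f' x) (at x)"
    and "\<And>v. Ck_on k S (\<lambda>x. f' x v)"
  shows "Ck_on (Suc k) S f"
  unfolding Ck_on.simps
proof (intro conjI ballI allI)
  show "f differentiable at x" if "x \<in> S" for x
    using der[OF that] by (auto simp: differentiable_def)
  show "Ck_on k S (\<lambda>x. frechet_derivative f (at x) v)" for v
    by (rule Ck_on_cong[OF \<open>open S\<close> _ assms(3)[of v]]) (simp add: frechet_derivative_eqI[OF der])
qed

lemma Ck_on_SucD:
  assumes "Ck_on (Suc k) S f"
  shows "Ck_on k S f"
  using assms
proof (induction k arbitrary: f)
  case 0
  then show ?case
    by (auto intro!: continuous_at_imp_continuous_on differentiable_imp_continuous_within)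
qed simp

lemma Ck_on_mono: "Ck_on k S f \<Longrightarrow> T \<subseteq> S \<Longrightarrow> Ck_on k T f"
  by (induction k arbitrary: f) (auto intro: continuous_on_subset)

lemma Ck_on_const: "open S \<Longrightarrow> Ck_on k S (\<lambda>x. c)"
proof (induction k arbitrary: c)
  case (Suc k)
  show ?case
    by (rule Ck_on_SucI[where f' = "\<lambda>x v. 0"]) (use Suc in \<open>auto intro!: derivative_intros\<close>)
qed simp

lemma Ck_on_bounded_linear:
  assumes "open S" "bounded_linear f"
  shows "Ck_on k S f"
proof (cases k)
  case 0
  then show ?thesis using assms linear_continuous_on by auto
next
  case (Suc l)
  show ?thesis unfolding Suc
    by (rule Ck_on_SucI[where f' = "\<lambda>x. f"])
      (use assms in \<open>auto intro: bounded_linear_imp_has_derivative Ck_on_const\<close>)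
qed

lemma Ck_on_has_derivative:
  "Ck_on (Suc k) S f \<Longrightarrow> x \<in> S \<Longrightarrow> (f has_derivative frechet_derivative f (at x)) (at x)"
  by (simp add: frechet_derivative_works[symmetric])

lemma Ck_on_add:
  assumes "open S" "Ck_on k S f" "Ck_on k S g"
  shows "Ck_on k S (\<lambda>x. f x + g x)"
  using assms(2,3)
proof (induction k arbitrary: f g)
  case 0
  then show ?case by (simp add: continuous_on_add)
next
  case (Suc k)
  show ?case
    by (rule Ck_on_SucI[OF \<open>open S\<close> has_derivative_add[OF Suc.prems[THEN Ck_on_has_derivative]]])
      (use Suc in auto)
qed

lemma Ck_on_sum:
  assumes "open S" "\<And>i. i \<in> I \<Longrightarrow> Ck_on k S (f i)"
  shows "Ck_on k S (\<lambda>x. \<Sum>i\<in>I. f i x)"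
  using assms(2)
proof (induction I rule: infinite_finite_induct)
  case (insert i I)
  then show ?case by (simp add: Ck_on_add[OF \<open>open S\<close>])
qed (simp_all add: Ck_on_const[OF \<open>open S\<close>])

text \<open>
  The product rule, for bilinear maps in general so that it serves scalar multiplication, products of
  functions and inner products at once.
\<close>

lemma Ck_on_bilinear:
  fixes h :: "'b::real_normed_vector \<Rightarrow> 'c::real_normed_vector \<Rightarrow> 'd::real_normed_vector"
  assumes "open S" "bounded_bilinear h" "Ck_on k S f" "Ck_on k S g"
  shows "Ck_on k S (\<lambda>x. h (f x) (g x))"
  using assms(3,4)
proof (induction k arbitrary: f g)
  case 0
  then show ?case by (auto intro: bounded_bilinear.continuous_on[OF assms(2)])
next
  case (Suc k)
  show ?case
  proof (rule Ck_on_SucI[OF \<open>open S\<close>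
        bounded_bilinear.FDERIV[OF assms(2) Suc.prems[THEN Ck_on_has_derivative]]])
    show "Ck_on k S (\<lambda>x. h (f x) (frechet_derivative g (at x) v)
      + h (frechet_derivative f (at x) v) (g x))" for v
      using Suc.prems Suc.prems[THEN Ck_on_SucD]
      by (intro Ck_on_add[OF \<open>open S\<close>] Suc.IH) simp_all
  qed
qed

lemmas Ck_on_scaleR = Ck_on_bilinear[OF _ bounded_bilinear_scaleR]
lemmas Ck_on_mult = Ck_on_bilinear[OF _ bounded_bilinear_mult]

lemma linear_expand:
  fixes f :: "'a::euclidean_space \<Rightarrow> 'b::real_vector"
  assumes "linear f"
  shows "f v = (\<Sum>b\<in>Basis. (v \<bullet> b) *\<^sub>R f b)"
proof -
  have "f v = f (\<Sum>b\<in>Basis. (v \<bullet> b) *\<^sub>R b)" by (simp add: euclidean_representation)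
  also have "\<dots> = (\<Sum>b\<in>Basis. (v \<bullet> b) *\<^sub>R f b)"
    by (simp add: linear_sum[OF assms] linear_cmul[OF assms])
  finally show ?thesis .
qed

text \<open>
  The chain rule is bilinear in the two derivatives, but the derivative of the outer map is
  controlled only in fixed directions; expanding the inner derivative in the standard basis
  turns it into a finite sum to which the induction hypothesis applies.
\<close>

lemma Ck_on_compose:
  fixes f :: "'a::real_normed_vector \<Rightarrow> 'b::euclidean_space"
    and g :: "'b \<Rightarrow> 'c::real_normed_vector"
  assumes "open S" "open T" "f ` S \<subseteq> T" "Ck_on k S f" "Ck_on k T g"
  shows "Ck_on k S (\<lambda>x. g (f x))"
  using assms(4,5)
proof (induction k arbitrary: g)
  case 0
  then show ?case using assms(3) continuous_on_compose2[of T g S f] by simp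
next
  case (Suc k)
  let ?f' = "\<lambda>x. frechet_derivative f (at x)" and ?g' = "\<lambda>y. frechet_derivative g (at y)"
  have fT: "f x \<in> T" if "x \<in> S" for x using that assms(3) by auto
  have "((\<lambda>x. g (f x)) has_derivative (\<lambda>v. ?g' (f x) (?f' x v))) (at x)" if "x \<in> S" for x
    by (rule has_derivative_compose[OF Ck_on_has_derivative[OF Suc.prems(1) that]
          Ck_on_has_derivative[OF Suc.prems(2) fT[OF that]]])
  moreover have "Ck_on k S (\<lambda>x. ?g' (f x) (?f' x v))" for v
  proof (rule Ck_on_cong[OF \<open>open S\<close>])
    show "(\<Sum>b\<in>Basis. (?f' x v \<bullet> b) *\<^sub>R ?g' (f x) b) = ?g' (f x) (?f' x v)" if "x \<in> S" for x
      using linear_expand[of "?g' (f x)" "?f' x v"]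
        Ck_on_has_derivative[OF Suc.prems(2) fT[OF that]]
      by (auto dest: has_derivative_linear)
    show "Ck_on k S (\<lambda>x. \<Sum>b\<in>Basis. (?f' x v \<bullet> b) *\<^sub>R ?g' (f x) b)"
    proof (intro Ck_on_sum Ck_on_scaleR \<open>open S\<close>)
      show "Ck_on k S (\<lambda>x. ?f' x v \<bullet> b)" for b
        by (rule Ck_on_bilinear[OF \<open>open S\<close> bounded_bilinear_inner])
          (use Suc.prems Ck_on_const[OF \<open>open S\<close>] in auto)
      show "Ck_on k S (\<lambda>x. ?g' (f x) b)" for b
        by (rule Suc.IH) (use Suc.prems Ck_on_SucD in auto)
    qed
  qed
  ultimately show ?case by (rule Ck_on_SucI[OF \<open>open S\<close>])
qed

lemma Ck_on_componentwise:
  fixes f :: "'a::real_normed_vector \<Rightarrow> real^'n"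
  assumes "open S" "\<And>i. Ck_on k S (\<lambda>x. f x $ i)"
  shows "Ck_on k S f"
proof -
  have "Ck_on k S (\<lambda>x. (f x $ i) *\<^sub>R (axis i 1 :: real^'n))" for i
    by (rule Ck_on_scaleR[OF assms(1) assms(2) Ck_on_const[OF assms(1)]])
  then have "Ck_on k S (\<lambda>x. \<Sum>i\<in>UNIV. (f x $ i) *\<^sub>R (axis i 1 :: real^'n))"
    by (rule Ck_on_sum[OF assms(1)])
  moreover have "(\<Sum>i\<in>UNIV. (f x $ i) *\<^sub>R axis i 1) = f x" for x
    using basis_expansion[of "f x"] by (simp add: scalar_mult_eq_scaleR)
  ultimately show ?thesis by simp
qed


lemma smooth_onI: "(\<And>k. Ck_on k S f) \<Longrightarrow> smooth_on S f"
  and smooth_onD: "smooth_on S f \<Longrightarrow> Ck_on k S f"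
  unfolding smooth_on_def by blast+

lemma smooth_on_cong:
  assumes "open S" "\<And>x. x \<in> S \<Longrightarrow> f x = g x"
  shows "smooth_on S f \<longleftrightarrow> smooth_on S g"
  unfolding smooth_on_def
  using Ck_on_cong[OF \<open>open S\<close>, of f g] Ck_on_cong[OF \<open>open S\<close>, of g f] assms(2) by metis

lemma smooth_on_subset: "smooth_on S f \<Longrightarrow> T \<subseteq> S \<Longrightarrow> smooth_on T f"
  by (auto simp: smooth_on_def intro: Ck_on_mono)

lemma smooth_on_const: "open S \<Longrightarrow> smooth_on S (\<lambda>x. c)"
  by (simp add: smooth_on_def Ck_on_const)

lemma smooth_on_bounded_linear: "open S \<Longrightarrow> bounded_linear f \<Longrightarrow> smooth_on S f"
  by (simp add: smooth_on_def Ck_on_bounded_linear)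

lemma smooth_on_add: "open S \<Longrightarrow> smooth_on S f \<Longrightarrow> smooth_on S g \<Longrightarrow> smooth_on S (\<lambda>x. f x + g x)"
  by (simp add: smooth_on_def Ck_on_add)

lemma smooth_on_sum:
  "open S \<Longrightarrow> (\<And>i. i \<in> I \<Longrightarrow> smooth_on S (f i)) \<Longrightarrow> smooth_on S (\<lambda>x. \<Sum>i\<in>I. f i x)"
  by (simp add: smooth_on_def Ck_on_sum)

lemma smooth_on_mult:
  fixes f g :: "'a::real_normed_vector \<Rightarrow> real"
  shows "open S \<Longrightarrow> smooth_on S f \<Longrightarrow> smooth_on S g \<Longrightarrow> smooth_on S (\<lambda>x. f x * g x)"
  by (simp add: smooth_on_def Ck_on_mult)

lemma smooth_on_minus:
  fixes f :: "'a::real_normed_vector \<Rightarrow> real"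
  shows "open S \<Longrightarrow> smooth_on S f \<Longrightarrow> smooth_on S (\<lambda>x. - f x)"
  using smooth_on_mult[of S "\<lambda>x. - 1" f] smooth_on_const[of S "- 1 :: real"] by simp

lemma smooth_on_diff:
  fixes f g :: "'a::real_normed_vector \<Rightarrow> real"
  shows "open S \<Longrightarrow> smooth_on S f \<Longrightarrow> smooth_on S g \<Longrightarrow> smooth_on S (\<lambda>x. f x - g x)"
  using smooth_on_add[of S f "\<lambda>x. - g x"] smooth_on_minus[of S g] by simp

lemma smooth_on_power:
  fixes f :: "'a::real_normed_vector \<Rightarrow> real"
  shows "open S \<Longrightarrow> smooth_on S f \<Longrightarrow> smooth_on S (\<lambda>x. f x ^ n)"
  by (induction n) (auto intro: smooth_on_const smooth_on_mult)

lemma smooth_on_compose: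
  fixes f :: "'a::real_normed_vector \<Rightarrow> 'b::euclidean_space"
  shows "open S \<Longrightarrow> open T \<Longrightarrow> f ` S \<subseteq> T \<Longrightarrow> smooth_on S f \<Longrightarrow> smooth_on T g \<Longrightarrow>
    smooth_on S (\<lambda>x. g (f x))"
  unfolding smooth_on_def using Ck_on_compose[of S T f] by blast

lemma smooth_on_componentwise:
  fixes f :: "'a::real_normed_vector \<Rightarrow> real^'n"
  shows "open S \<Longrightarrow> (\<And>i. smooth_on S (\<lambda>x. f x $ i)) \<Longrightarrow> smooth_on S f"
  by (simp add: smooth_on_def Ck_on_componentwise)

lemma smooth_on_nth: "open S \<Longrightarrow> smooth_on S (\<lambda>x. x $ i)"
  by (intro smooth_on_bounded_linear bounded_linear_vec_nth)

lemma smooth_on_has_derivative: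
  "smooth_on S f \<Longrightarrow> x \<in> S \<Longrightarrow> (f has_derivative frechet_derivative f (at x)) (at x)"
  using Ck_on_has_derivative[OF smooth_onD[of S f "Suc 0"]] by blast

lemma smooth_on_frechet_derivative:
  "smooth_on S f \<Longrightarrow> smooth_on S (\<lambda>x. frechet_derivative f (at x) v)"
  by (rule smooth_onI) (use smooth_onD[of S f "Suc k" for k] in simp)

lemma smooth_on_continuous_on: "smooth_on S f \<Longrightarrow> continuous_on S f"
  using smooth_onD[of S f 0] by simp

text \<open>
  A primitive is as smooth as the form that it integrates, so smoothness never has to be extracted
  from the integral that defines the primitive.
\<close>

lemma smooth_on_from_derivative:
  assumes "open S" "\<And>x. x \<in> S \<Longrightarrow> (f has_derivative f' x) (at x)"
    "\<And>v. smooth_on S (\<lambda>x. f' x v)"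
  shows "smooth_on S f"
proof (rule smooth_onI)
  fix k
  have "Ck_on (Suc k) S f"
    by (rule Ck_on_SucI[OF assms(1,2)]) (auto intro: smooth_onD assms(3))
  then show "Ck_on k S f" by (rule Ck_on_SucD)
qed

lemma smooth_on_sin_cos:
  "smooth_on UNIV (sin :: real \<Rightarrow> real)" "smooth_on UNIV (cos :: real \<Rightarrow> real)"
proof -
  have "Ck_on k UNIV (sin :: real \<Rightarrow> real) \<and> Ck_on k UNIV (cos :: real \<Rightarrow> real)" for k
  proof (induction k)
    case 0
    then show ?case by (simp add: continuous_on_sin continuous_on_cos)
  next
    case (Suc k)
    have "Ck_on (Suc k) UNIV (sin :: real \<Rightarrow> real)"
    proof (rule Ck_on_SucI)
      show "(sin has_derivative (\<lambda>v. v * cos x)) (at x)" for x :: real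
        by (auto intro!: derivative_eq_intros)
      show "Ck_on k UNIV (\<lambda>x::real. v * cos x)" for v
        by (rule Ck_on_mult) (use Suc in \<open>simp_all add: Ck_on_const\<close>)
    qed simp
    moreover have "Ck_on (Suc k) UNIV (cos :: real \<Rightarrow> real)"
    proof (rule Ck_on_SucI)
      show "(cos has_derivative (\<lambda>v. (- v) * sin x)) (at x)" for x :: real
        by (auto intro!: derivative_eq_intros)
      show "Ck_on k UNIV (\<lambda>x::real. (- v) * sin x)" for v
        by (rule Ck_on_mult) (use Suc in \<open>simp_all add: Ck_on_const\<close>)
    qed simp
    ultimately show ?case by simp
  qed
  then show "smooth_on UNIV (sin :: real \<Rightarrow> real)" "smooth_on UNIV (cos :: real \<Rightarrow> real)"
    by (auto simp: smooth_on_def)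
qed

lemma smooth_on_inverse: "smooth_on (- {0}) (inverse :: real \<Rightarrow> real)"
proof (rule smooth_onI)
  fix k show "Ck_on k (- {0}) (inverse :: real \<Rightarrow> real)"
  proof (induction k)
    case 0
    then show ?case by (simp add: continuous_on_inverse)
  next
    case (Suc k)
    show ?case
    proof (rule Ck_on_SucI)
      show "(inverse has_derivative (\<lambda>v. (- v) * (inverse x * inverse x))) (at x)"
        if "x \<in> - {0}" for x :: real
        using that by (auto intro!: derivative_eq_intros)
      show "Ck_on k (- {0}) (\<lambda>x::real. (- v) * (inverse x * inverse x))" for v
        by (intro Ck_on_mult Suc Ck_on_const) auto
    qed auto
  qed
qed

lemma smooth_on_inverse_compose:
  fixes f :: "'a::real_normed_vector \<Rightarrow> real"
  assumes "open S" "smooth_on S f" "\<And>x. x \<in> S \<Longrightarrow> f x \<noteq> 0"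
  shows "smooth_on S (\<lambda>x. inverse (f x))"
  by (rule smooth_on_compose[OF assms(1) _ _ assms(2) smooth_on_inverse]) (use assms in auto)

lemma smooth_on_divide:
  fixes f g :: "'a::real_normed_vector \<Rightarrow> real"
  assumes "open S" "smooth_on S f" "smooth_on S g" "\<And>x. x \<in> S \<Longrightarrow> g x \<noteq> 0"
  shows "smooth_on S (\<lambda>x. f x / g x)"
  unfolding divide_inverse
  by (intro smooth_on_mult smooth_on_inverse_compose assms)

lemma smooth_on_sqrt: "smooth_on {0<..} sqrt"
proof (rule smooth_onI)
  fix k show "Ck_on k {0<..} sqrt"
  proof (induction k)
    case 0
    then show ?case by (simp add: continuous_on_real_sqrt)
  next
    case (Suc k)
    show ?case
    proof (rule Ck_on_SucI)
      show "(sqrt has_derivative (\<lambda>v. (v / 2) * inverse (sqrt x))) (at x)"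
        if "x \<in> {0<..}" for x
        using that by (auto intro!: derivative_eq_intros simp: field_simps)
      have "Ck_on k {0<..} (\<lambda>x. inverse (sqrt x))"
        by (rule Ck_on_compose[OF _ _ _ Suc smooth_onD[OF smooth_on_inverse]]) auto
      then show "Ck_on k {0<..} (\<lambda>x. (v / 2) * inverse (sqrt x))" for v
        by (intro Ck_on_mult Ck_on_const) auto
    qed simp
  qed
qed


section \<open>The exterior product\<close>

text \<open>
  Contraction of the first argument and the sign involution.  Contraction is an antiderivation
  of the exterior product, and this property determines the product by recursion over the list of
  arguments.  Unlike the sum over shuffles, the recursion makes associativity and the alternating
  property into short inductions.
\<close>

definition contract :: "'a \<Rightarrow> 'a multiform \<Rightarrow> 'a multiform" where
  "contract v a = (\<lambda>vs. a (v # vs))"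

definition grade_sign :: "'a multiform \<Rightarrow> 'a multiform" where
  "grade_sign a = (\<lambda>vs. (- 1) ^ length vs * a vs)"

fun ext_prod :: "'a multiform \<Rightarrow> 'a multiform \<Rightarrow> 'a multiform" where
  "ext_prod a b [] = a [] * b []"
| "ext_prod a b (v # vs) = ext_prod (contract v a) b vs + ext_prod (grade_sign a) (contract v b) vs"

lemma contract_add: "contract v (a + b) = contract v a + contract v b"
  and contract_grade_sign: "contract v (grade_sign a) = (\<lambda>vs. - grade_sign (contract v a) vs)"
  and grade_sign_add: "grade_sign (a + b) = grade_sign a + grade_sign b"
  by (auto simp: contract_def grade_sign_def fun_eq_iff algebra_simps)

lemma contract_scale: "contract v (\<lambda>vs. r * a vs) = (\<lambda>vs. r * contract v a vs)"
  and grade_sign_scale: "grade_sign (\<lambda>vs. r * a vs) = (\<lambda>vs. r * grade_sign a vs)"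
  by (auto simp: contract_def grade_sign_def fun_eq_iff algebra_simps)

lemma ext_prod_add_left: "ext_prod (a + a') b vs = ext_prod a b vs + ext_prod a' b vs"
  by (induction vs arbitrary: a a' b) (simp_all add: contract_add grade_sign_add algebra_simps)

lemma ext_prod_add_right: "ext_prod a (b + b') vs = ext_prod a b vs + ext_prod a b' vs"
  by (induction vs arbitrary: a b b') (simp_all add: contract_add grade_sign_add algebra_simps)

lemma ext_prod_scale_left: "ext_prod (\<lambda>vs. r * a vs) b vs = r * ext_prod a b vs"
  by (induction vs arbitrary: a b) (simp_all add: contract_scale grade_sign_scale algebra_simps)

lemma ext_prod_scale_right: "ext_prod a (\<lambda>vs. r * b vs) vs = r * ext_prod a b vs"
  by (induction vs arbitrary: a b) (simp_all add: contract_scale grade_sign_scale algebra_simps)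

lemma ext_prod_uminus_left: "ext_prod (\<lambda>vs. - a vs) b vs = - ext_prod a b vs"
  using ext_prod_scale_left[of "- 1" a b vs] by simp

lemma contract_ext_prod:
  "contract v (ext_prod a b) = ext_prod (contract v a) b + ext_prod (grade_sign a) (contract v b)"
  by (auto simp: contract_def fun_eq_iff)

lemma grade_sign_ext_prod: "grade_sign (ext_prod a b) vs = ext_prod (grade_sign a) (grade_sign b) vs"
proof (induction vs arbitrary: a b)
  case Nil
  then show ?case by (simp add: grade_sign_def)
next
  case (Cons v vs)
  have "grade_sign (ext_prod a b) (v # vs) = - grade_sign (contract v (ext_prod a b)) vs"
    by (simp add: grade_sign_def contract_def)
  also have "\<dots> = - (grade_sign (ext_prod (contract v a) b) vs
      + grade_sign (ext_prod (grade_sign a) (contract v b)) vs)"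
    by (simp add: contract_ext_prod grade_sign_add)
  also have "\<dots> = ext_prod (grade_sign a) (grade_sign b) (v # vs)"
    by (simp add: Cons.IH contract_grade_sign ext_prod_uminus_left
        ext_prod_scale_right[of _ "- 1", simplified])
  finally show ?case .
qed

text \<open>
  The contractions of a product of three factors are products of three factors again, so both sides
  satisfy the same recursion.
\<close>

lemma ext_prod_assoc: "ext_prod (ext_prod a b) c vs = ext_prod a (ext_prod b c) vs"
proof (induction vs arbitrary: a b c)
  case (Cons v vs)
  have "grade_sign (ext_prod a b) = ext_prod (grade_sign a) (grade_sign b)"
    by (simp add: fun_eq_iff grade_sign_ext_prod)
  then show ?case
    by (simp add: contract_ext_prod ext_prod_add_left ext_prod_add_right Cons.IH)
qed simp

lemma ext_prod_map: "ext_prod a b (map L vs) = ext_prod (\<lambda>us. a (map L us)) (\<lambda>us. b (map L us)) vs"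
proof (induction vs arbitrary: a b)
  case (Cons v vs)
  have "contract (L v) a (map L us) = contract v (\<lambda>us. a (map L us)) us"
    "grade_sign a (map L us) = grade_sign (\<lambda>us. a (map L us)) us" for a us
    by (simp_all add: contract_def grade_sign_def)
  then show ?case by (simp add: Cons.IH)
qed simp

lemma ext_prod_scalar: "(\<And>vs. vs \<noteq> [] \<Longrightarrow> a vs = 0) \<Longrightarrow> ext_prod a b vs = a [] * b vs"
proof (induction vs arbitrary: a b)
  case (Cons v vs)
  have "contract v a = (\<lambda>us. 0 * contract v a us)"
    using Cons.prems by (auto simp: contract_def)
  then have "ext_prod (contract v a) b vs = 0"
    by (metis ext_prod_scale_left mult_zero_left)
  then show ?case
    using Cons.IH[of "grade_sign a" "contract v b"] Cons.prems
    by (simp add: grade_sign_def contract_def)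
qed simp

text \<open>
  A shuffle either assigns the first position to the first factor, or to the second one; in the
  second case this position creates one inversion with each position of the first factor.
\<close>

lemma ext_prod_eq_shuffle_sum:
  "ext_prod a b vs = (\<Sum>S\<in>Pow {..<length vs}. (- 1) ^ card {(i, j). i \<in> S \<and> j < i \<and> j \<notin> S} *
     a (nths vs S) * b (nths vs ({..<length vs} - S)))"
proof (induction vs arbitrary: a b)
  case Nil
  then show ?case by simp
next
  case (Cons v vs)
  let ?n = "length vs"
  define inv where "inv S = {(i, j). i \<in> S \<and> j < i \<and> j \<notin> S}" for S :: "nat set"
  define f where "f a b us S = (- 1) ^ card (inv S) * a (nths us S) * b (nths us ({..<length us} - S))"
    for a b :: "'a multiform" and us S
  have Pow_Suc: "Pow {..<Suc ?n} = (\<lambda>S. insert 0 (Suc ` S)) ` Pow {..<?n} \<union> (`) Suc ` Pow {..<?n}"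
    (is "?L = ?A \<union> ?B")
  proof
    show "?A \<union> ?B \<subseteq> ?L" by auto
    show "?L \<subseteq> ?A \<union> ?B"
    proof
      fix S assume S: "S \<in> ?L"
      define T where "T = {j. Suc j \<in> S}"
      have "T \<in> Pow {..<?n}" using S by (auto simp: T_def)
      moreover have "S = insert 0 (Suc ` T) \<or> S = Suc ` T"
      proof (cases "0 \<in> S")
        case True
        then have "S = insert 0 (Suc ` T)"
          by (auto simp: T_def image_iff) (metis not0_implies_Suc)
        then show ?thesis ..
      next
        case False
        then have "S = Suc ` T"
          by (auto simp: T_def image_iff) (metis not0_implies_Suc)
        then show ?thesis ..
      qed
      ultimately show "S \<in> ?A \<union> ?B" by blast
    qed
  qed
  have disj: "?A \<inter> ?B = {}" by auto
  have inj: "inj_on (\<lambda>S. insert 0 (Suc ` S)) (Pow {..<?n})" "inj_on ((`) Suc) (Pow {..<?n})"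
    by (auto intro!: inj_onI simp: inj_image_eq_iff)
  have nths0: "nths (v # vs) (insert 0 (Suc ` T)) = v # nths vs T"
    and nthsS: "nths (v # vs) (Suc ` T) = nths vs T" for T
    by (simp_all add: nths_Cons image_iff)
  have compl0: "{..<Suc ?n} - insert 0 (Suc ` T) = Suc ` ({..<?n} - T)"
    and complS: "{..<Suc ?n} - Suc ` T = insert 0 (Suc ` ({..<?n} - T))" for T
    by (auto simp: lessThan_Suc_eq_insert_0 image_set_diff)
  have inj_map: "inj_on (map_prod Suc Suc) R" for R
    by (auto intro: inj_onI)
  have inv0: "card (inv (insert 0 (Suc ` T))) = card (inv T)" for T
  proof -
    have "(i, j) \<in> inv (insert 0 (Suc ` T)) \<longleftrightarrow> (i, j) \<in> map_prod Suc Suc ` inv T" for i j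
      by (cases i; cases j) (auto simp: inv_def)
    then have "inv (insert 0 (Suc ` T)) = map_prod Suc Suc ` inv T"
      by (intro set_eqI) (metis surj_pair)
    then show ?thesis
      by (simp add: card_image[OF inj_map])
  qed
  have invS: "card (inv (Suc ` T)) = card T + card (inv T)" if T: "T \<subseteq> {..<?n}" for T
  proof -
    have "(i, j) \<in> inv (Suc ` T) \<longleftrightarrow> (i, j) \<in> map_prod Suc Suc ` inv T \<union> (\<lambda>i. (Suc i, 0)) ` T"
      for i j
      by (cases i; cases j) (auto simp: inv_def)
    then have "inv (Suc ` T) = map_prod Suc Suc ` inv T \<union> (\<lambda>i. (Suc i, 0)) ` T"
      by (intro set_eqI) (metis surj_pair)
    moreover have "finite T" using T finite_subset by blast
    moreover have "finite (inv T)"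
      by (rule finite_subset[of _ "T \<times> {..<?n}"]) (use T \<open>finite T\<close> in \<open>auto simp: inv_def\<close>)
    moreover have "map_prod Suc Suc ` inv T \<inter> (\<lambda>i. (Suc i, 0)) ` T = {}" by auto
    moreover have "card ((\<lambda>i. (Suc i, 0 :: nat)) ` T) = card T"
      by (rule card_image) (auto intro: inj_onI)
    ultimately show ?thesis
      by (simp add: card_Un_disjoint card_image[OF inj_map])
  qed
  have "(\<Sum>S\<in>Pow {..<length (v # vs)}. f a b (v # vs) S)
      = (\<Sum>T\<in>Pow {..<?n}. f a b (v # vs) (insert 0 (Suc ` T)))
        + (\<Sum>T\<in>Pow {..<?n}. f a b (v # vs) (Suc ` T))"
    by (simp add: Pow_Suc sum.union_disjoint[OF _ _ disj] sum.reindex[OF inj(1)]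
        sum.reindex[OF inj(2)])
  also have "(\<Sum>T\<in>Pow {..<?n}. f a b (v # vs) (insert 0 (Suc ` T)))
      = (\<Sum>T\<in>Pow {..<?n}. f (contract v a) b vs T)"
    by (rule sum.cong) (auto simp: f_def inv0 nths0 compl0 nthsS contract_def)
  also have "(\<Sum>T\<in>Pow {..<?n}. f a b (v # vs) (Suc ` T))
      = (\<Sum>T\<in>Pow {..<?n}. f (grade_sign a) (contract v b) vs T)"
  proof (rule sum.cong)
    fix T assume T: "T \<in> Pow {..<?n}"
    then have "{i. i < ?n \<and> i \<in> T} = T" by auto
    then have "length (nths vs T) = card T" by (simp add: length_nths)
    then show "f a b (v # vs) (Suc ` T) = f (grade_sign a) (contract v b) vs T"
      using T by (simp add: f_def invS nths0 complS nthsS contract_def grade_sign_def power_add)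
  qed simp
  also have "(\<Sum>T\<in>Pow {..<?n}. f (contract v a) b vs T)
      + (\<Sum>T\<in>Pow {..<?n}. f (grade_sign a) (contract v b) vs T) = ext_prod a b (v # vs)"
    by (simp add: Cons.IH f_def inv_def)
  finally show ?case by (simp add: f_def inv_def)
qed

lemma wedge_eq_ext_prod: "(\<alpha> \<and>\<^sub>w \<beta>) x = ext_prod (\<alpha> x) (\<beta> x)"
  by (simp add: wedge_def fun_eq_iff ext_prod_eq_shuffle_sum)


subsection \<open>Alternating multilinear maps\<close>

text \<open>
  A multilinear map that vanishes on lists with equal neighbours changes sign under neighbour
  transpositions, so two equal entries can be moved next to each other.
\<close>

lemma alternating_multilinear_adjacentI:
  assumes lin: "\<And>us ws. linear (\<lambda>v. a (us @ v # ws))"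
    and adj: "\<And>us v ws. a (us @ v # v # ws) = 0"
  shows "alternating_multilinear a"
proof -
  have swap: "a (us @ v # w # ws) = - a (us @ w # v # ws)" for us v w ws
  proof -
    have l1: "a (us @ (x + y) # zs) = a (us @ x # zs) + a (us @ y # zs)" for x y us zs
      using linear_add[OF lin[of us zs]] .
    have l2: "a (us @ u # (x + y) # zs) = a (us @ u # x # zs) + a (us @ u # y # zs)"
      for u x y us zs
      using l1[of "us @ [u]"] by simp
    have "0 = a (us @ (v + w) # (v + w) # ws)" by (simp only: adj)
    also have "\<dots> = a (us @ v # w # ws) + a (us @ w # v # ws)"
      unfolding l1 l2 by (simp add: adj)
    finally show ?thesis by simp
  qed
  have "a (xs @ y # ys @ y # zs) = 0" for xs y ys zs
  proof (induction ys arbitrary: xs)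
    case (Cons u ys)
    then show ?case using swap[of xs y u "ys @ y # zs"] Cons.IH[of "xs @ [u]"] by simp
  qed (simp add: adj)
  then have "a vs = 0" if "\<not> distinct vs" for vs
    using not_distinct_decomp[OF that] by auto
  then show ?thesis using lin by (simp add: alternating_multilinear_def)
qed

lemma alternating_multilinear_linear:
  "alternating_multilinear a \<Longrightarrow> linear (\<lambda>v. a (us @ v # ws))"
  and alternating_multilinear_not_distinct:
  "alternating_multilinear a \<Longrightarrow> \<not> distinct vs \<Longrightarrow> a vs = 0"
  by (auto simp: alternating_multilinear_def)

lemma alternating_multilinear_contract:
  assumes "alternating_multilinear a"
  shows "alternating_multilinear (contract v a)"
  unfolding alternating_multilinear_def contract_def
  using alternating_multilinear_linear[OF assms, of "v # us" for us]
    alternating_multilinear_not_distinct[OF assms] by simp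

lemma alternating_multilinear_grade_sign:
  assumes "alternating_multilinear a"
  shows "alternating_multilinear (grade_sign a)"
proof -
  have "linear (\<lambda>v. (- 1) ^ length (us @ v # ws) * a (us @ v # ws))" for us ws
    using linear_compose_scale_right[OF alternating_multilinear_linear[OF assms, of us ws],
        of "(- 1) ^ Suc (length us + length ws)"]
    by simp
  then show ?thesis
    using alternating_multilinear_not_distinct[OF assms]
    by (simp add: alternating_multilinear_def grade_sign_def del: length_append)
qed

lemma linear_ext_prod:
  assumes "alternating_multilinear a" "alternating_multilinear b"
  shows "linear (\<lambda>v. ext_prod a b (us @ v # ws))"
  using assms
proof (induction us arbitrary: a b)
  case Nil
  have *: "contract (x + y) a = contract x a + contract y a"
    "contract (r *\<^sub>R x) a = (\<lambda>vs. r * contract x a vs)"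
    if "alternating_multilinear a" for x y r and a :: "'a multiform"
    using linear_add[OF alternating_multilinear_linear[OF that, of "[]"]]
      linear_cmul[OF alternating_multilinear_linear[OF that, of "[]"]]
    by (auto simp: contract_def fun_eq_iff)
  show ?case
    by (rule linearI) (simp_all add: *[OF Nil(1)] *[OF Nil(2)] ext_prod_add_left ext_prod_add_right
        ext_prod_scale_left ext_prod_scale_right algebra_simps)
next
  case (Cons u us)
  then show ?case
    by (auto intro!: linear_compose_add Cons.IH alternating_multilinear_contract
        alternating_multilinear_grade_sign)
qed

text \<open>
  Two equal arguments at the head of the list leave two mixed terms, which cancel because contraction
  anticommutes with the sign involution; a common prefix is absorbed into the factors.
\<close>

lemma alternating_multilinear_ext_prod:
  assumes "alternating_multilinear a" "alternating_multilinear b"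
  shows "alternating_multilinear (ext_prod a b)"
proof (rule alternating_multilinear_adjacentI)
  show "linear (\<lambda>v. ext_prod a b (us @ v # ws))" for us ws
    by (rule linear_ext_prod[OF assms])
  show "ext_prod a b (us @ v # v # ws) = 0" for us v ws
    using assms
  proof (induction us arbitrary: a b)
    case Nil
    have *: "contract v (contract v a) = (\<lambda>us. 0 * a us)"
      if "alternating_multilinear a" for a :: "'a multiform"
      using alternating_multilinear_not_distinct[OF that] by (auto simp: contract_def)
    have "grade_sign (grade_sign a) = a" by (auto simp: grade_sign_def simp flip: power_add mult.assoc)
    then show ?case
      using Nil
      by (simp add: * ext_prod_scale_left[of 0, simplified] ext_prod_scale_right[of _ 0, simplified]
          contract_grade_sign ext_prod_uminus_left)
  next
    case (Cons u us)
    then show ?case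
      by (simp add: alternating_multilinear_contract alternating_multilinear_grade_sign)
  qed
qed


section \<open>Closed one-forms and local inverses\<close>

text \<open>
  The primitive is the integral of the form along the segments from a base point; differentiating
  under the integral sign and using that the derivative is symmetric, the integrand becomes a total
  derivative along the segment.
\<close>

lemma closed_one_form_exact:
  fixes \<omega> :: "'a::euclidean_space \<Rightarrow> 'a \<Rightarrow> real"
  assumes "open S" "convex S"
    and lin: "\<And>x. x \<in> S \<Longrightarrow> linear (\<omega> x)"
    and smooth: "\<And>v. smooth_on S (\<lambda>x. \<omega> x v)"
    and closed: "\<And>x v w. x \<in> S \<Longrightarrow> frechet_derivative (\<lambda>y. \<omega> y w) (at x) v
        = frechet_derivative (\<lambda>y. \<omega> y v) (at x) w"
  obtains f where "\<And>x. x \<in> S \<Longrightarrow> (f has_derivative \<omega> x) (at x)" "smooth_on S f"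
proof (cases "S = {}")
  case True
  then show ?thesis using that[of "\<lambda>_. 0"] smooth_on_const[of S "0 :: real"] by simp
next
  case False
  then obtain a where a: "a \<in> S" by auto
  define D where "D v x = frechet_derivative (\<lambda>y. \<omega> y v) (at x)" for v x
  have D: "((\<lambda>y. \<omega> y v) has_derivative D v x) (at x)" if "x \<in> S" for v x
    unfolding D_def using smooth_on_has_derivative[OF smooth that] .
  have seg: "a + t *\<^sub>R (x - a) \<in> S" if "x \<in> S" "t \<in> {0..1}" for x t
    using convexD_alt[OF \<open>convex S\<close> a that(1), of t] that(2) by (simp add: algebra_simps)
  define F where "F x t = \<omega> (a + t *\<^sub>R (x - a)) (x - a)" for x t
  define G where "G x t v = t * D (x - a) (a + t *\<^sub>R (x - a)) v + \<omega> (a + t *\<^sub>R (x - a)) v"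
    for x t v
  have F_expand: "F x t = (\<Sum>b\<in>Basis. ((x - a) \<bullet> b) * \<omega> (a + t *\<^sub>R (x - a)) b)"
    if "x \<in> S" "t \<in> {0..1}" for x t
    unfolding F_def using linear_expand[OF lin[OF seg[OF that]], of "x - a"] by simp
  have D_expand: "D w y v = (\<Sum>b\<in>Basis. (w \<bullet> b) * D b y v)" if "y \<in> S" for w y v
  proof -
    have "((\<lambda>y. \<Sum>b\<in>Basis. (w \<bullet> b) * \<omega> y b) has_derivative
        (\<lambda>v. \<Sum>b\<in>Basis. (w \<bullet> b) * D b y v)) (at y)"
      by (intro has_derivative_sum has_derivative_mult_right D that)
    then have "((\<lambda>y. \<omega> y w) has_derivative (\<lambda>v. \<Sum>b\<in>Basis. (w \<bullet> b) * D b y v)) (at y)"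
      by (rule has_derivative_transform_within_open[OF _ \<open>open S\<close> that])
        (use linear_expand[OF lin, of _ w] in simp)
    then show ?thesis
      using has_derivative_unique[OF D[OF that]] by metis
  qed
  have G_deriv: "((\<lambda>x. F x t) has_derivative G x t) (at x)" if "x \<in> S" "t \<in> {0..1}" for x t
  proof -
    have aff: "((\<lambda>x. a + t *\<^sub>R (x - a)) has_derivative (\<lambda>v. t *\<^sub>R v)) (at x)"
      by (auto intro!: derivative_eq_intros)
    have "((\<lambda>x. \<Sum>b\<in>Basis. ((x - a) \<bullet> b) * \<omega> (a + t *\<^sub>R (x - a)) b) has_derivative
       (\<lambda>v. \<Sum>b\<in>Basis. ((x - a) \<bullet> b) * D b (a + t *\<^sub>R (x - a)) (t *\<^sub>R v)
          + (v \<bullet> b) * \<omega> (a + t *\<^sub>R (x - a)) b)) (at x)"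
    proof (intro has_derivative_sum has_derivative_mult)
      show "((\<lambda>x. (x - a) \<bullet> b) has_derivative (\<lambda>v. v \<bullet> b)) (at x)" for b
        by (auto intro!: derivative_eq_intros)
      show "((\<lambda>x. \<omega> (a + t *\<^sub>R (x - a)) b) has_derivative
          (\<lambda>v. D b (a + t *\<^sub>R (x - a)) (t *\<^sub>R v))) (at x)" for b
        using has_derivative_compose[OF aff D[OF seg[OF that]]] .
    qed
    then have "((\<lambda>x. F x t) has_derivative
       (\<lambda>v. \<Sum>b\<in>Basis. ((x - a) \<bullet> b) * D b (a + t *\<^sub>R (x - a)) (t *\<^sub>R v)
          + (v \<bullet> b) * \<omega> (a + t *\<^sub>R (x - a)) b)) (at x)"
      by (rule has_derivative_transform_within_open[OF _ \<open>open S\<close> that(1)])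
        (rule F_expand[symmetric, OF _ that(2)])
    moreover have "(\<lambda>v. \<Sum>b\<in>Basis. ((x - a) \<bullet> b) * D b (a + t *\<^sub>R (x - a)) (t *\<^sub>R v)
          + (v \<bullet> b) * \<omega> (a + t *\<^sub>R (x - a)) b) = G x t"
    proof
      fix v
      have "D b (a + t *\<^sub>R (x - a)) (t *\<^sub>R v) = t * D b (a + t *\<^sub>R (x - a)) v" for b
        using linear_cmul[OF has_derivative_linear[OF D[OF seg[OF that]]]] by simp
      then show "(\<Sum>b\<in>Basis. ((x - a) \<bullet> b) * D b (a + t *\<^sub>R (x - a)) (t *\<^sub>R v)
          + (v \<bullet> b) * \<omega> (a + t *\<^sub>R (x - a)) b) = G x t v"
        unfolding G_def D_expand[OF seg[OF that], of "x - a"]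
        using linear_expand[OF lin[OF seg[OF that]], of v]
        by (simp add: sum.distrib sum_distrib_left ac_simps)
    qed
    ultimately show ?thesis by (rule has_derivative_eq_rhs)
  qed
  \<comment> \<open>The derivative as a bounded linear map, in the form in which its continuity is visible.\<close>
  define GB where "GB x t = (\<Sum>b\<in>Basis. G x t b *\<^sub>R blinfun_inner_right b)" for x t
  have lin_G: "linear (G x t)" if "x \<in> S" "t \<in> {0..1}" for x t
    using has_derivative_linear[OF G_deriv[OF that]] .
  have GB: "blinfun_apply (GB x t) = G x t" if "x \<in> S" "t \<in> {0..1}" for x t
  proof
    show "GB x t v = G x t v" for v
      using linear_expand[OF lin_G[OF that], of v]
      by (simp add: GB_def blinfun.sum_left blinfun.scaleR_left mult.commute inner_commute)
  qed
  have cont_aff: "continuous_on (S \<times> {0..1}) (\<lambda>(x, t). h (a + t *\<^sub>R (x - a)))"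
    if "smooth_on S h" for h :: "'a \<Rightarrow> real"
    unfolding split_def
    by (rule continuous_on_compose2[OF smooth_on_continuous_on[OF that]])
      (auto intro!: continuous_intros seg)
  have cont_G: "continuous_on (S \<times> {0..1}) (\<lambda>(x, t). G x t v)" for v
  proof -
    have "continuous_on (S \<times> {0..1}) (\<lambda>(x, t). t * (\<Sum>b\<in>Basis. ((x - a) \<bullet> b) *
        D b (a + t *\<^sub>R (x - a)) v) + \<omega> (a + t *\<^sub>R (x - a)) v)"
      unfolding split_def
      by (intro continuous_intros cont_aff[unfolded split_def] smooth)
        (unfold D_def, rule smooth_on_frechet_derivative[OF smooth])
    then show ?thesis
      by (rule continuous_on_eq) (auto simp: G_def D_expand[OF seg, of _ _ "_ - a"])
  qed
  have cont_F: "continuous_on {0..1} (F x)" if "x \<in> S" for x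
  proof -
    have "continuous_on {0..1} (\<lambda>t. \<omega> (a + t *\<^sub>R (x - a)) (x - a))"
      by (rule continuous_on_compose2[OF smooth_on_continuous_on[OF smooth]])
        (auto intro!: continuous_intros seg that)
    then show ?thesis unfolding F_def .
  qed
  define f where "f x = integral (cbox 0 1) (F x)" for x
  have f_der: "(f has_derivative \<omega> x) (at x)" if x: "x \<in> S" for x
  proof -
    have "((\<lambda>x. integral (cbox 0 1) (F x)) has_derivative integral (cbox 0 1) (GB x)) (at x within S)"
    proof (rule leibniz_rule[OF _ _ _ x \<open>convex S\<close>])
      show "((\<lambda>x. F x t) has_derivative blinfun_apply (GB x t)) (at x within S)"
        if "x \<in> S" "t \<in> cbox 0 1" for x t
        using G_deriv[of x t] GB[of x t] that has_derivative_at_withinI by (metis cbox_interval)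
      show "F x integrable_on cbox 0 1" if "x \<in> S" for x
        using integrable_continuous_interval[OF cont_F[OF that]] by simp
      show "continuous_on (S \<times> cbox 0 1) (\<lambda>(x, t). GB x t)"
        unfolding GB_def split_def cbox_interval
        by (intro continuous_intros cont_G[unfolded split_def])
    qed
    moreover have "blinfun_apply (integral (cbox 0 1) (GB x)) = \<omega> x"
    proof
      fix v
      have contGB: "continuous_on {0..1} (GB x)"
        unfolding GB_def
        by (intro continuous_intros continuous_on_compose2[OF cont_G[unfolded split_def], of _ "\<lambda>t. (x, t)", simplified])
          (use x in auto)
      have "integral {0..1} (GB x) v = integral {0..1} (\<lambda>t. GB x t v)"
        by (rule blinfun_apply_integral[OF integrable_continuous_interval[OF contGB]])
      also have "\<dots> = integral {0..1} (\<lambda>t. G x t v)"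
        by (rule integral_cong) (simp add: GB x)
      also have "\<dots> = 1 * \<omega> (a + 1 *\<^sub>R (x - a)) v - 0 * \<omega> (a + 0 *\<^sub>R (x - a)) v"
      proof (rule integral_unique, rule fundamental_theorem_of_calculus)
        show "((\<lambda>t. t * \<omega> (a + t *\<^sub>R (x - a)) v) has_vector_derivative G x t v) (at t within {0..1})"
          if t: "t \<in> {0..1}" for t
        proof -
          have "((\<lambda>t. a + t *\<^sub>R (x - a)) has_derivative (\<lambda>s. s *\<^sub>R (x - a))) (at t within {0..1})"
            by (auto intro!: derivative_eq_intros)
          from has_derivative_compose[OF this D[OF seg[OF x t]]]
          have "((\<lambda>t. \<omega> (a + t *\<^sub>R (x - a)) v) has_derivative
              (\<lambda>s. D v (a + t *\<^sub>R (x - a)) (s *\<^sub>R (x - a)))) (at t within {0..1})" .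
          moreover have "D v (a + t *\<^sub>R (x - a)) (s *\<^sub>R (x - a))
              = s * D (x - a) (a + t *\<^sub>R (x - a)) v" for s
            using linear_cmul[OF has_derivative_linear[OF D[OF seg[OF x t]]]]
              closed[OF seg[OF x t], of "x - a" v]
            by (simp add: D_def)
          ultimately show ?thesis
            unfolding has_vector_derivative_def G_def
            by (auto intro!: derivative_eq_intros simp: algebra_simps)
        qed
      qed simp
      finally show "integral (cbox 0 1) (GB x) v = \<omega> x v" by simp
    qed
    ultimately have "(f has_derivative \<omega> x) (at x within S)"
      unfolding f_def[abs_def] by (rule has_derivative_eq_rhs)
    then show ?thesis using at_within_open[OF x \<open>open S\<close>] by simp
  qed
  then show ?thesis
    using that smooth_on_from_derivative[OF \<open>open S\<close> f_der smooth] by blast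
qed

text \<open>
  The derivative of the inverse solves a linear system; by Cramer's rule its entries are rational
  in those of the derivative of the map, so each degree of differentiability of the inverse gives the
  next one.
\<close>

lemma smooth_local_inverse:
  fixes g :: "real^'n \<Rightarrow> real^'n"
  assumes "open S" "smooth_on S g" "x0 \<in> S" "inj (frechet_derivative g (at x0))"
  obtains V where "open V" "x0 \<in> V" "V \<subseteq> S" "diffeomorphism V (g ` V) g"
proof -
  let ?g' = "\<lambda>x. frechet_derivative g (at x)"
  have der: "(g has_derivative ?g' x) (at x)" if "x \<in> S" for x
    using smooth_on_has_derivative[OF assms(2) that] .
  have bl: "bounded_linear (?g' x)" if "x \<in> S" for x
    using has_derivative_bounded_linear[OF der[OF that]] .
  define g'B where "g'B x = (\<Sum>b\<in>Basis. blinfun_scaleR_left (?g' x b) o\<^sub>L blinfun_inner_right b)" for x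
  have g'B: "blinfun_apply (g'B x) = ?g' x" if "x \<in> S" for x
  proof
    show "g'B x v = ?g' x v" for v
      using linear_expand[OF bounded_linear.linear[OF bl[OF that]], of v]
      by (simp add: g'B_def blinfun.sum_left inner_commute)
  qed
  have cont: "continuous_on S g'B"
    unfolding g'B_def
    by (intro continuous_intros bounded_linear.continuous_on[OF bounded_linear_blinfun_scaleR_left]
        smooth_on_continuous_on[OF smooth_on_frechet_derivative[OF assms(2)]])
  have "linear (?g' x0)" using bl[OF assms(3)] by (rule bounded_linear.linear)
  then obtain L where L: "linear L" "L \<circ> ?g' x0 = id"
    using linear_injective_left_inverse[OF _ assms(4)] by blast
  then have inv: "Blinfun L o\<^sub>L g'B x0 = id_blinfun"
    by (intro blinfun_eqI)
      (simp add: g'B[OF assms(3)] bounded_linear_Blinfun_apply linear_linear pointfree_idE)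
  obtain V W h h' where V: "open V" "V \<subseteq> S" "x0 \<in> V" "open W" "homeomorphism V W g h"
    and h': "\<And>y. y \<in> W \<Longrightarrow> (h has_derivative h' y) (at y)"
    "\<And>y. y \<in> W \<Longrightarrow> h' y = inv (blinfun_apply (g'B (h y)))"
    "\<And>y. y \<in> W \<Longrightarrow> bij (blinfun_apply (g'B (h y)))"
    using inverse_function_theorem[OF \<open>open S\<close> _ cont assms(3) inv] der g'B by metis
  have hV: "h y \<in> V" if "y \<in> W" for y
    using V(5) that unfolding homeomorphism_def by auto
  have W: "W = g ` V" using V(5) by (simp add: homeomorphism_def)
  have hg: "h (g x) = x" if "x \<in> V" for x
    using V(5) that by (simp add: homeomorphism_def)
  define M where "M x = matrix (?g' x)" for x
  have M: "M x *v v = ?g' x v" if "x \<in> S" for x v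
    unfolding M_def
    using matrix_works bounded_linear.linear[OF bl[OF that]] linear_matrix_vector_mul_eq by blast
  have M_entry: "M x $ i $ j = ?g' x (axis j 1) $ i" for x i j
    by (simp add: M_def matrix_def)
  have hS: "h y \<in> S" if "y \<in> W" for y using hV[OF that] V(2) by blast
  have bij_g': "bij (?g' (h y))" if "y \<in> W" for y
    using h'(3)[OF that] g'B[OF hS[OF that]] by simp
  have det: "det (M (h y)) \<noteq> 0" if "y \<in> W" for y
  proof -
    have "(\<lambda>v. M (h y) *v v) = ?g' (h y)"
      using M[OF hS[OF that]] by auto
    then have "inj ((*v) (M (h y)))" using bij_g'[OF that] bij_is_inj by metis
    then show ?thesis
      using invertible_det_nz invertible_left_inverse matrix_left_invertible_injective
      by blast
  qed
  have h'_eq: "h' y v = (\<chi> k. det (\<chi> i j. if j = k then v $ i else M (h y) $ i $ j) / det (M (h y)))"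
    if "y \<in> W" for y v
  proof -
    have "M (h y) *v h' y v = v"
      using M[OF hS[OF that]] h'(2)[OF that] g'B[OF hS[OF that]] bij_g'[OF that]
      by (simp add: bij_is_surj surj_f_inv_f)
    then show ?thesis using cramer[OF det[OF that], of "h' y v" v] by simp
  qed
  have det_Ck: "Ck_on k W (\<lambda>y. det (\<chi> i j. B y i j))"
    if "\<And>i j. Ck_on k W (\<lambda>y. B y i j)" for k and B :: "_ \<Rightarrow> 'n \<Rightarrow> 'n \<Rightarrow> real"
  proof -
    have prod: "Ck_on k W (\<lambda>y. \<Prod>i\<in>I. B y i (p i))" for I p
      by (induction I rule: infinite_finite_induct)
        (auto intro: Ck_on_const Ck_on_mult that \<open>open W\<close>)
    show ?thesis
      unfolding det_def
      by (simp, intro Ck_on_sum Ck_on_mult Ck_on_const prod \<open>open W\<close>)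
  qed
  have "Ck_on k W h" for k
  proof (induction k)
    case 0
    then show ?case using V(5) by (simp add: homeomorphism_def)
  next
    case (Suc k)
    have M_Ck: "Ck_on k W (\<lambda>y. M (h y) $ i $ j)" for i j
    proof -
      have "Ck_on k W (\<lambda>y. ?g' (h y) (axis j 1))"
        by (rule Ck_on_compose[OF \<open>open W\<close> \<open>open S\<close> _ Suc smooth_onD[OF
                smooth_on_frechet_derivative[OF assms(2)]]]) (use hS in auto)
      then show ?thesis
        unfolding M_entry
        by (rule Ck_on_compose[OF \<open>open W\<close> open_UNIV _ _ Ck_on_bounded_linear, rotated])
          (auto intro: bounded_linear_vec_nth)
    qed
    show ?case
    proof (rule Ck_on_SucI[OF \<open>open W\<close> h'(1)])
      show "Ck_on k W (\<lambda>y. h' y v)" for v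
      proof (rule Ck_on_cong[OF \<open>open W\<close>])
        show "(\<chi> l. det (\<chi> i j. if j = l then v $ i else M (h y) $ i $ j) / det (M (h y))) = h' y v"
          if "y \<in> W" for y
          using h'_eq[OF that] by simp
        have detM: "Ck_on k W (\<lambda>y. det (M (h y)))"
          using det_Ck[of k "\<lambda>y i j. M (h y) $ i $ j", OF M_Ck] by simp
        show "Ck_on k W (\<lambda>y. \<chi> l. det (\<chi> i j. if j = l then v $ i else M (h y) $ i $ j)
            / det (M (h y)))"
        proof (rule Ck_on_componentwise[OF \<open>open W\<close>], unfold vec_lambda_beta divide_inverse,
            rule Ck_on_mult[OF \<open>open W\<close>])
          have "Ck_on k W (\<lambda>y. if j = l then v $ i else M (h y) $ i $ j)" for i j l
            by (cases "j = l") (simp_all add: M_Ck Ck_on_const[OF \<open>open W\<close>])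
          then show "Ck_on k W (\<lambda>y. det (\<chi> i j. if j = l then v $ i else M (h y) $ i $ j))" for l
            by (rule det_Ck)
          show "Ck_on k W (\<lambda>y. inverse (det (M (h y))))"
            by (rule Ck_on_compose[OF \<open>open W\<close> _ _ detM smooth_onD[OF smooth_on_inverse]])
              (use det in auto)
        qed
      qed
    qed
  qed
  then have "smooth_on W h" by (simp add: smooth_on_def)
  moreover have inv_eq: "inv_into V g y = h y" if "y \<in> W" for y
    using that hV[OF that] V(5)
    by (metis W hg homeomorphism_def inj_onI inv_into_f_f)
  ultimately have "smooth_on (g ` V) (inv_into V g)"
    using smooth_on_cong[OF \<open>open W\<close>, of h "inv_into V g"] W by auto
  moreover have "bij_betw g V (g ` V)"
    by (rule inj_on_imp_bij_betw) (metis hg inj_onI)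
  ultimately have "diffeomorphism V (g ` V) g"
    unfolding diffeomorphism_def
    using V(1,2,4) W smooth_on_subset[OF assms(2)] by simp
  then show ?thesis using that V(1-3) by blast
qed


section \<open>Forms and generated ideals\<close>

lemma sum_fun_at: "(\<Sum>i\<in>I. f i) x = (\<Sum>i\<in>I. f i x)"
  for f :: "'i \<Rightarrow> 'b \<Rightarrow> 'c::comm_monoid_add"
  by (induction I rule: infinite_finite_induct) simp_all

lemma forms_onI:
  "(\<And>x. x \<in> U \<Longrightarrow> alternating_multilinear (\<omega> x)) \<Longrightarrow> (\<And>vs. smooth_on U (\<lambda>x. \<omega> x vs)) \<Longrightarrow>
    \<omega> \<in> forms_on U"
  and forms_on_alternating: "\<omega> \<in> forms_on U \<Longrightarrow> x \<in> U \<Longrightarrow> alternating_multilinear (\<omega> x)"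
  and forms_on_smooth: "\<omega> \<in> forms_on U \<Longrightarrow> smooth_on U (\<lambda>x. \<omega> x vs)"
  by (auto simp: forms_on_def)

lemma forms_on_cong:
  assumes "open U" "\<omega> \<in> forms_on U" "\<And>x. x \<in> U \<Longrightarrow> \<omega>' x = \<omega> x"
  shows "\<omega>' \<in> forms_on U"
proof (rule forms_onI)
  show "alternating_multilinear (\<omega>' x)" if "x \<in> U" for x
    using forms_on_alternating[OF assms(2) that] assms(3)[OF that] by simp
  show "smooth_on U (\<lambda>x. \<omega>' x vs)" for vs
    using smooth_on_cong[OF assms(1), of "\<lambda>x. \<omega>' x vs" "\<lambda>x. \<omega> x vs"] assms(3)
      forms_on_smooth[OF assms(2)] by simp
qed

lemma forms_on_subset: "\<omega> \<in> forms_on U \<Longrightarrow> V \<subseteq> U \<Longrightarrow> \<omega> \<in> forms_on V"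
  by (auto simp: forms_on_def intro: smooth_on_subset)

lemma alternating_multilinear_add:
  "alternating_multilinear a \<Longrightarrow> alternating_multilinear b \<Longrightarrow> alternating_multilinear (a + b)"
  by (simp add: alternating_multilinear_def linear_compose_add)

lemma alternating_multilinear_scale:
  assumes "alternating_multilinear a"
  shows "alternating_multilinear (\<lambda>vs. r * a vs)"
  using linear_compose_scale_right[OF alternating_multilinear_linear[OF assms], of r]
    alternating_multilinear_not_distinct[OF assms]
  by (simp add: alternating_multilinear_def)

lemma forms_on_add:
  "open U \<Longrightarrow> \<alpha> \<in> forms_on U \<Longrightarrow> \<beta> \<in> forms_on U \<Longrightarrow> \<alpha> + \<beta> \<in> forms_on U"
  by (rule forms_onI)
    (simp_all add: alternating_multilinear_add smooth_on_add forms_on_alternating forms_on_smooth)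

lemma forms_on_scale:
  "open U \<Longrightarrow> smooth_on U f \<Longrightarrow> \<alpha> \<in> forms_on U \<Longrightarrow> f \<cdot> \<alpha> \<in> forms_on U"
  unfolding scale_form_def
  by (rule forms_onI)
    (simp_all add: alternating_multilinear_scale smooth_on_mult forms_on_alternating forms_on_smooth)

lemma forms_on_zero_form:
  assumes "open U" "smooth_on U f"
  shows "zero_form f \<in> forms_on U"
proof (rule forms_onI)
  show "alternating_multilinear (zero_form f x)" for x
    by (auto simp: alternating_multilinear_def zero_form_def module_hom_zero)
  show "smooth_on U (\<lambda>x. zero_form f x vs)" for vs
    using assms smooth_on_const[of U "0 :: real"] by (cases "vs = []") (simp_all add: zero_form_def)
qed

lemma forms_on_wedge:
  assumes "open U" "\<alpha> \<in> forms_on U" "\<beta> \<in> forms_on U"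
  shows "\<alpha> \<and>\<^sub>w \<beta> \<in> forms_on U"
proof (rule forms_onI)
  show "alternating_multilinear ((\<alpha> \<and>\<^sub>w \<beta>) x)" if "x \<in> U" for x
    unfolding wedge_eq_ext_prod
    by (intro alternating_multilinear_ext_prod assms(2,3)[THEN forms_on_alternating] that)
  show "smooth_on U (\<lambda>x. (\<alpha> \<and>\<^sub>w \<beta>) x vs)" for vs
    unfolding wedge_def
    by (intro smooth_on_sum smooth_on_mult smooth_on_const assms forms_on_smooth)
qed

lemma wedge_cong: "\<alpha> x = \<alpha>' x \<Longrightarrow> \<beta> x = \<beta>' x \<Longrightarrow> (\<alpha> \<and>\<^sub>w \<beta>) x = (\<alpha>' \<and>\<^sub>w \<beta>') x"
  by (simp add: wedge_eq_ext_prod)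

lemma wedge_assoc: "(\<alpha> \<and>\<^sub>w \<beta>) \<and>\<^sub>w \<gamma> = \<alpha> \<and>\<^sub>w (\<beta> \<and>\<^sub>w \<gamma>)"
  by (simp add: fun_eq_iff wedge_eq_ext_prod ext_prod_assoc)

lemma wedge_add_left: "(\<alpha> + \<alpha>') \<and>\<^sub>w \<beta> = \<alpha> \<and>\<^sub>w \<beta> + \<alpha>' \<and>\<^sub>w \<beta>"
  by (simp add: fun_eq_iff wedge_eq_ext_prod ext_prod_add_left)

lemma wedge_add_right: "\<alpha> \<and>\<^sub>w (\<beta> + \<beta>') = \<alpha> \<and>\<^sub>w \<beta> + \<alpha> \<and>\<^sub>w \<beta>'"
  by (simp add: fun_eq_iff wedge_eq_ext_prod ext_prod_add_right)

lemma wedge_zero_left: "0 \<and>\<^sub>w \<beta> = 0" and wedge_zero_right: "\<alpha> \<and>\<^sub>w 0 = 0"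
  using wedge_add_left[of 0 0 \<beta>] wedge_add_right[of \<alpha> 0 0] by simp_all

lemma wedge_sum_right: "\<alpha> \<and>\<^sub>w (\<Sum>i\<in>I. f i) = (\<Sum>i\<in>I. \<alpha> \<and>\<^sub>w f i)"
  by (induction I rule: infinite_finite_induct)
    (simp_all only: sum.infinite sum.empty sum.insert wedge_zero_right wedge_add_right
      not_False_eq_True)

lemma zero_form_wedge: "zero_form f \<and>\<^sub>w \<alpha> = f \<cdot> \<alpha>"
  by (simp add: fun_eq_iff wedge_eq_ext_prod ext_prod_scalar zero_form_def scale_form_def)

lemma generated_idealI:
  "\<omega> \<in> forms_on U \<Longrightarrow> finite T \<Longrightarrow> T \<subseteq> G \<Longrightarrow> (\<And>\<gamma>. \<gamma> \<in> T \<Longrightarrow> \<beta> \<gamma> \<in> forms_on U) \<Longrightarrow>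
    (\<And>x. x \<in> U \<Longrightarrow> \<omega> x = (\<Sum>\<gamma>\<in>T. \<beta> \<gamma> \<and>\<^sub>w \<gamma>) x) \<Longrightarrow> \<omega> \<in> generated_ideal U G"
  unfolding generated_ideal_def by blast

lemma generated_idealE:
  assumes "\<omega> \<in> generated_ideal U G"
  obtains T \<beta> where "finite T" "T \<subseteq> G" "\<And>\<gamma>. \<gamma> \<in> T \<Longrightarrow> \<beta> \<gamma> \<in> forms_on U"
    "\<And>x. x \<in> U \<Longrightarrow> \<omega> x = (\<Sum>\<gamma>\<in>T. \<beta> \<gamma> \<and>\<^sub>w \<gamma>) x"
  using assms unfolding generated_ideal_def mem_Collect_eq by (elim conjE exE) (rule that, auto)

lemma generated_ideal_forms: "\<omega> \<in> generated_ideal U G \<Longrightarrow> \<omega> \<in> forms_on U"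
  by (simp add: generated_ideal_def)

lemma generated_ideal_cong:
  assumes "open U" "\<omega> \<in> generated_ideal U G" "\<And>x. x \<in> U \<Longrightarrow> \<omega>' x = \<omega> x"
  shows "\<omega>' \<in> generated_ideal U G"
proof -
  obtain T \<beta> where "finite T" "T \<subseteq> G" "\<And>\<gamma>. \<gamma> \<in> T \<Longrightarrow> \<beta> \<gamma> \<in> forms_on U"
    "\<And>x. x \<in> U \<Longrightarrow> \<omega> x = (\<Sum>\<gamma>\<in>T. \<beta> \<gamma> \<and>\<^sub>w \<gamma>) x"
    using assms(2) by (rule generated_idealE) blast
  then show ?thesis
    using assms(3) forms_on_cong[OF assms(1) generated_ideal_forms[OF assms(2)] assms(3)]
    by (intro generated_idealI[where T = T and \<beta> = \<beta>]) simp_all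
qed

lemma forms_on_zero: "open U \<Longrightarrow> 0 \<in> forms_on U"
  by (rule forms_on_cong[OF _ forms_on_zero_form[OF _ smooth_on_const[of U 0]]])
    (simp_all add: zero_form_def fun_eq_iff)

lemma generated_ideal_zero:
  assumes "open U"
  shows "0 \<in> generated_ideal U G"
proof (rule generated_idealI[OF forms_on_zero[OF assms]])
  show "finite {}" "{} \<subseteq> G" by auto
  show "0 x = (\<Sum>\<gamma>\<in>{}. (\<lambda>_. 0) \<gamma> \<and>\<^sub>w \<gamma>) x" for x :: 'a
    by (simp only: sum.empty)
qed auto

lemma generated_ideal_add:
  assumes "open U" "\<omega> \<in> generated_ideal U G" "\<omega>' \<in> generated_ideal U G"
  shows "\<omega> + \<omega>' \<in> generated_ideal U G"
proof -
  obtain T \<beta> where T: "finite T" "T \<subseteq> G" "\<And>\<gamma>. \<gamma> \<in> T \<Longrightarrow> \<beta> \<gamma> \<in> forms_on U"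
    "\<And>x. x \<in> U \<Longrightarrow> \<omega> x = (\<Sum>\<gamma>\<in>T. \<beta> \<gamma> \<and>\<^sub>w \<gamma>) x"
    using assms(2) by (rule generated_idealE) blast
  obtain T' \<beta>' where T': "finite T'" "T' \<subseteq> G" "\<And>\<gamma>. \<gamma> \<in> T' \<Longrightarrow> \<beta>' \<gamma> \<in> forms_on U"
    "\<And>x. x \<in> U \<Longrightarrow> \<omega>' x = (\<Sum>\<gamma>\<in>T'. \<beta>' \<gamma> \<and>\<^sub>w \<gamma>) x"
    using assms(3) by (rule generated_idealE) blast
  define \<delta> where "\<delta> \<gamma> = (if \<gamma> \<in> T then \<beta> \<gamma> else 0) + (if \<gamma> \<in> T' then \<beta>' \<gamma> else 0)" for \<gamma>
  have ext: "(\<Sum>\<gamma>\<in>T \<union> T'. (if \<gamma> \<in> R then f \<gamma> else 0) \<and>\<^sub>w \<gamma>) = (\<Sum>\<gamma>\<in>R. f \<gamma> \<and>\<^sub>w \<gamma>)"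
    if "R \<subseteq> T \<union> T'" for R f
    by (rule sum.mono_neutral_cong_right) (use T(1) T'(1) that in \<open>auto simp: wedge_zero_left\<close>)
  show ?thesis
  proof (rule generated_idealI[where T = "T \<union> T'" and \<beta> = \<delta>])
    show "\<omega> + \<omega>' \<in> forms_on U"
      by (intro forms_on_add assms(1) assms(2,3)[THEN generated_ideal_forms])
    show "\<delta> \<gamma> \<in> forms_on U" for \<gamma>
      unfolding \<delta>_def by (intro forms_on_add assms(1)) (auto intro: T(3) T'(3) forms_on_zero[OF assms(1)])
    show "(\<omega> + \<omega>') x = (\<Sum>\<gamma>\<in>T \<union> T'. \<delta> \<gamma> \<and>\<^sub>w \<gamma>) x" if "x \<in> U" for x
      using ext[of T \<beta>] ext[of T' \<beta>'] T(4)[OF that] T'(4)[OF that]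
      by (simp add: \<delta>_def wedge_add_left sum.distrib)
  qed (use T T' in auto)
qed

lemma generated_ideal_sum:
  assumes "open U" "\<forall>i\<in>I. f i \<in> generated_ideal U G"
  shows "sum f I \<in> generated_ideal U G"
  using assms(2)
proof (induction I rule: infinite_finite_induct)
  case (insert i I)
  then have "f i \<in> generated_ideal U G" "sum f I \<in> generated_ideal U G" by blast+
  then have "f i + sum f I \<in> generated_ideal U G" by (rule generated_ideal_add[OF assms(1)])
  then show ?case unfolding sum.insert[OF insert(1,2)] .
next
  case empty
  show ?case unfolding sum.empty by (rule generated_ideal_zero[OF assms(1)])
next
  case (infinite I)
  show ?case unfolding sum.infinite[OF infinite(1)] by (rule generated_ideal_zero[OF assms(1)])
qed

text \<open>By associativity the coefficients of the generators absorb a further factor.\<close>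

lemma generated_ideal_wedge:
  assumes "open U" "\<alpha> \<in> forms_on U" "\<omega> \<in> generated_ideal U G"
  shows "\<alpha> \<and>\<^sub>w \<omega> \<in> generated_ideal U G"
proof -
  obtain T \<beta> where T: "finite T" "T \<subseteq> G" "\<And>\<gamma>. \<gamma> \<in> T \<Longrightarrow> \<beta> \<gamma> \<in> forms_on U"
    "\<And>x. x \<in> U \<Longrightarrow> \<omega> x = (\<Sum>\<gamma>\<in>T. \<beta> \<gamma> \<and>\<^sub>w \<gamma>) x"
    using assms(3) by (rule generated_idealE) blast
  show ?thesis
  proof (rule generated_idealI[where T = T and \<beta> = "\<lambda>\<gamma>. \<alpha> \<and>\<^sub>w \<beta> \<gamma>"])
    show "(\<alpha> \<and>\<^sub>w \<omega>) x = (\<Sum>\<gamma>\<in>T. (\<alpha> \<and>\<^sub>w \<beta> \<gamma>) \<and>\<^sub>w \<gamma>) x" if "x \<in> U" for x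
      using wedge_cong[of \<alpha> x \<alpha> \<omega> "\<Sum>\<gamma>\<in>T. \<beta> \<gamma> \<and>\<^sub>w \<gamma>"] T(4)[OF that]
      by (simp add: wedge_assoc wedge_sum_right)
  qed (use T assms generated_ideal_forms[OF assms(3)] in \<open>auto intro: forms_on_wedge\<close>)
qed

lemma generated_ideal_scale:
  "open U \<Longrightarrow> smooth_on U f \<Longrightarrow> \<omega> \<in> generated_ideal U G \<Longrightarrow> f \<cdot> \<omega> \<in> generated_ideal U G"
  using generated_ideal_wedge[OF _ forms_on_zero_form] by (simp add: zero_form_wedge)

lemma generated_ideal_generator:
  assumes "open U" "\<gamma> \<in> G" "\<gamma> \<in> forms_on U"
  shows "\<gamma> \<in> generated_ideal U G"
proof (rule generated_idealI[where T = "{\<gamma>}" and \<beta> = "\<lambda>_. zero_form (\<lambda>_. 1)"])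
  show "\<gamma> x = (\<Sum>\<gamma>\<in>{\<gamma>}. zero_form (\<lambda>_. 1) \<and>\<^sub>w \<gamma>) x" for x
    by (simp add: zero_form_wedge scale_form_def)
qed (use assms smooth_on_const[of U "1 :: real"] in \<open>auto intro: forms_on_zero_form\<close>)

lemma generated_ideal_subsetI:
  assumes "open U" "G \<subseteq> generated_ideal U H"
  shows "generated_ideal U G \<subseteq> generated_ideal U H"
proof
  fix \<omega> assume "\<omega> \<in> generated_ideal U G"
  then obtain T \<beta> where T: "finite T" "T \<subseteq> G" "\<And>\<gamma>. \<gamma> \<in> T \<Longrightarrow> \<beta> \<gamma> \<in> forms_on U"
    "\<And>x. x \<in> U \<Longrightarrow> \<omega> x = (\<Sum>\<gamma>\<in>T. \<beta> \<gamma> \<and>\<^sub>w \<gamma>) x"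
    by (rule generated_idealE) blast
  have "(\<Sum>\<gamma>\<in>T. \<beta> \<gamma> \<and>\<^sub>w \<gamma>) \<in> generated_ideal U H"
    using T(2,3) assms(2) by (intro generated_ideal_sum ballI generated_ideal_wedge assms(1)) auto
  then show "\<omega> \<in> generated_ideal U H"
    by (rule generated_ideal_cong[OF assms(1)]) (rule T(4))
qed


subsection \<open>Pullback of forms and ideals\<close>

lemma pullback_wedge: "pullback g (\<alpha> \<and>\<^sub>w \<beta>) = pullback g \<alpha> \<and>\<^sub>w pullback g \<beta>"
  by (simp add: fun_eq_iff pullback_def wedge_eq_ext_prod ext_prod_map)

lemma pullback_sum: "pullback g (\<Sum>i\<in>I. f i) = (\<Sum>i\<in>I. pullback g (f i))"
  by (simp add: fun_eq_iff pullback_def sum_fun_at)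

text \<open>
  Smoothness of a pulled back form: its arguments vary with the point, and are expanded in the
  standard basis one after the other.
\<close>

lemma forms_on_pullback:
  fixes g :: "'a::real_normed_vector \<Rightarrow> 'b::euclidean_space"
  assumes "open V" "open W" "g ` V \<subseteq> W" "smooth_on V g" "\<omega> \<in> forms_on W"
  shows "pullback g \<omega> \<in> forms_on V"
proof (rule forms_onI)
  let ?g' = "\<lambda>x. frechet_derivative g (at x)"
  have gW: "g x \<in> W" if "x \<in> V" for x using assms(3) that by auto
  show "alternating_multilinear (pullback g \<omega> x)" if "x \<in> V" for x
    unfolding alternating_multilinear_def
  proof (intro conjI allI impI)
    have lin: "linear (?g' x)"
      using has_derivative_linear[OF smooth_on_has_derivative[OF assms(4) that]] .
    show "linear (\<lambda>v. pullback g \<omega> x (us @ v # ws))" for us ws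
      using linear_compose[OF lin alternating_multilinear_linear[OF
          forms_on_alternating[OF assms(5) gW[OF that]]]]
      by (simp add: pullback_def o_def)
    show "pullback g \<omega> x vs = 0" if "\<not> distinct vs" for vs
      using alternating_multilinear_not_distinct[OF forms_on_alternating[OF assms(5) gW[OF \<open>x \<in> V\<close>]]]
        that distinct_map by (fastforce simp: pullback_def)
  qed
  have "smooth_on V (\<lambda>x. \<omega> (g x) (us @ map (?g' x) vs))" for us vs
  proof (induction vs arbitrary: us)
    case Nil
    show ?case
      using smooth_on_compose[OF assms(1,2,3,4) forms_on_smooth[OF assms(5)]] by simp
  next
    case (Cons v vs)
    have "smooth_on V (\<lambda>x. \<Sum>b\<in>Basis. (?g' x v \<bullet> b) * \<omega> (g x) ((us @ [b]) @ map (?g' x) vs))"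
    proof (intro smooth_on_sum smooth_on_mult assms(1) Cons.IH)
      show "smooth_on V (\<lambda>x. ?g' x v \<bullet> b)" for b
        using smooth_on_compose[OF assms(1) open_UNIV subset_UNIV
            smooth_on_frechet_derivative[OF assms(4)] smooth_on_bounded_linear[OF open_UNIV
              bounded_linear_inner_left]] .
    qed
    moreover have "(\<Sum>b\<in>Basis. (?g' x v \<bullet> b) * \<omega> (g x) ((us @ [b]) @ map (?g' x) vs))
        = \<omega> (g x) (us @ map (?g' x) (v # vs))" if "x \<in> V" for x
    proof -
      have "linear (\<lambda>v. \<omega> (g x) (us @ v # map (?g' x) vs))"
        by (intro alternating_multilinear_linear forms_on_alternating[OF assms(5)] gW that)
      from linear_expand[OF this, of "?g' x v"] show ?thesis by simp
    qed
    ultimately show ?case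
      using smooth_on_cong[OF assms(1), of "\<lambda>x. \<Sum>b\<in>Basis. (?g' x v \<bullet> b) * \<omega> (g x) ((us @ [b]) @ map (?g' x) vs)"
          "\<lambda>x. \<omega> (g x) (us @ map (?g' x) (v # vs))"] by blast
  qed
  from this[of "[]"] show "smooth_on V (\<lambda>x. pullback g \<omega> x vs)" for vs
    by (simp add: pullback_def)
qed

lemma generated_ideal_pullback:
  fixes g :: "'a::real_normed_vector \<Rightarrow> 'b::euclidean_space"
  assumes "open V" "open W" "g ` V \<subseteq> W" "smooth_on V g" "G \<subseteq> forms_on W"
    and "\<omega> \<in> generated_ideal W G"
  shows "pullback g \<omega> \<in> generated_ideal V (pullback g ` G)"
proof -
  obtain T \<beta> where T: "finite T" "T \<subseteq> G" "\<And>\<gamma>. \<gamma> \<in> T \<Longrightarrow> \<beta> \<gamma> \<in> forms_on W"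
    "\<And>x. x \<in> W \<Longrightarrow> \<omega> x = (\<Sum>\<gamma>\<in>T. \<beta> \<gamma> \<and>\<^sub>w \<gamma>) x"
    using assms(6) by (rule generated_idealE) blast
  note pull = forms_on_pullback[OF assms(1-4)]
  have "(\<Sum>\<gamma>\<in>T. pullback g (\<beta> \<gamma>) \<and>\<^sub>w pullback g \<gamma>) \<in> generated_ideal V (pullback g ` G)"
    using T(2,3) assms(5)
    by (intro generated_ideal_sum ballI generated_ideal_wedge generated_ideal_generator assms(1) pull)
      auto
  moreover have "pullback g \<omega> x = (\<Sum>\<gamma>\<in>T. pullback g (\<beta> \<gamma>) \<and>\<^sub>w pullback g \<gamma>) x" if "x \<in> V" for x
  proof -
    have "pullback g \<omega> x = pullback g (\<Sum>\<gamma>\<in>T. \<beta> \<gamma> \<and>\<^sub>w \<gamma>) x"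
      using T(4)[of "g x"] that assms(3) by (auto simp: pullback_def)
    then show ?thesis by (simp add: pullback_sum pullback_wedge)
  qed
  ultimately show ?thesis by (rule generated_ideal_cong[OF assms(1)])
qed

lemma pullback_inverse:
  fixes g :: "'a::real_normed_vector \<Rightarrow> 'b::real_normed_vector"
  assumes "diffeomorphism V W g" "y \<in> W"
  shows "pullback (inv_into V g) (pullback g \<omega>) y = \<omega> y"
proof -
  let ?h = "inv_into V g"
  have V: "open V" "open W" "bij_betw g V W" "smooth_on V g" "smooth_on W ?h"
    using assms(1) by (auto simp: diffeomorphism_def)
  have gh: "g (?h y) = y" if "y \<in> W" for y
    using bij_betw_inv_into_right[OF V(3) that] .
  have hV: "?h y \<in> V" using V(3) assms(2) by (metis bij_betw_def inv_into_into)
  have "((\<lambda>y. g (?h y)) has_derivative (\<lambda>v. frechet_derivative g (at (?h y))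
      (frechet_derivative ?h (at y) v))) (at y)"
    by (rule has_derivative_compose[OF smooth_on_has_derivative[OF V(5) assms(2)]
          smooth_on_has_derivative[OF V(4) hV]])
  moreover have "((\<lambda>y. g (?h y)) has_derivative (\<lambda>v. v)) (at y)"
    by (rule has_derivative_transform_within_open[OF has_derivative_ident V(2) assms(2)])
      (simp add: gh)
  ultimately have "frechet_derivative g (at (?h y)) (frechet_derivative ?h (at y) v) = v" for v
    using has_derivative_unique by metis
  then show ?thesis
    using gh[OF assms(2)] by (simp add: pullback_def fun_eq_iff o_def)
qed

text \<open>
  Pullback along the inverse undoes the pullback of the form as well as that of the generators.
\<close>

lemma diffeomorphism_generated_ideal_iff:
  fixes g :: "'a::euclidean_space \<Rightarrow> 'b::euclidean_space"
  assumes "diffeomorphism V W g" "G \<subseteq> forms_on W" "\<omega> \<in> forms_on W"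
  shows "\<omega> \<in> generated_ideal W G \<longleftrightarrow> pullback g \<omega> \<in> generated_ideal V (pullback g ` G)"
proof
  let ?h = "inv_into V g"
  have V: "open V" "open W" "bij_betw g V W" "smooth_on V g" "smooth_on W ?h"
    using assms(1) by (auto simp: diffeomorphism_def)
  have gV: "g ` V \<subseteq> W" and hW: "?h ` W \<subseteq> V"
    using V(3) bij_betw_inv_into[OF V(3)] by (auto simp: bij_betw_def)
  show "pullback g \<omega> \<in> generated_ideal V (pullback g ` G)" if "\<omega> \<in> generated_ideal W G"
    by (rule generated_ideal_pullback[OF V(1,2) gV V(4) assms(2) that])
  assume "pullback g \<omega> \<in> generated_ideal V (pullback g ` G)"
  then have "pullback ?h (pullback g \<omega>) \<in> generated_ideal W (pullback ?h ` pullback g ` G)"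
    using forms_on_pullback[OF V(1,2) gV V(4)] assms(2)
    by (intro generated_ideal_pullback[OF V(2,1) hW V(5)]) auto
  moreover have "pullback ?h (pullback g \<gamma>) \<in> generated_ideal W G" if "\<gamma> \<in> G" for \<gamma>
    by (rule generated_ideal_cong[OF V(2) generated_ideal_generator[OF V(2) that]])
      (use that assms pullback_inverse in auto)
  ultimately have "pullback ?h (pullback g \<omega>) \<in> generated_ideal W G"
    using generated_ideal_subsetI[OF V(2), of "pullback ?h ` pullback g ` G" G] by auto
  then show "\<omega> \<in> generated_ideal W G"
    by (rule generated_ideal_cong[OF V(2)]) (simp add: pullback_inverse[OF assms(1)])
qed


section \<open>Integration of the structure equations\<close>

text \<open>
  The exterior derivative of a one-form and the exterior product of two covectors, evaluated on a
  pair of vectors.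
\<close>

definition curl :: "('a::real_normed_vector \<Rightarrow> 'a \<Rightarrow> real) \<Rightarrow> 'a \<Rightarrow> 'a \<Rightarrow> 'a \<Rightarrow> real" where
  "curl a x v w = frechet_derivative (\<lambda>y. a y w) (at x) v - frechet_derivative (\<lambda>y. a y v) (at x) w"

definition wedge_value :: "('a \<Rightarrow> real) \<Rightarrow> ('a \<Rightarrow> real) \<Rightarrow> 'a \<Rightarrow> 'a \<Rightarrow> real" where
  "wedge_value a b v w = a v * b w - a w * b v"

text \<open>
  The structure equations evaluated on pairs of vectors: \<open>t i x v\<close> is the value of \<open>\<theta>\<^sup>i\<close> at the point
  \<open>x\<close> on the vector \<open>v\<close>.  In this form they are polynomial identities in real numbers, which the
  integration below combines by ring arithmetic.
\<close>

locale structured_coframe =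
  fixes S :: "'a::euclidean_space set" and t :: "nat \<Rightarrow> 'a \<Rightarrow> 'a \<Rightarrow> real" and F :: "'a \<Rightarrow> real"
  assumes open_S: "open S"
    and linear_t: "\<And>i x. i < 5 \<Longrightarrow> x \<in> S \<Longrightarrow> linear (t i x)"
    and smooth_t: "\<And>i v. i < 5 \<Longrightarrow> smooth_on S (\<lambda>x. t i x v)"
    and separating: "\<And>x v. x \<in> S \<Longrightarrow> (\<And>i. i < 5 \<Longrightarrow> t i x v = 0) \<Longrightarrow> v = 0"
    and smooth_F: "smooth_on S F"
    and F_deriv: "\<And>x v. x \<in> S \<Longrightarrow> frechet_derivative F (at x) v
      = 2 * (F x)\<^sup>2 * (2 * t 0 x v - t 2 x v - t 4 x v) + 2 * F x * (t 1 x v + t 3 x v)"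
    and curl_0: "\<And>x v w. x \<in> S \<Longrightarrow> curl (t 0) x v w
      = 2 * wedge_value (t 0 x) (t 1 x) v w - F x * wedge_value (t 0 x) (t 2 x) v w
      + 2 * wedge_value (t 0 x) (t 3 x) v w - F x * wedge_value (t 0 x) (t 4 x) v w
      + wedge_value (t 1 x) (t 2 x) v w + wedge_value (t 3 x) (t 4 x) v w"
    and curl_1: "\<And>x v w. x \<in> S \<Longrightarrow> curl (t 1) x v w
      = - F x * wedge_value (t 0 x) (t 2 x) v w - F x * wedge_value (t 0 x) (t 4 x) v w
      - wedge_value (t 1 x) (t 4 x) v w + wedge_value (t 2 x) (t 3 x) v w
      + (F x + 1) * wedge_value (t 2 x) (t 4 x) v w"
    and curl_2: "\<And>x v w. x \<in> S \<Longrightarrow> curl (t 2) x v w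
      = - 2 * F x * wedge_value (t 0 x) (t 2 x) v w - wedge_value (t 1 x) (t 2 x) v w
      - wedge_value (t 1 x) (t 4 x) v w + wedge_value (t 2 x) (t 3 x) v w
      + (1 - F x) * wedge_value (t 2 x) (t 4 x) v w + wedge_value (t 3 x) (t 4 x) v w"
    and curl_3: "\<And>x v w. x \<in> S \<Longrightarrow> curl (t 3) x v w
      = F x * wedge_value (t 0 x) (t 2 x) v w + F x * wedge_value (t 0 x) (t 4 x) v w
      + wedge_value (t 1 x) (t 4 x) v w - wedge_value (t 2 x) (t 3 x) v w
      + (F x - 1) * wedge_value (t 2 x) (t 4 x) v w"
    and curl_4: "\<And>x v w. x \<in> S \<Longrightarrow> curl (t 4) x v w
      = - 2 * F x * wedge_value (t 0 x) (t 4 x) v w + wedge_value (t 1 x) (t 2 x) v w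
      - wedge_value (t 1 x) (t 4 x) v w + wedge_value (t 2 x) (t 3 x) v w
      + (F x + 1) * wedge_value (t 2 x) (t 4 x) v w - wedge_value (t 3 x) (t 4 x) v w"
begin

text \<open>The argument \<open>w\<close> is fed to the form, and \<open>v\<close> is the direction of differentiation.\<close>

definition T :: "nat \<Rightarrow> 'a \<Rightarrow> 'a \<Rightarrow> 'a \<Rightarrow> real" where
  "T i x w v = frechet_derivative (\<lambda>y. t i y w) (at x) v"

lemma has_derivative_t: "i < 5 \<Longrightarrow> x \<in> S \<Longrightarrow> ((\<lambda>y. t i y w) has_derivative T i x w) (at x)"
  unfolding T_def[abs_def] by (rule smooth_on_has_derivative[OF smooth_t])

lemma has_derivative_F: "x \<in> S \<Longrightarrow> (F has_derivative
    (\<lambda>v. 2 * (F x)\<^sup>2 * (2 * t 0 x v - t 2 x v - t 4 x v) + 2 * F x * (t 1 x v + t 3 x v))) (at x)"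
  by (rule has_derivative_eq_rhs[OF smooth_on_has_derivative[OF smooth_F]]) (auto simp: F_deriv)

lemma T_swap: "T i x w v = T i x v w + curl (t i) x v w"
  by (simp add: T_def curl_def)

lemmas curl_eqs = curl_0 curl_1 curl_2 curl_3 curl_4

text \<open>
  The integration by quadratures.  The invariant form \<open>\<gamma>\<close> is the differential of the angle \<open>\<phi>\<close> of the
  vector \<open>(A, B)\<close>, whose length is given by \<open>F\<close>; rotating the invariant forms
  \<open>\<theta>\<^sup>2 + \<theta>\<^sup>4\<close> and \<open>\<theta>\<^sup>4 - \<theta>\<^sup>2\<close> by this angle and scaling them by half the length turns them into the
  exact forms \<open>dx\<close> and \<open>dy\<close>, and then \<open>- 2 F \<theta>\<^sup>0\<close> becomes a contact form.
\<close>

lemma contact_coordinates: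
  assumes "convex S" and F_pos: "\<And>x. x \<in> S \<Longrightarrow> 0 < F x"
  obtains A B X Y Z where
    "\<And>x. x \<in> S \<Longrightarrow> (A x)\<^sup>2 + (B x)\<^sup>2 = 2 * F x"
    "\<And>x. x \<in> S \<Longrightarrow> (A has_derivative (\<lambda>v.
        A x * (F x * (2 * t 0 x v - t 2 x v - t 4 x v) + t 1 x v + t 3 x v)
        - B x * (t 2 x v + t 4 x v - t 1 x v + t 3 x v))) (at x)"
    "\<And>x. x \<in> S \<Longrightarrow> (B has_derivative (\<lambda>v.
        B x * (F x * (2 * t 0 x v - t 2 x v - t 4 x v) + t 1 x v + t 3 x v)
        + A x * (t 2 x v + t 4 x v - t 1 x v + t 3 x v))) (at x)"
    "\<And>x. x \<in> S \<Longrightarrow> (X has_derivative (\<lambda>v.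
        (A x * (t 2 x v + t 4 x v) - B x * (t 4 x v - t 2 x v)) / 2)) (at x)"
    "\<And>x. x \<in> S \<Longrightarrow> (Y has_derivative (\<lambda>v.
        (B x * (t 2 x v + t 4 x v) + A x * (t 4 x v - t 2 x v)) / 2)) (at x)"
    "\<And>x. x \<in> S \<Longrightarrow> (Z has_derivative (\<lambda>v. - 2 * F x * t 0 x v
        + (A x + Y x) * ((A x * (t 2 x v + t 4 x v) - B x * (t 4 x v - t 2 x v)) / 2)
        + (B x - X x) * ((B x * (t 2 x v + t 4 x v) + A x * (t 4 x v - t 2 x v)) / 2))) (at x)"
    "smooth_on S A" "smooth_on S B" "smooth_on S X" "smooth_on S Y" "smooth_on S Z"
proof -
  note [derivative_intros] = has_derivative_t has_derivative_F
  define \<gamma> where "\<gamma> x v = t 2 x v + t 4 x v - t 1 x v + t 3 x v" for x v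
  \<comment> \<open>This is \<open>dF / (2 F)\<close>, the logarithmic derivative of the length of \<open>(A, B)\<close>.\<close>
  define \<nu> where "\<nu> x v = F x * (2 * t 0 x v - t 2 x v - t 4 x v) + t 1 x v + t 3 x v" for x v
  have smooth_\<gamma>: "smooth_on S (\<lambda>x. \<gamma> x v)" for v
    unfolding \<gamma>_def by (intro smooth_on_add smooth_on_diff smooth_t open_S) auto
  obtain \<phi> where \<phi>: "\<And>x. x \<in> S \<Longrightarrow> (\<phi> has_derivative \<gamma> x) (at x)" "smooth_on S \<phi>"
  proof (rule closed_one_form_exact[OF open_S \<open>convex S\<close> _ smooth_\<gamma>])
    show "linear (\<gamma> x)" if "x \<in> S" for x
      unfolding \<gamma>_def[abs_def]
      by (intro linear_compose_add linear_compose_sub linear_t that) auto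
    fix x v w assume x: "x \<in> S"
    have "((\<lambda>x. \<gamma> x w) has_derivative (\<lambda>v. T 2 x w v + T 4 x w v - T 1 x w v + T 3 x w v)) (at x)"
      for w
      unfolding \<gamma>_def by (auto intro!: derivative_eq_intros x)
    note \<gamma>_deriv = this[THEN frechet_derivative_eqI]
    show "frechet_derivative (\<lambda>y. \<gamma> y w) (at x) v = frechet_derivative (\<lambda>y. \<gamma> y v) (at x) w"
      unfolding \<gamma>_deriv T_swap[of _ _ w v] curl_eqs[OF x] wedge_value_def by algebra
  qed blast
  define R where "R x = sqrt (2 * F x)" for x
  have R_sq: "R x * R x = 2 * F x" and R_pos: "R x > 0" if "x \<in> S" for x
    using F_pos[OF that] by (simp_all add: R_def)
  have R_deriv: "(R has_derivative (\<lambda>v. R x * \<nu> x v)) (at x)" if "x \<in> S" for x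
  proof -
    have "(R has_derivative (\<lambda>v. (2 * (2 * (F x)\<^sup>2 * (2 * t 0 x v - t 2 x v - t 4 x v)
        + 2 * F x * (t 1 x v + t 3 x v))) * (inverse (R x) / 2))) (at x)"
      unfolding R_def[abs_def]
      by (rule has_derivative_compose[OF _ DERIV_real_sqrt[unfolded has_field_derivative_def], THEN has_derivative_eq_rhs])
        (use that F_pos in \<open>auto intro!: derivative_eq_intros\<close>)
    moreover have "(2 * (2 * (F x)\<^sup>2 * (2 * t 0 x v - t 2 x v - t 4 x v)
        + 2 * F x * (t 1 x v + t 3 x v))) * (inverse (R x) / 2) = R x * \<nu> x v" for v
    proof -
      have "2 * (2 * (F x)\<^sup>2 * (2 * t 0 x v - t 2 x v - t 4 x v)
        + 2 * F x * (t 1 x v + t 3 x v)) = (R x * R x) * (2 * \<nu> x v)"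
        by (simp add: R_sq[OF that] \<nu>_def power2_eq_square algebra_simps)
      then show ?thesis using R_pos[OF that] by (simp add: field_simps)
    qed
    ultimately show ?thesis by simp
  qed
  have R_smooth: "smooth_on S R"
    unfolding R_def
    by (rule smooth_on_compose[OF open_S _ _ _ smooth_on_sqrt])
      (auto intro!: smooth_on_mult smooth_on_const open_S smooth_F F_pos)
  define A where "A x = R x * cos (\<phi> x)" for x
  define B where "B x = R x * sin (\<phi> x)" for x
  have smooth_A: "smooth_on S A" and smooth_B: "smooth_on S B"
    unfolding A_def B_def
    by (intro smooth_on_mult R_smooth open_S smooth_on_compose[OF open_S open_UNIV _ \<phi>(2)]
        smooth_on_sin_cos; simp)+
  have AB: "(A x)\<^sup>2 + (B x)\<^sup>2 = 2 * F x" if "x \<in> S" for x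
  proof -
    have "(A x)\<^sup>2 + (B x)\<^sup>2 = (R x * R x) * ((cos (\<phi> x))\<^sup>2 + (sin (\<phi> x))\<^sup>2)"
      unfolding A_def B_def by algebra
    then show ?thesis by (simp add: R_sq[OF that])
  qed
  have A_deriv: "(A has_derivative (\<lambda>v. A x * \<nu> x v - B x * \<gamma> x v)) (at x)" if "x \<in> S" for x
    unfolding A_def[abs_def]
    by (rule has_derivative_eq_rhs, (rule derivative_intros R_deriv[OF that] \<phi>(1)[OF that])+)
      (auto simp: A_def B_def algebra_simps)
  have B_deriv: "(B has_derivative (\<lambda>v. B x * \<nu> x v + A x * \<gamma> x v)) (at x)" if "x \<in> S" for x
    unfolding B_def[abs_def]
    by (rule has_derivative_eq_rhs, (rule derivative_intros R_deriv[OF that] \<phi>(1)[OF that])+)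
      (auto simp: A_def B_def algebra_simps)
  note [derivative_intros] = A_deriv B_deriv
  define ax where "ax x v = (A x * (t 2 x v + t 4 x v) - B x * (t 4 x v - t 2 x v)) / 2" for x v
  define ay where "ay x v = (B x * (t 2 x v + t 4 x v) + A x * (t 4 x v - t 2 x v)) / 2" for x v
  have smooth_ax: "smooth_on S (\<lambda>x. ax x v)" and smooth_ay: "smooth_on S (\<lambda>x. ay x v)" for v
    unfolding ax_def ay_def
    by (intro smooth_on_divide smooth_on_mult smooth_on_add smooth_on_diff smooth_on_const smooth_A smooth_B smooth_t
        open_S; simp)+
  have linear_ax: "linear (ax x)" and linear_ay: "linear (ay x)" if "x \<in> S" for x
    using linear_t[OF _ that, of 2] linear_t[OF _ that, of 4]
    unfolding ax_def[abs_def] ay_def[abs_def] linear_iff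
    by (simp_all add: algebra_simps add_divide_distrib diff_divide_distrib)
  have ax_deriv: "((\<lambda>x. ax x w) has_derivative (\<lambda>v.
      ((A x * \<nu> x v - B x * \<gamma> x v) * (t 2 x w + t 4 x w) + A x * (T 2 x w v + T 4 x w v)
      - (B x * \<nu> x v + A x * \<gamma> x v) * (t 4 x w - t 2 x w) - B x * (T 4 x w v - T 2 x w v)) / 2)) (at x)"
    and ay_deriv: "((\<lambda>x. ay x w) has_derivative (\<lambda>v.
      ((B x * \<nu> x v + A x * \<gamma> x v) * (t 2 x w + t 4 x w) + B x * (T 2 x w v + T 4 x w v)
      + (A x * \<nu> x v - B x * \<gamma> x v) * (t 4 x w - t 2 x w) + A x * (T 4 x w v - T 2 x w v)) / 2)) (at x)"
    if "x \<in> S" for x w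
    unfolding ax_def ay_def
    by (auto intro!: derivative_eq_intros that simp: fun_eq_iff field_simps)
  have ax_closed: "frechet_derivative (\<lambda>y. ax y w) (at x) v = frechet_derivative (\<lambda>y. ax y v) (at x) w"
    if x: "x \<in> S" for x v w
    unfolding ax_deriv[OF x, THEN frechet_derivative_eqI] T_swap[of _ _ w v] curl_eqs[OF x]
      wedge_value_def \<gamma>_def \<nu>_def
    by algebra
  obtain X where X: "\<And>x. x \<in> S \<Longrightarrow> (X has_derivative ax x) (at x)" "smooth_on S X"
    by (rule closed_one_form_exact[OF open_S \<open>convex S\<close> linear_ax smooth_ax ax_closed]) blast+
  have ay_closed: "frechet_derivative (\<lambda>y. ay y w) (at x) v = frechet_derivative (\<lambda>y. ay y v) (at x) w"
    if x: "x \<in> S" for x v w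
    unfolding ay_deriv[OF x, THEN frechet_derivative_eqI] T_swap[of _ _ w v] curl_eqs[OF x]
      wedge_value_def \<gamma>_def \<nu>_def
    by algebra
  obtain Y where Y: "\<And>x. x \<in> S \<Longrightarrow> (Y has_derivative ay x) (at x)" "smooth_on S Y"
    by (rule closed_one_form_exact[OF open_S \<open>convex S\<close> linear_ay smooth_ay ay_closed]) blast+
  note [derivative_intros] = X(1) Y(1)
  define az where "az x v = - 2 * F x * t 0 x v + (A x + Y x) * ax x v + (B x - X x) * ay x v"
    for x v
  have smooth_az: "smooth_on S (\<lambda>x. az x v)" for v
    unfolding az_def
    by (intro smooth_on_mult smooth_on_add smooth_on_diff smooth_on_const smooth_A smooth_B smooth_t
        smooth_ax smooth_ay smooth_F X(2) Y(2) open_S; simp)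
  have linear_az: "linear (az x)" if "x \<in> S" for x
    using linear_t[OF _ that, of 0] linear_ax[OF that] linear_ay[OF that]
    unfolding az_def[abs_def] linear_iff by (simp add: algebra_simps)
  obtain Z where Z: "\<And>x. x \<in> S \<Longrightarrow> (Z has_derivative az x) (at x)" "smooth_on S Z"
  proof (rule closed_one_form_exact[OF open_S \<open>convex S\<close> linear_az smooth_az])
    fix x v w assume x: "x \<in> S"
    define F' where "F' v = 2 * (F x)\<^sup>2 * (2 * t 0 x v - t 2 x v - t 4 x v) + 2 * F x * (t 1 x v + t 3 x v)" for v
    define ax' where "ax' w v = frechet_derivative (\<lambda>y. ax y w) (at x) v" for w v
    define ay' where "ay' w v = frechet_derivative (\<lambda>y. ay y w) (at x) v" for w v
    have F': "(F has_derivative F') (at x)"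
      unfolding F'_def[abs_def] by (rule has_derivative_F[OF x])
    have ax': "((\<lambda>y. ax y w) has_derivative ax' w) (at x)"
      and ay': "((\<lambda>y. ay y w) has_derivative ay' w) (at x)" for w
      unfolding ax'_def[abs_def] ay'_def[abs_def]
      by (rule smooth_on_has_derivative[OF smooth_ax x] smooth_on_has_derivative[OF smooth_ay x])+
    have sym: "ax' w v = ax' v w" "ay' w v = ay' v w"
      unfolding ax'_def ay'_def by (rule ax_closed[OF x] ay_closed[OF x])+
    have "((\<lambda>x. az x w) has_derivative (\<lambda>v. - 2 * (F' v * t 0 x w + F x * T 0 x w v)
        + (A x * \<nu> x v - B x * \<gamma> x v + ay x v) * ax x w + (A x + Y x) * ax' w v
        + (B x * \<nu> x v + A x * \<gamma> x v - ax x v) * ay x w + (B x - X x) * ay' w v)) (at x)" for w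
      unfolding az_def
      by (rule has_derivative_eq_rhs, (rule derivative_intros x F' ax' ay' | simp)+)
        (auto simp: fun_eq_iff algebra_simps)
    note az' = this[THEN frechet_derivative_eqI]
    \<comment> \<open>In \<open>dA \<and> dx + dB \<and> dy + 2 dy \<and> dx\<close> the rotation cancels; only the square of the length remains.\<close>
    define s where "s v = (t 2 x v + t 4 x v) / 2" for v
    define d where "d v = (t 4 x v - t 2 x v) / 2" for v
    have t24: "t 2 x v = s v - d v" "t 4 x v = s v + d v" for v
      by (simp_all add: s_def d_def field_simps)
    have sd: "ax x v = A x * s v - B x * d v" "ay x v = B x * s v + A x * d v" for v
      by (simp_all add: ax_def ay_def s_def d_def field_simps)
    define h where "h v w = (A x * \<nu> x v - B x * \<gamma> x v + ay x v) * ax x w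
        + (B x * \<nu> x v + A x * \<gamma> x v - ax x v) * ay x w" for v w
    have "h v w - h w v = ((A x)\<^sup>2 + (B x)\<^sup>2) * (\<nu> x v * s w - \<nu> x w * s v
        + \<gamma> x v * d w - \<gamma> x w * d v - 2 * (s v * d w - s w * d v))"
      unfolding h_def sd by (simp add: algebra_simps power2_eq_square)
    then have h: "h v w - h w v = 2 * F x * (\<nu> x v * s w - \<nu> x w * s v
        + \<gamma> x v * d w - \<gamma> x w * d v - 2 * (s v * d w - s w * d v))"
      by (simp add: AB[OF x])
    have "frechet_derivative (\<lambda>y. az y w) (at x) v - frechet_derivative (\<lambda>y. az y v) (at x) w
        = - 2 * (F' v * t 0 x w - F' w * t 0 x v) - 2 * F x * curl (t 0) x v w + (h v w - h w v)"
      unfolding az' sym T_swap[of _ _ w v] h_def by algebra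
    also have "\<dots> = 0"
      unfolding h curl_eqs[OF x] wedge_value_def \<gamma>_def \<nu>_def F'_def t24
      by (simp add: algebra_simps power2_eq_square)
    finally show "frechet_derivative (\<lambda>y. az y w) (at x) v = frechet_derivative (\<lambda>y. az y v) (at x) w"
      by simp
  qed blast+
  show thesis
    by (rule that[of A B X Y Z])
      (use AB A_deriv B_deriv X Y Z smooth_A smooth_B in
        \<open>unfold \<gamma>_def[abs_def] \<nu>_def[abs_def] ax_def[abs_def] ay_def[abs_def] az_def[abs_def], blast+\<close>)
qed

end


section \<open>The contact form and the two-form of the equation\<close>

lemma exhaust_5:
  fixes i :: 5
  shows "i = 1 \<or> i = 2 \<or> i = 3 \<or> i = 4 \<or> i = 5"
proof (induct i)
  case (of_int z)
  then have "z = 0 \<or> z = 1 \<or> z = 2 \<or> z = 3 \<or> z = 4" by fastforce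
  then show ?case by auto
qed

lemma forall_5: "(\<forall>i::5. P i) \<longleftrightarrow> P 1 \<and> P 2 \<and> P 3 \<and> P 4 \<and> P 5"
  by (metis exhaust_5)

lemma vector_5 [simp]:
  "(vector [a, b, c, d, e] :: 'a::zero^5) $ 1 = a"
  "(vector [a, b, c, d, e] :: 'a::zero^5) $ 2 = b"
  "(vector [a, b, c, d, e] :: 'a::zero^5) $ 3 = c"
  "(vector [a, b, c, d, e] :: 'a::zero^5) $ 4 = d"
  "(vector [a, b, c, d, e] :: 'a::zero^5) $ 5 = e"
  unfolding vector_def by simp_all

lemma has_derivative_vector_5:
  fixes a b c d e :: "'a::real_normed_vector \<Rightarrow> real"
  assumes "(a has_derivative a') F" "(b has_derivative b') F" "(c has_derivative c') F"
    "(d has_derivative d') F" "(e has_derivative e') F"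
  shows "((\<lambda>x. vector [a x, b x, c x, d x, e x] :: real^5) has_derivative
    (\<lambda>v. vector [a' v, b' v, c' v, d' v, e' v])) F"
proof -
  have *: "(vector [r1, r2, r3, r4, r5] :: real^5) = r1 *\<^sub>R axis 1 1 + r2 *\<^sub>R axis 2 1
      + r3 *\<^sub>R axis 3 1 + r4 *\<^sub>R axis 4 1 + r5 *\<^sub>R axis 5 1" for r1 r2 r3 r4 r5
    by (simp add: vec_eq_iff forall_5 axis_def)
  show ?thesis unfolding * by (intro derivative_intros assms)
qed

lemma smooth_on_vector_5:
  fixes a b c d e :: "'a::real_normed_vector \<Rightarrow> real"
  assumes "open S" "smooth_on S a" "smooth_on S b" "smooth_on S c" "smooth_on S d" "smooth_on S e"
  shows "smooth_on S (\<lambda>x. vector [a x, b x, c x, d x, e x] :: real^5)"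
proof (rule smooth_on_componentwise[OF assms(1)])
  show "smooth_on S (\<lambda>x. (vector [a x, b x, c x, d x, e x] :: real^5) $ i)" for i
    using exhaust_5[of i] assms(2-) by auto
qed


subsection \<open>Forms of degree one and two\<close>

definition homogeneous :: "nat \<Rightarrow> 'a multiform \<Rightarrow> bool" where
  "homogeneous k a \<longleftrightarrow> (\<forall>vs. length vs \<noteq> k \<longrightarrow> a vs = 0)"

lemma homogeneousD: "homogeneous k a \<Longrightarrow> length vs \<noteq> k \<Longrightarrow> a vs = 0"
  by (simp add: homogeneous_def)

lemma ext_prod_zero_left: "(\<And>us. a us = 0) \<Longrightarrow> ext_prod a b vs = 0"
  using ext_prod_scalar[of a b vs] by simp

lemma ext_prod_zero_right:
  assumes "\<And>us. b us = 0"
  shows "ext_prod a b vs = 0"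
proof -
  have "b = (\<lambda>us. 0)" using assms by blast
  then show ?thesis using ext_prod_scale_right[of a 0 b vs] by simp
qed

lemma homogeneous_ext_prod:
  assumes "homogeneous k a" "homogeneous l b"
  shows "homogeneous (k + l) (ext_prod a b)"
  unfolding homogeneous_def
proof (intro allI impI)
  fix vs :: "'a list" assume "length vs \<noteq> k + l"
  then show "ext_prod a b vs = 0"
    using assms
  proof (induction vs arbitrary: a b k l)
    case Nil
    then show ?case by (auto simp: homogeneous_def)
  next
    case (Cons v vs)
    have "ext_prod (contract v a) b vs = 0"
    proof (cases k)
      case 0
      then have "contract v a us = 0" for us
        using Cons.prems(2) by (simp add: contract_def homogeneous_def)
      then show ?thesis by (rule ext_prod_zero_left)
    next
      case (Suc k')
      then have "homogeneous k' (contract v a)"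
        using Cons.prems(2) by (simp add: contract_def homogeneous_def)
      then show ?thesis using Cons.IH[of k' l] Cons.prems(1,3) Suc by simp
    qed
    moreover have "ext_prod (grade_sign a) (contract v b) vs = 0"
    proof (cases l)
      case 0
      then have "contract v b us = 0" for us
        using Cons.prems(3) by (simp add: contract_def homogeneous_def)
      then show ?thesis by (rule ext_prod_zero_right)
    next
      case (Suc l')
      then have "homogeneous l' (contract v b)"
        using Cons.prems(3) by (simp add: contract_def homogeneous_def)
      moreover have "homogeneous k (grade_sign a)"
        using Cons.prems(2) by (simp add: grade_sign_def homogeneous_def)
      ultimately show ?thesis using Cons.IH[of k l'] Cons.prems(1) Suc by simp
    qed
    ultimately show ?case by simp
  qed
qed

lemma homogeneous_wedge_one:
  "homogeneous 1 (\<alpha> x) \<Longrightarrow> homogeneous 1 (\<beta> x) \<Longrightarrow> homogeneous 2 ((\<alpha> \<and>\<^sub>w \<beta>) x)"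
  using homogeneous_ext_prod[of 1 "\<alpha> x" 1 "\<beta> x"] by (simp add: wedge_eq_ext_prod numeral_2_eq_2)

lemma wedge_one_pair:
  assumes "homogeneous 1 (\<alpha> x)" "homogeneous 1 (\<beta> x)"
  shows "(\<alpha> \<and>\<^sub>w \<beta>) x [v, w] = wedge_value (\<lambda>u. \<alpha> x [u]) (\<lambda>u. \<beta> x [u]) v w"
  using assms
  by (simp add: wedge_eq_ext_prod contract_def grade_sign_def wedge_value_def homogeneous_def)

lemma homogeneous_2_eqI:
  assumes "homogeneous 2 a" "homogeneous 2 b" "\<And>v w. a [v, w] = b [v, w]"
  shows "a = b"
proof
  fix vs
  show "a vs = b vs"
  proof (cases "length vs = 2")
    case True
    then obtain v w where "vs = [v, w]"
      by (auto simp: numeral_2_eq_2 length_Suc_conv)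
    then show ?thesis using assms(3) by simp
  qed (use assms(1,2) in \<open>simp add: homogeneous_def\<close>)
qed

lemma homogeneous_1_eqI:
  assumes "homogeneous 1 a" "homogeneous 1 b" "\<And>v. a [v] = b [v]"
  shows "a = b"
proof
  fix vs
  show "a vs = b vs"
  proof (cases "length vs = 1")
    case True
    then obtain v where "vs = [v]" by (auto simp: length_Suc_conv)
    then show ?thesis using assms(3) by simp
  qed (use assms(1,2) in \<open>simp add: homogeneous_def\<close>)
qed

lemma homogeneous_linear:
  "homogeneous k (\<alpha> x) \<Longrightarrow> homogeneous k (\<beta> x) \<Longrightarrow> homogeneous k ((\<alpha> + \<beta>) x)"
  "homogeneous k (\<alpha> x) \<Longrightarrow> homogeneous k (\<beta> x) \<Longrightarrow> homogeneous k ((\<alpha> - \<beta>) x)"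
  "homogeneous k (\<omega> x) \<Longrightarrow> homogeneous k ((f \<cdot> \<omega>) x)"
  by (auto simp: homogeneous_def scale_form_def)

lemma homogeneous_pullback: "homogeneous k (\<omega> (g x)) \<Longrightarrow> homogeneous k (pullback g \<omega> x)"
  by (auto simp: homogeneous_def pullback_def)

lemma ext_d_pair: "ext_d \<omega> x [v, w] = curl (\<lambda>y u. \<omega> y [u]) x v w"
  by (simp add: ext_d_def curl_def numeral_2_eq_2 lessThan_Suc)

lemma homogeneous_ext_d:
  assumes "\<And>x. homogeneous 1 (\<omega> x)"
  shows "homogeneous 2 (ext_d \<omega> x)"
  unfolding homogeneous_def ext_d_def
proof (intro allI impI sum.neutral ballI)
  fix vs :: "'a list" and i
  assume "length vs \<noteq> 2" "i \<in> {..<length vs}"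
  then have "length (take i vs @ drop (Suc i) vs) \<noteq> 1" by auto
  then have "(\<lambda>y. \<omega> y (take i vs @ drop (Suc i) vs)) = (\<lambda>y. 0)"
    using homogeneousD[OF assms] by blast
  then show "(- 1) ^ i * frechet_derivative (\<lambda>y. \<omega> y (take i vs @ drop (Suc i) vs)) (at x) (vs ! i) = 0"
    by (simp add: frechet_derivative_const)
qed

lemma k_forms_on_homogeneous: "\<omega> \<in> k_forms_on k U \<Longrightarrow> x \<in> U \<Longrightarrow> homogeneous k (\<omega> x)"
  by (simp add: k_forms_on_def homogeneous_def)

lemma differential_eq:
  "differential f x vs = (if length vs = 1 then frechet_derivative f (at x) (hd vs) else 0)"
proof (cases "length vs = 1")
  case True
  then obtain v where "vs = [v]" by (auto simp: length_Suc_conv)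
  then show ?thesis by (simp add: ext_d_def zero_form_def)
next
  case False
  have "(\<lambda>y. zero_form f y (take i vs @ drop (Suc i) vs)) = (\<lambda>y. 0)" if "i < length vs" for i
  proof -
    have "length (take i vs @ drop (Suc i) vs) \<noteq> 0" using that False by auto
    then show ?thesis by (simp only: zero_form_def length_0_conv if_False)
  qed
  then show ?thesis
    using False by (auto simp: ext_d_def frechet_derivative_const intro!: sum.neutral)
qed

lemma homogeneous_differential: "homogeneous 1 (differential f x)"
  by (simp add: homogeneous_def differential_eq)

lemma frechet_derivative_nth: "frechet_derivative (\<lambda>w. w $ i) (at x) = (\<lambda>v. v $ i)"
  by (rule frechet_derivative_eqI) (rule bounded_linear_imp_has_derivative[OF bounded_linear_vec_nth])

abbreviation coordinate_form :: "5 \<Rightarrow> (real^5) form" where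
  "coordinate_form i \<equiv> differential (\<lambda>w. w $ i)"

lemma coordinate_form_value: "coordinate_form i x [v] = v $ i"
  by (simp add: differential_eq frechet_derivative_nth)

lemma coordinate_form_wedge_pair:
  "(coordinate_form i \<and>\<^sub>w coordinate_form j) x [v, w] = v $ i * w $ j - w $ i * v $ j"
  unfolding wedge_one_pair[OF homogeneous_differential homogeneous_differential]
  by (simp add: coordinate_form_value wedge_value_def)

lemma coordinate_form_forms_on:
  assumes "open W"
  shows "coordinate_form i \<in> forms_on W"
proof (rule forms_onI)
  have val: "coordinate_form i x vs = (if length vs = 1 then hd vs $ i else 0)" for x vs
    by (simp add: differential_eq frechet_derivative_nth)
  show "alternating_multilinear (coordinate_form i x)" for x
    unfolding alternating_multilinear_def
  proof (intro conjI allI impI)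
    show "linear (\<lambda>v. coordinate_form i x (us @ v # ws))" for us ws
      by (cases us; cases ws) (auto simp: val linear_iff)
    show "coordinate_form i x vs = 0" if "\<not> distinct vs" for vs
      using that by (cases vs) (auto simp: val)
  qed
  show "smooth_on W (\<lambda>x. coordinate_form i x vs)" for vs
    unfolding val by (rule smooth_on_const[OF assms])
qed


subsection \<open>The generators of the ideal of the equation\<close>

abbreviation (input) jet_A :: "real^5 \<Rightarrow> real" where "jet_A w \<equiv> w $ 4 - w $ 2"
abbreviation (input) jet_B :: "real^5 \<Rightarrow> real" where "jet_B w \<equiv> w $ 5 + w $ 1"

text \<open>
  The mixed derivative is represented by \<open>dx \<and> dp\<close>.  The symmetric choice
  \<open>(dx \<and> dp + dq \<and> dy) / 2\<close> differs from it by a multiple of the derivative of the contact form and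
  defines the same ideal, but restricting \<open>dx \<and> dp\<close> to a surface yields exactly the iterated
  derivative in the equation.
\<close>

definition pde_form :: "(real^5) form" where
  "pde_form =
     (\<lambda>w. (jet_A w)\<^sup>2 - (jet_B w)\<^sup>2) \<cdot> (coordinate_form 4 \<and>\<^sub>w coordinate_form 2
       - coordinate_form 1 \<and>\<^sub>w coordinate_form 5)
     + (\<lambda>w. 4 * jet_A w * jet_B w) \<cdot> (coordinate_form 1 \<and>\<^sub>w coordinate_form 4)
     + (\<lambda>w. ((jet_A w)\<^sup>2 + (jet_B w)\<^sup>2)\<^sup>2) \<cdot> (coordinate_form 1 \<and>\<^sub>w coordinate_form 2)"

lemma forms_on_diff:
  assumes "open U" "\<alpha> \<in> forms_on U" "\<beta> \<in> forms_on U"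
  shows "\<alpha> - \<beta> \<in> forms_on U"
proof (rule forms_on_cong[OF assms(1)])
  show "\<alpha> + (\<lambda>_. - 1) \<cdot> \<beta> \<in> forms_on U"
    by (intro forms_on_add forms_on_scale smooth_on_const assms)
qed (auto simp: scale_form_def fun_eq_iff)

lemma pde_form_k_forms:
  assumes "open W"
  shows "pde_form \<in> k_forms_on 2 W"
proof -
  have "pde_form \<in> forms_on W"
    unfolding pde_form_def
    by (intro forms_on_add forms_on_scale forms_on_diff forms_on_wedge coordinate_form_forms_on
        smooth_on_add smooth_on_diff smooth_on_mult smooth_on_power smooth_on_const smooth_on_nth
        assms)
  moreover have "homogeneous 2 (pde_form x)" for x
    unfolding pde_form_def
    by (intro homogeneous_linear homogeneous_wedge_one homogeneous_differential)
  ultimately show ?thesis by (simp add: k_forms_on_def homogeneous_def)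
qed

lemma pde_form_pair: "pde_form x [v, w] =
    ((jet_A x)\<^sup>2 - (jet_B x)\<^sup>2) * ((v $ 4 * w $ 2 - w $ 4 * v $ 2) - (v $ 1 * w $ 5 - w $ 1 * v $ 5))
    + 4 * jet_A x * jet_B x * (v $ 1 * w $ 4 - w $ 1 * v $ 4)
    + ((jet_A x)\<^sup>2 + (jet_B x)\<^sup>2)\<^sup>2 * (v $ 1 * w $ 2 - w $ 1 * v $ 2)"
  by (simp add: pde_form_def scale_form_def coordinate_form_wedge_pair)

lemma homogeneous_contact_form: "homogeneous 1 (contact_form x)"
  unfolding contact_form_def
  by (auto simp: homogeneous_def scale_form_def differential_eq)

lemma contact_form_value: "contact_form x [v] = v $ 3 - x $ 4 * v $ 1 - x $ 5 * v $ 2"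
  by (simp add: contact_form_def scale_form_def coordinate_form_value)

lemma contact_form_forms_on: "open W \<Longrightarrow> contact_form \<in> forms_on W"
  unfolding contact_form_def
  by (intro forms_on_diff forms_on_scale coordinate_form_forms_on smooth_on_nth)

lemma ext_d_contact_form_pair: "ext_d contact_form x [v, w] =
    v $ 1 * w $ 4 - w $ 1 * v $ 4 + v $ 2 * w $ 5 - w $ 2 * v $ 5"
proof -
  have "((\<lambda>y. contact_form y [u]) has_derivative (\<lambda>v. - v $ 4 * u $ 1 - v $ 5 * u $ 2)) (at x)" for u
    unfolding contact_form_value
    by (auto intro!: derivative_eq_intros bounded_linear_imp_has_derivative[OF bounded_linear_vec_nth])
  from this[THEN frechet_derivative_eqI] show ?thesis
    by (simp add: ext_d_pair curl_def algebra_simps)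
qed

lemma ext_d_contact_form_forms_on:
  assumes "open W"
  shows "ext_d contact_form \<in> forms_on W"
proof (rule forms_on_cong[OF assms])
  let ?\<omega> = "coordinate_form 1 \<and>\<^sub>w coordinate_form 4 + coordinate_form 2 \<and>\<^sub>w coordinate_form 5"
  show "?\<omega> \<in> forms_on W"
    by (intro forms_on_add forms_on_wedge coordinate_form_forms_on assms)
  show "ext_d contact_form x = ?\<omega> x" for x
  proof (rule homogeneous_2_eqI)
    show "homogeneous 2 (ext_d contact_form x)" "homogeneous 2 (?\<omega> x)"
      by (intro homogeneous_ext_d homogeneous_contact_form homogeneous_linear
          homogeneous_wedge_one homogeneous_differential)+
    show "ext_d contact_form x [v, w] = ?\<omega> x [v, w]" for v w
      by (simp add: ext_d_contact_form_pair coordinate_form_wedge_pair)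
  qed
qed

lemma has_derivative_real_2:
  fixes h :: "real^2 \<Rightarrow> real"
  assumes "(h has_derivative h') F"
  shows "h' v = v $ 1 * h' (axis 1 1) + v $ 2 * h' (axis 2 1)"
proof -
  have "v = (v $ 1) *\<^sub>R axis 1 1 + (v $ 2) *\<^sub>R axis 2 1"
    by (simp add: vec_eq_iff forall_2 axis_def)
  then have "h' v = h' ((v $ 1) *\<^sub>R axis 1 1 + (v $ 2) *\<^sub>R axis 2 1)" by simp
  then show ?thesis
    using has_derivative_linear[OF assms] by (simp add: linear_add linear_cmul)
qed

text \<open>
  On the surface of a function all two-forms are multiples of \<open>dx \<and> dy\<close>, and the factor of the
  restricted form is the left-hand side of the equation.
\<close>

lemma pde_form_encodes:
  assumes "open W"
  shows "encodes_pde W pde_form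
    (\<lambda>z u. let A = partial 1 z u - u $ 2; B = partial 2 z u + u $ 1 in
       (A\<^sup>2 - B\<^sup>2) * (partial 1 (partial 1 z) u - partial 2 (partial 2 z) u)
       + 4 * A * B * partial 2 (partial 1 z) u + (A\<^sup>2 + B\<^sup>2)\<^sup>2 = 0)"
  unfolding encodes_pde_def
proof (intro conjI allI impI ballI)
  show "pde_form \<in> k_forms_on 2 W" by (rule pde_form_k_forms[OF assms])
  fix D :: "(real^2) set" and z u
  assume D: "open D \<and> smooth_on D z \<and> jet1 z ` D \<subseteq> W" and u: "u \<in> D"
  define A where "A = partial 1 z u - u $ 2"
  define B where "B = partial 2 z u + u $ 1"
  define E where "E = (A\<^sup>2 - B\<^sup>2) * (partial 1 (partial 1 z) u - partial 2 (partial 2 z) u)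
       + 4 * A * B * partial 2 (partial 1 z) u + (A\<^sup>2 + B\<^sup>2)\<^sup>2"
  have der: "(h has_derivative frechet_derivative h (at u)) (at u)"
    if "h = z \<or> h = partial 1 z \<or> h = partial 2 z" for h
    using that D u smooth_on_has_derivative smooth_on_frechet_derivative by blast
  note der = der[of z] der[of "partial 1 z"] der[of "partial 2 z"]
  have "(jet1 z has_derivative (\<lambda>v. vector [v $ 1, v $ 2, frechet_derivative z (at u) v,
      frechet_derivative (partial 1 z) (at u) v, frechet_derivative (partial 2 z) (at u) v])) (at u)"
    unfolding jet1_def[abs_def]
    by (intro has_derivative_vector_5 der bounded_linear_imp_has_derivative[OF bounded_linear_vec_nth])
      simp_all
  note J = frechet_derivative_eqI[OF this]
  have pair: "pullback (jet1 z) pde_form u [v, w] = E * (v $ 1 * w $ 2 - w $ 1 * v $ 2)" for v w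
    unfolding pullback_def J
    using has_derivative_real_2[OF der(2), of v] has_derivative_real_2[OF der(2), of w]
      has_derivative_real_2[OF der(3), of v] has_derivative_real_2[OF der(3), of w]
    by (simp add: pde_form_pair jet1_def E_def A_def B_def algebra_simps)
  have "homogeneous 2 (pullback (jet1 z) pde_form u)"
    using pde_form_k_forms[OF open_UNIV] by (intro homogeneous_pullback k_forms_on_homogeneous) auto
  moreover have "homogeneous 2 (0 :: (real^2) multiform)" by (simp add: homogeneous_def)
  ultimately have "pullback (jet1 z) pde_form u = 0 \<longleftrightarrow> (\<forall>v w. pullback (jet1 z) pde_form u [v, w] = 0)"
    using homogeneous_2_eqI[of "pullback (jet1 z) pde_form u" 0] by auto
  also have "\<dots> \<longleftrightarrow> E = 0"
    unfolding pair
  proof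
    assume "\<forall>v w :: real^2. E * (v $ 1 * w $ 2 - w $ 1 * v $ 2) = 0"
    from this[rule_format, of "axis 1 1" "axis 2 1"] show "E = 0" by (simp add: axis_def)
  qed simp
  finally show "pullback (jet1 z) pde_form u = 0 \<longleftrightarrow> (let A = partial 1 z u - u $ 2; B = partial 2 z u + u $ 1 in
       (A\<^sup>2 - B\<^sup>2) * (partial 1 (partial 1 z) u - partial 2 (partial 2 z) u)
       + 4 * A * B * partial 2 (partial 1 z) u + (A\<^sup>2 + B\<^sup>2)\<^sup>2 = 0)"
    by (simp add: E_def A_def B_def Let_def)
qed


section \<open>The contact equivalence\<close>

text \<open>
  The differentials of the five coordinates separate vectors: as \<open>A\<^sup>2 + B\<^sup>2 = 2 F\<close> does not vanish, \<open>dx\<close>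
  and \<open>dy\<close> determine \<open>\<theta>\<^sup>2\<close> and \<open>\<theta>\<^sup>4\<close>, the contact form determines \<open>\<theta>\<^sup>0\<close>, and \<open>dA\<close> and \<open>dB\<close> determine
  the remaining two forms.
\<close>

lemma contact_diffeomorphism:
  fixes S :: "(real^5) set"
  assumes "structured_coframe S t F" "convex S" "\<And>x. x \<in> S \<Longrightarrow> 0 < F x" "x0 \<in> S"
  obtains V g where "open V" "x0 \<in> V" "V \<subseteq> S" "diffeomorphism V (g ` V) g"
    "\<And>x. x \<in> V \<Longrightarrow> (jet_A (g x))\<^sup>2 + (jet_B (g x))\<^sup>2 = 2 * F x"
    "\<And>x v. x \<in> V \<Longrightarrow> pullback g contact_form x [v] = - 2 * F x * t 0 x v"
    "\<And>x v w. x \<in> V \<Longrightarrow> pullback g (ext_d contact_form) x [v, w] = - 2 * F x *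
      (wedge_value (\<lambda>v. t 1 x v + F x * t 0 x v) (t 2 x) v w
        + wedge_value (\<lambda>v. t 3 x v + F x * t 0 x v) (t 4 x) v w)"
    "\<And>x v w. x \<in> V \<Longrightarrow> pullback g pde_form x [v, w] =
      - 4 * F x * (F x + jet_A (g x) * jet_B (g x))
          * wedge_value (\<lambda>v. t 1 x v + F x * t 0 x v) (t 2 x) v w
      + 4 * F x * (F x - jet_A (g x) * jet_B (g x))
          * wedge_value (\<lambda>v. t 3 x v + F x * t 0 x v) (t 4 x) v w"
proof -
  interpret structured_coframe S t F by (rule assms(1))
  obtain A B X Y Z where AB: "\<And>x. x \<in> S \<Longrightarrow> (A x)\<^sup>2 + (B x)\<^sup>2 = 2 * F x"
    and A: "\<And>x. x \<in> S \<Longrightarrow> (A has_derivative (\<lambda>v.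
        A x * (F x * (2 * t 0 x v - t 2 x v - t 4 x v) + t 1 x v + t 3 x v)
        - B x * (t 2 x v + t 4 x v - t 1 x v + t 3 x v))) (at x)"
    and B: "\<And>x. x \<in> S \<Longrightarrow> (B has_derivative (\<lambda>v.
        B x * (F x * (2 * t 0 x v - t 2 x v - t 4 x v) + t 1 x v + t 3 x v)
        + A x * (t 2 x v + t 4 x v - t 1 x v + t 3 x v))) (at x)"
    and X: "\<And>x. x \<in> S \<Longrightarrow> (X has_derivative (\<lambda>v.
        (A x * (t 2 x v + t 4 x v) - B x * (t 4 x v - t 2 x v)) / 2)) (at x)"
    and Y: "\<And>x. x \<in> S \<Longrightarrow> (Y has_derivative (\<lambda>v.
        (B x * (t 2 x v + t 4 x v) + A x * (t 4 x v - t 2 x v)) / 2)) (at x)"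
    and Z: "\<And>x. x \<in> S \<Longrightarrow> (Z has_derivative (\<lambda>v. - 2 * F x * t 0 x v
        + (A x + Y x) * ((A x * (t 2 x v + t 4 x v) - B x * (t 4 x v - t 2 x v)) / 2)
        + (B x - X x) * ((B x * (t 2 x v + t 4 x v) + A x * (t 4 x v - t 2 x v)) / 2))) (at x)"
    and smooth: "smooth_on S A" "smooth_on S B" "smooth_on S X" "smooth_on S Y" "smooth_on S Z"
    using contact_coordinates[OF assms(2,3)] by blast
  define g where "g x = (vector [X x, Y x, Z x, A x + Y x, B x - X x] :: real^5)" for x
  \<comment> \<open>With the factor one half included here, \<open>dx\<close> and \<open>dy\<close> have no denominators.\<close>
  define s where "s x v = (t 2 x v + t 4 x v) / 2" for x v
  define d where "d x v = (t 4 x v - t 2 x v) / 2" for x v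
  define \<nu> where "\<nu> x v = F x * (2 * t 0 x v - t 2 x v - t 4 x v) + t 1 x v + t 3 x v" for x v
  define \<gamma> where "\<gamma> x v = t 2 x v + t 4 x v - t 1 x v + t 3 x v" for x v
  define dx where "dx x v = A x * s x v - B x * d x v" for x v
  define dy where "dy x v = B x * s x v + A x * d x v" for x v
  define dA where "dA x v = A x * \<nu> x v - B x * \<gamma> x v" for x v
  define dB where "dB x v = B x * \<nu> x v + A x * \<gamma> x v" for x v
  define g' where "g' x v = (vector [dx x v, dy x v, - 2 * F x * t 0 x v + (A x + Y x) * dx x v
      + (B x - X x) * dy x v, dA x v + dy x v, dB x v - dx x v] :: real^5)" for x v
  have g_deriv: "(g has_derivative g' x) (at x)" if "x \<in> S" for x
  proof -
    have X': "(X has_derivative dx x) (at x)" and Y': "(Y has_derivative dy x) (at x)"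
      and Z': "(Z has_derivative (\<lambda>v. - 2 * F x * t 0 x v + (A x + Y x) * dx x v
        + (B x - X x) * dy x v)) (at x)"
      and A': "(A has_derivative dA x) (at x)" and B': "(B has_derivative dB x) (at x)"
      by (rule has_derivative_eq_rhs[OF X[OF that]] has_derivative_eq_rhs[OF Y[OF that]]
          has_derivative_eq_rhs[OF Z[OF that]] has_derivative_eq_rhs[OF A[OF that]]
          has_derivative_eq_rhs[OF B[OF that]];
          simp add: fun_eq_iff dx_def dy_def dA_def dB_def s_def d_def \<nu>_def \<gamma>_def field_simps)+
    show ?thesis
      unfolding g_def[abs_def] g'_def[abs_def]
      by (intro has_derivative_vector_5 has_derivative_add has_derivative_diff X' Y' Z' A' B')
  qed
  note fg' = frechet_derivative_eqI[OF g_deriv]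
  have smooth_g: "smooth_on S g"
    unfolding g_def[abs_def]
    by (intro smooth_on_vector_5 smooth_on_add smooth_on_diff smooth open_S)
  have inj_g': "inj (g' x)" if x: "x \<in> S" for x
  proof -
    have "v = 0" if "g' x v = 0" for v
    proof -
      have "g' x v $ i = 0" for i using that by simp
      from this[of 1] this[of 2] this[of 3] this[of 4] this[of 5]
      have 0: "dx x v = 0" "dy x v = 0" "F x * t 0 x v = 0" "dA x v = 0" "dB x v = 0"
        by (simp_all add: g'_def)
      have AB_pos: "A x * A x + B x * B x > 0"
        using AB[OF x] assms(3)[OF x] by (simp add: power2_eq_square)
      have rot: "a = 0 \<and> b = 0" if "A x * a - B x * b = 0" "B x * a + A x * b = 0" for a b
      proof -
        have "(A x * A x + B x * B x) * a = 0" "(A x * A x + B x * B x) * b = 0"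
          using that by algebra+
        then show ?thesis using AB_pos by auto
      qed
      have "s x v = 0" "d x v = 0" "\<nu> x v = 0" "\<gamma> x v = 0"
        using rot[of "s x v" "d x v"] rot[of "\<nu> x v" "\<gamma> x v"] 0
        by (auto simp: dx_def dy_def dA_def dB_def)
      moreover have "t 0 x v = 0" using 0(3) assms(3)[OF x] by simp
      ultimately have *: "t 0 x v = 0" "t 1 x v = 0" "t 2 x v = 0" "t 3 x v = 0" "t 4 x v = 0"
        by (simp_all add: s_def d_def \<nu>_def \<gamma>_def)
      have "t i x v = 0" if "i < 5" for i
      proof -
        have "i = 0 \<or> i = 1 \<or> i = 2 \<or> i = 3 \<or> i = 4" using that by arith
        then show ?thesis using * by blast
      qed
      then show ?thesis by (rule separating[OF x])
    qed
    then show ?thesis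
      using linear_injective_0[OF has_derivative_linear[OF g_deriv[OF x]]] by blast
  qed
  obtain V where V: "open V" "x0 \<in> V" "V \<subseteq> S" "diffeomorphism V (g ` V) g"
    using smooth_local_inverse[OF open_S smooth_g assms(4)] inj_g'[OF assms(4)] fg'[OF assms(4)]
    by metis
  have jet: "jet_A (g x) = A x" "jet_B (g x) = B x" for x
    by (simp_all add: g_def)
  have pull: "pullback g \<omega> x [v] = \<omega> (g x) [g' x v]"
    "pullback g \<omega> x [v, w] = \<omega> (g x) [g' x v, g' x w]" if "x \<in> V" for \<omega> x v w
    using that V(3) by (auto simp: pullback_def fg' subset_iff)
  have t24: "t 2 x v = s x v - d x v" "t 4 x v = s x v + d x v" for x v
    by (simp_all add: s_def d_def field_simps)
  have t13: "t 1 x v + F x * t 0 x v = (\<nu> x v - \<gamma> x v) / 2 + (F x + 1) * s x v"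
    "t 3 x v + F x * t 0 x v = (\<nu> x v + \<gamma> x v) / 2 + (F x - 1) * s x v" for x v
    by (simp_all add: \<nu>_def \<gamma>_def s_def field_simps)
  show thesis
  proof (rule that[OF V])
    fix x v w assume x: "x \<in> V"
    then have xS: "x \<in> S" using V(3) by blast
    show "(jet_A (g x))\<^sup>2 + (jet_B (g x))\<^sup>2 = 2 * F x"
      using AB[OF xS] by (simp add: jet)
    show "pullback g contact_form x [v] = - 2 * F x * t 0 x v"
      by (simp add: pull[OF x] contact_form_value g_def g'_def)
    define n where "n v = \<nu> x v / 2" for v
    define c where "c v = \<gamma> x v / 2" for v
    have nc: "\<nu> x v = 2 * n v" "\<gamma> x v = 2 * c v" for v by (simp_all add: n_def c_def)
    have t13': "t 1 x v + F x * t 0 x v = n v - c v + (F x + 1) * s x v"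
      "t 3 x v + F x * t 0 x v = n v + c v + (F x - 1) * s x v" for v
      unfolding t13 nc by (simp_all add: field_simps)
    have F_eq: "2 * F x = A x * A x + B x * B x" using AB[OF xS] by (simp add: power2_eq_square)
    have "wedge_value (\<lambda>v. t 1 x v + F x * t 0 x v) (t 2 x) v w
        = (n v - c v + (F x + 1) * s x v) * (s x w - d x w)
        - (n w - c w + (F x + 1) * s x w) * (s x v - d x v)"
      and "wedge_value (\<lambda>v. t 3 x v + F x * t 0 x v) (t 4 x) v w
        = (n v + c v + (F x - 1) * s x v) * (s x w + d x w)
        - (n w + c w + (F x - 1) * s x w) * (s x v + d x v)"
      by (simp_all only: wedge_value_def t24 t13')
    note PQ = this
    have d_eq: "pullback g (ext_d contact_form) x [v, w]
        = (A x * A x + B x * B x) * (2 * (s x v * n w - s x w * n v) + 2 * (d x v * c w - d x w * c v)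
          + 2 * (s x v * d x w - s x w * d x v))"
      unfolding pull[OF x] ext_d_contact_form_pair g'_def vector_5 dx_def dy_def dA_def dB_def nc
      by (simp add: algebra_simps)
    show "pullback g (ext_d contact_form) x [v, w] = - 2 * F x *
      (wedge_value (\<lambda>v. t 1 x v + F x * t 0 x v) (t 2 x) v w
        + wedge_value (\<lambda>v. t 3 x v + F x * t 0 x v) (t 4 x) v w)"
      unfolding d_eq PQ F_eq[symmetric] by (simp add: algebra_simps)
    \<comment> \<open>The symbol of the equation is the real part of a square, hence simple in the rotated frame.\<close>
    have "pullback g pde_form x [v, w] = (A x * A x + B x * B x)\<^sup>2 *
        (2 * (n v * d x w - n w * d x v) - 2 * (s x v * c w - s x w * c v)
        + 2 * F x * (s x v * d x w - s x w * d x v))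
        + 2 * A x * B x * pullback g (ext_d contact_form) x [v, w]"
      unfolding d_eq unfolding pull[OF x] pde_form_pair jet g'_def vector_5 dx_def dy_def dA_def dB_def nc F_eq
      by (simp add: algebra_simps power2_eq_square)
    then show "pullback g pde_form x [v, w] =
      - 4 * F x * (F x + jet_A (g x) * jet_B (g x))
          * wedge_value (\<lambda>v. t 1 x v + F x * t 0 x v) (t 2 x) v w
      + 4 * F x * (F x - jet_A (g x) * jet_B (g x))
          * wedge_value (\<lambda>v. t 3 x v + F x * t 0 x v) (t 4 x) v w"
      unfolding d_eq PQ jet F_eq[symmetric] by (simp add: algebra_simps power2_eq_square)
  qed
qed


subsection \<open>Comparison of the ideals\<close>

text \<open>
  The forms \<open>c2\<close> and \<open>c3\<close> are combinations of two decomposable forms \<open>P\<close> and \<open>Q\<close> whose coefficient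
  matrix has determinant \<open>- 16 F\<^sup>3\<close>, so \<open>P\<close> and \<open>Q\<close> can be recovered.  They differ from the products
  \<open>\<theta> 1 \<and>\<^sub>w \<theta> 2\<close> and \<open>\<theta> 3 \<and>\<^sub>w \<theta> 4\<close> by multiples of \<open>\<theta> 0\<close>, which is proportional to \<open>c1\<close>.
\<close>

lemma generated_ideal_contact_eq:
  fixes V :: "'a::real_normed_vector set" and \<theta> :: "nat \<Rightarrow> 'a form"
  assumes V: "open V" and \<theta>: "\<And>i. i < 5 \<Longrightarrow> \<theta> i \<in> k_forms_on 1 V"
    and F: "smooth_on V F" "\<And>x. x \<in> V \<Longrightarrow> F x \<noteq> 0" and h: "smooth_on V h"
    and c: "c1 \<in> forms_on V" "c2 \<in> forms_on V" "c3 \<in> forms_on V"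
    and hom: "\<And>x. homogeneous 1 (c1 x)" "\<And>x. homogeneous 2 (c2 x)" "\<And>x. homogeneous 2 (c3 x)"
    and c1: "\<And>x v. x \<in> V \<Longrightarrow> c1 x [v] = - 2 * F x * \<theta> 0 x [v]"
    and c2: "\<And>x v w. x \<in> V \<Longrightarrow> c2 x [v, w] = - 2 * F x *
      (wedge_value (\<lambda>v. \<theta> 1 x [v] + F x * \<theta> 0 x [v]) (\<lambda>v. \<theta> 2 x [v]) v w
        + wedge_value (\<lambda>v. \<theta> 3 x [v] + F x * \<theta> 0 x [v]) (\<lambda>v. \<theta> 4 x [v]) v w)"
    and c3: "\<And>x v w. x \<in> V \<Longrightarrow> c3 x [v, w] =
      - 4 * F x * (F x + h x)
          * wedge_value (\<lambda>v. \<theta> 1 x [v] + F x * \<theta> 0 x [v]) (\<lambda>v. \<theta> 2 x [v]) v w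
      + 4 * F x * (F x - h x)
          * wedge_value (\<lambda>v. \<theta> 3 x [v] + F x * \<theta> 0 x [v]) (\<lambda>v. \<theta> 4 x [v]) v w"
  shows "generated_ideal V {c1, c2, c3}
    = generated_ideal V {\<theta> 0, \<theta> 1 \<and>\<^sub>w \<theta> 2, \<theta> 3 \<and>\<^sub>w \<theta> 4}" (is "?C = ?I")
proof
  define P where "P = \<theta> 1 \<and>\<^sub>w \<theta> 2 + (\<lambda>x. - F x) \<cdot> (\<theta> 2 \<and>\<^sub>w \<theta> 0)"
  define Q where "Q = \<theta> 3 \<and>\<^sub>w \<theta> 4 + (\<lambda>x. - F x) \<cdot> (\<theta> 4 \<and>\<^sub>w \<theta> 0)"
  have forms: "\<theta> i \<in> forms_on V" if "i < 5" for i
    using \<theta>[OF that] by (simp add: k_forms_on_def)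
  have hom1: "homogeneous 1 (\<theta> i x)" if "i < 5" "x \<in> V" for i x
    by (rule k_forms_on_homogeneous[OF \<theta>]) (use that in auto)
  have pair: "(\<theta> i \<and>\<^sub>w \<theta> j) x [v, w] = wedge_value (\<lambda>v. \<theta> i x [v]) (\<lambda>v. \<theta> j x [v]) v w"
    if "i < 5" "j < 5" "x \<in> V" for i j x v w
    by (rule wedge_one_pair[OF hom1 hom1]) (use that in auto)
  have P_pair: "P x [v, w] = wedge_value (\<lambda>v. \<theta> 1 x [v] + F x * \<theta> 0 x [v]) (\<lambda>v. \<theta> 2 x [v]) v w"
    and Q_pair: "Q x [v, w] = wedge_value (\<lambda>v. \<theta> 3 x [v] + F x * \<theta> 0 x [v]) (\<lambda>v. \<theta> 4 x [v]) v w"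
    if "x \<in> V" for x v w
  proof -
    note pairs = pair[of 1 2 x, OF _ _ that] pair[of 2 0 x, OF _ _ that]
      pair[of 3 4 x, OF _ _ that] pair[of 4 0 x, OF _ _ that]
    have "P x [v, w] = (\<theta> 1 \<and>\<^sub>w \<theta> 2) x [v, w] - F x * (\<theta> 2 \<and>\<^sub>w \<theta> 0) x [v, w]"
      "Q x [v, w] = (\<theta> 3 \<and>\<^sub>w \<theta> 4) x [v, w] - F x * (\<theta> 4 \<and>\<^sub>w \<theta> 0) x [v, w]"
      by (simp_all add: P_def Q_def scale_form_def)
    then show "P x [v, w] = wedge_value (\<lambda>v. \<theta> 1 x [v] + F x * \<theta> 0 x [v]) (\<lambda>v. \<theta> 2 x [v]) v w"
      "Q x [v, w] = wedge_value (\<lambda>v. \<theta> 3 x [v] + F x * \<theta> 0 x [v]) (\<lambda>v. \<theta> 4 x [v]) v w"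
      by (simp_all add: pairs[simplified] wedge_value_def algebra_simps)
  qed
  have c2': "c2 x [v, w] = - 2 * F x * (P x [v, w] + Q x [v, w])"
    and c3': "c3 x [v, w] = - 4 * F x * (F x + h x) * P x [v, w] + 4 * F x * (F x - h x) * Q x [v, w]"
    if "x \<in> V" for x v w
    by (simp_all only: c2[OF that] c3[OF that] P_pair[OF that] Q_pair[OF that])
  have hom_PQ: "homogeneous 2 (P x)" "homogeneous 2 (Q x)" if "x \<in> V" for x
    unfolding P_def Q_def
    by (intro homogeneous_linear homogeneous_wedge_one hom1 that; simp)+
  note smooth_intros = smooth_on_divide smooth_on_mult smooth_on_add smooth_on_diff smooth_on_minus
    smooth_on_power smooth_on_const F(1) h
  have PQ_I: "P \<in> ?I" "Q \<in> ?I"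
    unfolding P_def Q_def
    by (intro generated_ideal_add generated_ideal_scale generated_ideal_wedge smooth_intros
        generated_ideal_generator V forms forms_on_wedge; simp)+
  have "c1 \<in> ?I"
  proof (rule generated_ideal_cong[OF V])
    show "(\<lambda>x. - 2 * F x) \<cdot> \<theta> 0 \<in> ?I"
      by (intro generated_ideal_scale generated_ideal_generator V smooth_intros forms; simp)
    show "c1 x = ((\<lambda>x. - 2 * F x) \<cdot> \<theta> 0) x" if "x \<in> V" for x
    proof (rule homogeneous_1_eqI[OF hom(1)])
      show "homogeneous 1 (((\<lambda>x. - 2 * F x) \<cdot> \<theta> 0) x)"
        by (intro homogeneous_linear hom1 that) simp
      show "c1 x [v] = ((\<lambda>x. - 2 * F x) \<cdot> \<theta> 0) x [v]" for v
        by (simp add: c1 that scale_form_def)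
    qed
  qed
  moreover have "c2 \<in> ?I"
  proof (rule generated_ideal_cong[OF V])
    show "(\<lambda>x. - 2 * F x) \<cdot> (P + Q) \<in> ?I"
      by (intro generated_ideal_scale generated_ideal_add PQ_I V smooth_intros)
    show "c2 x = ((\<lambda>x. - 2 * F x) \<cdot> (P + Q)) x" if "x \<in> V" for x
    proof (rule homogeneous_2_eqI[OF hom(2)])
      show "homogeneous 2 (((\<lambda>x. - 2 * F x) \<cdot> (P + Q)) x)"
        by (intro homogeneous_linear hom_PQ that)
      show "c2 x [v, w] = ((\<lambda>x. - 2 * F x) \<cdot> (P + Q)) x [v, w]" for v w
        by (simp add: c2' that scale_form_def)
    qed
  qed
  moreover have "c3 \<in> ?I"
  proof (rule generated_ideal_cong[OF V])
    let ?r = "(\<lambda>x. - 4 * F x * (F x + h x)) \<cdot> P + (\<lambda>x. 4 * F x * (F x - h x)) \<cdot> Q"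
    show "?r \<in> ?I"
      by (intro generated_ideal_scale generated_ideal_add PQ_I V smooth_intros)
    show "c3 x = ?r x" if "x \<in> V" for x
    proof (rule homogeneous_2_eqI[OF hom(3)])
      show "homogeneous 2 (?r x)"
        by (intro homogeneous_linear hom_PQ that)
      show "c3 x [v, w] = ?r x [v, w]" for v w
        by (simp add: c3' that scale_form_def)
    qed
  qed
  ultimately show "?C \<subseteq> ?I"
    by (intro generated_ideal_subsetI[OF V]) auto
  have c_C: "c1 \<in> ?C" "c2 \<in> ?C" "c3 \<in> ?C"
    by (intro generated_ideal_generator V c; simp)+
  have \<theta>0_C: "\<theta> 0 \<in> ?C"
  proof (rule generated_ideal_cong[OF V])
    show "(\<lambda>x. - 1 / (2 * F x)) \<cdot> c1 \<in> ?C"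
      by (intro generated_ideal_scale c_C V smooth_intros) (simp add: F(2))
    show "\<theta> 0 x = ((\<lambda>x. - 1 / (2 * F x)) \<cdot> c1) x" if "x \<in> V" for x
    proof (rule homogeneous_1_eqI)
      show "homogeneous 1 (\<theta> 0 x)" by (rule hom1) (use that in auto)
      show "homogeneous 1 (((\<lambda>x. - 1 / (2 * F x)) \<cdot> c1) x)"
        by (intro homogeneous_linear hom)
      show "\<theta> 0 x [v] = ((\<lambda>x. - 1 / (2 * F x)) \<cdot> c1) x [v]" for v
        by (simp add: scale_form_def c1 that F(2))
    qed
  qed
  have P_C: "P \<in> ?C"
  proof (rule generated_ideal_cong[OF V])
    let ?r = "(\<lambda>x. - (F x - h x) / (4 * (F x)\<^sup>2)) \<cdot> c2 + (\<lambda>x. - 1 / (8 * (F x)\<^sup>2)) \<cdot> c3"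
    show "?r \<in> ?C"
      by (intro generated_ideal_add generated_ideal_scale c_C V smooth_intros) (simp_all add: F(2))
    show "P x = ?r x" if "x \<in> V" for x
    proof (rule homogeneous_2_eqI[OF hom_PQ(1)[OF that]])
      show "homogeneous 2 (?r x)" by (intro homogeneous_linear hom)
      show "P x [v, w] = ?r x [v, w]" for v w
        using F(2)[OF that]
        by (simp add: scale_form_def c2' c3' that field_simps power2_eq_square)
    qed
  qed
  have Q_C: "Q \<in> ?C"
  proof (rule generated_ideal_cong[OF V])
    let ?r = "(\<lambda>x. - (F x + h x) / (4 * (F x)\<^sup>2)) \<cdot> c2 + (\<lambda>x. 1 / (8 * (F x)\<^sup>2)) \<cdot> c3"
    show "?r \<in> ?C"
      by (intro generated_ideal_add generated_ideal_scale c_C V smooth_intros) (simp_all add: F(2))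
    show "Q x = ?r x" if "x \<in> V" for x
    proof (rule homogeneous_2_eqI[OF hom_PQ(2)[OF that]])
      show "homogeneous 2 (?r x)" by (intro homogeneous_linear hom)
      show "Q x [v, w] = ?r x [v, w]" for v w
        using F(2)[OF that]
        by (simp add: scale_form_def c2' c3' that field_simps power2_eq_square)
    qed
  qed
  have "\<theta> 1 \<and>\<^sub>w \<theta> 2 \<in> ?C"
  proof (rule generated_ideal_cong[OF V])
    show "P + F \<cdot> (\<theta> 2 \<and>\<^sub>w \<theta> 0) \<in> ?C"
      by (intro generated_ideal_add generated_ideal_scale generated_ideal_wedge P_C \<theta>0_C V F(1) forms)
        simp
  qed (simp add: P_def scale_form_def fun_eq_iff)
  moreover have "\<theta> 3 \<and>\<^sub>w \<theta> 4 \<in> ?C"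
  proof (rule generated_ideal_cong[OF V])
    show "Q + F \<cdot> (\<theta> 4 \<and>\<^sub>w \<theta> 0) \<in> ?C"
      by (intro generated_ideal_add generated_ideal_scale generated_ideal_wedge Q_C \<theta>0_C V F(1) forms)
        simp
  qed (simp add: Q_def scale_form_def fun_eq_iff)
  ultimately show "?I \<subseteq> ?C"
    using \<theta>0_C by (intro generated_ideal_subsetI[OF V]) auto
qed

lemma local_equivalence_positive:
  fixes S :: "(real^5) set" and \<theta> :: "nat \<Rightarrow> (real^5) form"
  assumes frame: "structured_coframe S (\<lambda>i x v. \<theta> i x [v]) F"
    and \<theta>: "\<And>i. i < 5 \<Longrightarrow> \<theta> i \<in> k_forms_on 1 S"
    and "convex S" "\<And>x. x \<in> S \<Longrightarrow> 0 < F x" "x0 \<in> S"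
  obtains V g where "x0 \<in> V" "V \<subseteq> S" "g ` V \<subseteq> {w. w $ 4 - w $ 2 \<noteq> 0 \<or> w $ 5 + w $ 1 \<noteq> 0}"
    "open V" "diffeomorphism V (g ` V) g"
    "\<And>\<omega>. \<omega> \<in> forms_on (g ` V) \<Longrightarrow>
      \<omega> \<in> generated_ideal (g ` V) {contact_form, ext_d contact_form, pde_form} \<longleftrightarrow>
      pullback g \<omega> \<in> generated_ideal V {\<theta> 0, \<theta> 1 \<and>\<^sub>w \<theta> 2, \<theta> 3 \<and>\<^sub>w \<theta> 4}"
proof (rule contact_diffeomorphism[OF frame assms(3-5)])
  fix V g assume V: "open V" "x0 \<in> V" "V \<subseteq> S" "diffeomorphism V (g ` V) g"
    and AB: "\<And>x. x \<in> V \<Longrightarrow> (jet_A (g x))\<^sup>2 + (jet_B (g x))\<^sup>2 = 2 * F x"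
    and pull1: "\<And>x v. x \<in> V \<Longrightarrow> pullback g contact_form x [v] = - 2 * F x * \<theta> 0 x [v]"
    and pull2: "\<And>x v w. x \<in> V \<Longrightarrow> pullback g (ext_d contact_form) x [v, w] = - 2 * F x *
      (wedge_value (\<lambda>v. \<theta> 1 x [v] + F x * \<theta> 0 x [v]) (\<lambda>v. \<theta> 2 x [v]) v w
        + wedge_value (\<lambda>v. \<theta> 3 x [v] + F x * \<theta> 0 x [v]) (\<lambda>v. \<theta> 4 x [v]) v w)"
    and pull3: "\<And>x v w. x \<in> V \<Longrightarrow> pullback g pde_form x [v, w] =
      - 4 * F x * (F x + jet_A (g x) * jet_B (g x))
          * wedge_value (\<lambda>v. \<theta> 1 x [v] + F x * \<theta> 0 x [v]) (\<lambda>v. \<theta> 2 x [v]) v w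
      + 4 * F x * (F x - jet_A (g x) * jet_B (g x))
          * wedge_value (\<lambda>v. \<theta> 3 x [v] + F x * \<theta> 0 x [v]) (\<lambda>v. \<theta> 4 x [v]) v w"
  have W: "open (g ` V)" and smooth_g: "smooth_on V g"
    using V(4) by (auto simp: diffeomorphism_def)
  have pde: "pde_form \<in> forms_on U" if "open U" for U
    using pde_form_k_forms[OF that] by (simp add: k_forms_on_def)
  have gens: "{contact_form, ext_d contact_form, pde_form} \<subseteq> forms_on (g ` V)"
    using contact_form_forms_on[OF W] ext_d_contact_form_forms_on[OF W] pde[OF W] by simp
  have comp: "smooth_on V (\<lambda>x. g x $ i)" for i
    by (rule smooth_on_compose[OF V(1) open_UNIV _ smooth_g smooth_on_nth]) auto
  have "generated_ideal V {pullback g contact_form, pullback g (ext_d contact_form), pullback g pde_form}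
      = generated_ideal V {\<theta> 0, \<theta> 1 \<and>\<^sub>w \<theta> 2, \<theta> 3 \<and>\<^sub>w \<theta> 4}"
  proof (rule generated_ideal_contact_eq[OF V(1) _ _ _ _ _ _ _ _ _ _ pull1 pull2 pull3])
    show "\<theta> i \<in> k_forms_on 1 V" if "i < 5" for i
      using \<theta>[OF that] V(3) forms_on_subset by (auto simp: k_forms_on_def)
    show "smooth_on V F" by (rule smooth_on_subset[OF structured_coframe.smooth_F[OF frame] V(3)])
    show "F x \<noteq> 0" if "x \<in> V" for x using assms(4)[of x] V(3) that by auto
    show "smooth_on V (\<lambda>x. jet_A (g x) * jet_B (g x))"
      by (intro smooth_on_mult smooth_on_diff smooth_on_add comp V(1))
    show "pullback g contact_form \<in> forms_on V" "pullback g (ext_d contact_form) \<in> forms_on V"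
      "pullback g pde_form \<in> forms_on V"
      using forms_on_pullback[OF V(1) W subset_refl smooth_g] gens by auto
    show "homogeneous 1 (pullback g contact_form x)" for x
      by (rule homogeneous_pullback[of 1 _ g, OF homogeneous_contact_form])
    show "homogeneous 2 (pullback g (ext_d contact_form) x)" for x
      by (intro homogeneous_pullback homogeneous_ext_d homogeneous_contact_form)
    show "homogeneous 2 (pullback g pde_form x)" for x
      using pde_form_k_forms[OF open_UNIV] by (intro homogeneous_pullback k_forms_on_homogeneous) auto
  qed
  then have "\<omega> \<in> generated_ideal (g ` V) {contact_form, ext_d contact_form, pde_form} \<longleftrightarrow>
      pullback g \<omega> \<in> generated_ideal V {\<theta> 0, \<theta> 1 \<and>\<^sub>w \<theta> 2, \<theta> 3 \<and>\<^sub>w \<theta> 4}"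
    if "\<omega> \<in> forms_on (g ` V)" for \<omega>
    using diffeomorphism_generated_ideal_iff[OF V(4) gens that] by simp
  moreover have "g ` V \<subseteq> {w. w $ 4 - w $ 2 \<noteq> 0 \<or> w $ 5 + w $ 1 \<noteq> 0}"
  proof -
    have "jet_A (g x) \<noteq> 0 \<or> jet_B (g x) \<noteq> 0" if x: "x \<in> V" for x
    proof -
      have "0 < F x" using assms(4) V(3) x by blast
      then show ?thesis using AB[OF x] by auto
    qed
    then show ?thesis by blast
  qed
  ultimately show thesis using that V by blast
qed


subsection \<open>Reversing the sign of the invariant\<close>

text \<open>
  Exchanging the two characteristic systems of the ideal, with suitable signs, is an involution of
  the structure equations that reverses the sign of \<open>F\<close>.
\<close>

definition exchange :: "(nat \<Rightarrow> 'a form) \<Rightarrow> nat \<Rightarrow> 'a form" where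
  "exchange \<theta> i = (if i = 0 then (\<lambda>_. - 1) \<cdot> \<theta> 0 else if i = 1 then \<theta> 3
     else if i = 2 then (\<lambda>_. - 1) \<cdot> \<theta> 4 else if i = 3 then \<theta> 1 else (\<lambda>_. - 1) \<cdot> \<theta> 2)"

lemma curl_uminus:
  assumes "\<And>u. smooth_on S (\<lambda>y. a y u)" "x \<in> S"
  shows "curl (\<lambda>y u. - a y u) x v w = - curl a x v w"
  using frechet_derivative_eqI[OF has_derivative_minus[OF smooth_on_has_derivative[OF assms]]]
  by (simp add: curl_def)

lemma structured_coframe_exchange:
  assumes "structured_coframe S (\<lambda>i x v. \<theta> i x [v]) F"
  shows "structured_coframe S (\<lambda>i x v. exchange \<theta> i x [v]) (\<lambda>x. - F x)"
proof -
  interpret structured_coframe S "\<lambda>i x v. \<theta> i x [v]" F by (rule assms)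
  have ex: "exchange \<theta> 0 x [v] = - \<theta> 0 x [v]" "exchange \<theta> 1 x [v] = \<theta> 3 x [v]"
    "exchange \<theta> 2 x [v] = - \<theta> 4 x [v]" "exchange \<theta> 3 x [v] = \<theta> 1 x [v]"
    "exchange \<theta> 4 x [v] = - \<theta> 2 x [v]" for x v
    by (simp_all add: exchange_def scale_form_def)
  have cases: "i = 0 \<or> i = 1 \<or> i = 2 \<or> i = 3 \<or> i = 4" if "i < 5" for i :: nat
    using that by arith
  have neg: "curl (\<lambda>y u. - \<theta> i y [u]) x v w = - curl (\<lambda>y u. \<theta> i y [u]) x v w"
    if "i < 5" "x \<in> S" for i x v w
    by (rule curl_uminus[OF smooth_t[OF that(1)] that(2)])
  show ?thesis
  proof (rule structured_coframe.intro)
    show "open S" by (rule open_S)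
    show "linear (\<lambda>v. exchange \<theta> i x [v])" if "i < 5" "x \<in> S" for i x
      using cases[OF that(1)] linear_t[OF _ that(2)]
      by (elim disjE) (simp_all only: ex, auto intro!: linear_compose_neg)
    show "smooth_on S (\<lambda>x. exchange \<theta> i x [v])" if "i < 5" for i v
      using cases[OF that] smooth_t
      by (elim disjE) (simp_all only: ex, auto intro!: smooth_on_minus open_S)
    show "v = 0" if x: "x \<in> S" and 0: "\<And>i. i < 5 \<Longrightarrow> exchange \<theta> i x [v] = 0" for x v
    proof (rule separating[OF x])
      have "\<theta> 0 x [v] = 0" "\<theta> 1 x [v] = 0" "\<theta> 2 x [v] = 0" "\<theta> 3 x [v] = 0" "\<theta> 4 x [v] = 0"
        using 0[of 0] 0[of 1] 0[of 2] 0[of 3] 0[of 4] by (simp_all only: ex, simp_all)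
      then show "\<theta> i x [v] = 0" if "i < 5" for i
        using cases[OF that] by blast
    qed
    show "smooth_on S (\<lambda>x. - F x)" by (rule smooth_on_minus[OF open_S smooth_F])
    fix x v w assume x: "x \<in> S"
    show "frechet_derivative (\<lambda>x. - F x) (at x) v
      = 2 * (- F x)\<^sup>2 * (2 * exchange \<theta> 0 x [v] - exchange \<theta> 2 x [v] - exchange \<theta> 4 x [v])
        + 2 * - F x * (exchange \<theta> 1 x [v] + exchange \<theta> 3 x [v])"
      unfolding frechet_derivative_eqI[OF has_derivative_minus[OF smooth_on_has_derivative[OF smooth_F x]]]
        F_deriv[OF x] ex
      by (simp add: algebra_simps)
  qed (simp_all only: ex neg curl_0 curl_1 curl_2 curl_3 curl_4 wedge_value_def,
      simp_all add: algebra_simps)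
qed

lemma exchange_k_forms:
  assumes "open S" "\<And>i. i < 5 \<Longrightarrow> \<theta> i \<in> k_forms_on 1 S" "i < 5"
  shows "exchange \<theta> i \<in> k_forms_on 1 S"
proof -
  have "(\<lambda>_. - 1) \<cdot> \<theta> j \<in> k_forms_on 1 S" if "j < 5" for j
  proof -
    have "\<theta> j \<in> forms_on S" and 0: "\<And>x vs. x \<in> S \<Longrightarrow> length vs \<noteq> 1 \<Longrightarrow> \<theta> j x vs = 0"
      using assms(2)[OF that] by (simp_all add: k_forms_on_def)
    then have "(\<lambda>_. - 1) \<cdot> \<theta> j \<in> forms_on S"
      by (intro forms_on_scale smooth_on_const assms(1))
    moreover have "((\<lambda>_. - 1) \<cdot> \<theta> j) x vs = 0" if "x \<in> S" "length vs \<noteq> 1" for x vs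
      using 0[OF that] by (simp add: scale_form_def)
    ultimately show ?thesis by (simp add: k_forms_on_def)
  qed
  then show ?thesis using assms(2) by (simp add: exchange_def)
qed

lemma generated_ideal_exchange:
  assumes "open V" "\<And>i. i < 5 \<Longrightarrow> \<theta> i \<in> forms_on V"
  shows "generated_ideal V {exchange \<theta> 0, exchange \<theta> 1 \<and>\<^sub>w exchange \<theta> 2, exchange \<theta> 3 \<and>\<^sub>w exchange \<theta> 4}
    = generated_ideal V {\<theta> 0, \<theta> 1 \<and>\<^sub>w \<theta> 2, \<theta> 3 \<and>\<^sub>w \<theta> 4}"
proof -
  have wedge_neg: "\<alpha> \<and>\<^sub>w ((\<lambda>_. - 1) \<cdot> \<beta>) = (\<lambda>_. - 1) \<cdot> (\<alpha> \<and>\<^sub>w \<beta>)" for \<alpha> \<beta> :: "'a form"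
    by (simp add: fun_eq_iff wedge_eq_ext_prod scale_form_def ext_prod_scale_right[of _ "- 1", simplified])
  have neg_iff: "(\<lambda>_. - 1) \<cdot> \<omega> \<in> generated_ideal V G \<longleftrightarrow> \<omega> \<in> generated_ideal V G" for \<omega> G
  proof
    assume "(\<lambda>_. - 1) \<cdot> \<omega> \<in> generated_ideal V G"
    from generated_ideal_scale[OF assms(1) smooth_on_const[OF assms(1), of "- 1"] this]
    show "\<omega> \<in> generated_ideal V G" by (simp add: scale_form_def)
  qed (rule generated_ideal_scale[OF assms(1) smooth_on_const[OF assms(1)]])
  let ?G = "{\<theta> 0, \<theta> 1 \<and>\<^sub>w \<theta> 2, \<theta> 3 \<and>\<^sub>w \<theta> 4}"
  let ?H = "{(\<lambda>_. - 1) \<cdot> \<theta> 0, (\<lambda>_. - 1) \<cdot> (\<theta> 3 \<and>\<^sub>w \<theta> 4), (\<lambda>_. - 1) \<cdot> (\<theta> 1 \<and>\<^sub>w \<theta> 2)}"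
  have forms: "\<theta> 0 \<in> forms_on V" "\<theta> 1 \<and>\<^sub>w \<theta> 2 \<in> forms_on V" "\<theta> 3 \<and>\<^sub>w \<theta> 4 \<in> forms_on V"
    by (intro forms_on_wedge assms; simp)+
  have "\<omega> \<in> generated_ideal V ?G" if "\<omega> \<in> ?G" for \<omega>
    using that by (intro generated_ideal_generator assms(1)) (use forms in auto)
  then have "?H \<subseteq> generated_ideal V ?G" by (auto simp only: neg_iff) blast+
  moreover have "(\<lambda>_. - 1) \<cdot> \<omega> \<in> generated_ideal V ?H" if "\<omega> \<in> ?G" for \<omega>
    using that
    by (intro generated_ideal_generator assms(1))
      (use forms in \<open>auto intro!: forms_on_scale smooth_on_const assms(1)\<close>)
  then have "?G \<subseteq> generated_ideal V ?H" using neg_iff by blast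
  ultimately have "generated_ideal V ?H = generated_ideal V ?G"
    using generated_ideal_subsetI[OF assms(1)] by blast
  then show ?thesis by (simp add: exchange_def wedge_neg)
qed

lemma local_equivalence:
  fixes S :: "(real^5) set" and \<theta> :: "nat \<Rightarrow> (real^5) form"
  assumes frame: "structured_coframe S (\<lambda>i x v. \<theta> i x [v]) F"
    and \<theta>: "\<And>i. i < 5 \<Longrightarrow> \<theta> i \<in> k_forms_on 1 S"
    and "convex S" "x0 \<in> S"
    and sign: "(\<forall>x\<in>S. 0 < F x) \<or> (\<forall>x\<in>S. F x < 0)"
  obtains V g where "x0 \<in> V" "V \<subseteq> S" "g ` V \<subseteq> {w. w $ 4 - w $ 2 \<noteq> 0 \<or> w $ 5 + w $ 1 \<noteq> 0}"
    "diffeomorphism V (g ` V) g"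
    "\<And>\<omega>. \<omega> \<in> forms_on (g ` V) \<Longrightarrow>
      \<omega> \<in> generated_ideal (g ` V) {contact_form, ext_d contact_form, pde_form} \<longleftrightarrow>
      pullback g \<omega> \<in> generated_ideal V {\<theta> 0, \<theta> 1 \<and>\<^sub>w \<theta> 2, \<theta> 3 \<and>\<^sub>w \<theta> 4}"
  using sign
proof
  assume pos: "\<forall>x\<in>S. 0 < F x"
  show thesis
  proof (rule local_equivalence_positive[OF frame \<theta> assms(3) _ assms(4)])
    fix V g assume V: "x0 \<in> V" "V \<subseteq> S" "g ` V \<subseteq> {w. w $ 4 - w $ 2 \<noteq> 0 \<or> w $ 5 + w $ 1 \<noteq> 0}"
      "open V" "diffeomorphism V (g ` V) g"
      and ideal: "\<And>\<omega>. \<omega> \<in> forms_on (g ` V) \<Longrightarrow>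
        \<omega> \<in> generated_ideal (g ` V) {contact_form, ext_d contact_form, pde_form} \<longleftrightarrow>
        pullback g \<omega> \<in> generated_ideal V {\<theta> 0, \<theta> 1 \<and>\<^sub>w \<theta> 2, \<theta> 3 \<and>\<^sub>w \<theta> 4}"
    show thesis by (rule that[OF V(1,2,3,5) ideal])
  qed (use pos in blast)+
next
  assume neg: "\<forall>x\<in>S. F x < 0"
  have S: "open S" using frame by (rule structured_coframe.open_S)
  show thesis
  proof (rule local_equivalence_positive[OF structured_coframe_exchange[OF frame]
        exchange_k_forms[OF S \<theta>] assms(3) _ assms(4)])
    fix V g assume V: "x0 \<in> V" "V \<subseteq> S" "g ` V \<subseteq> {w. w $ 4 - w $ 2 \<noteq> 0 \<or> w $ 5 + w $ 1 \<noteq> 0}"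
      "open V" "diffeomorphism V (g ` V) g"
      and ideal: "\<And>\<omega>. \<omega> \<in> forms_on (g ` V) \<Longrightarrow>
        \<omega> \<in> generated_ideal (g ` V) {contact_form, ext_d contact_form, pde_form} \<longleftrightarrow>
        pullback g \<omega> \<in> generated_ideal V
          {exchange \<theta> 0, exchange \<theta> 1 \<and>\<^sub>w exchange \<theta> 2, exchange \<theta> 3 \<and>\<^sub>w exchange \<theta> 4}"
    have "\<theta> i \<in> forms_on V" if "i < 5" for i
      using \<theta>[OF that] forms_on_subset[OF _ V(2)] by (simp add: k_forms_on_def)
    then have "generated_ideal V {exchange \<theta> 0, exchange \<theta> 1 \<and>\<^sub>w exchange \<theta> 2, exchange \<theta> 3 \<and>\<^sub>w exchange \<theta> 4}
        = generated_ideal V {\<theta> 0, \<theta> 1 \<and>\<^sub>w \<theta> 2, \<theta> 3 \<and>\<^sub>w \<theta> 4}"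
      by (rule generated_ideal_exchange[OF V(4)])
    note ideal' = ideal[unfolded this]
    show thesis by (rule that[OF V(1,2,3,5) ideal'])
  qed (use neg in auto)
qed


section \<open>Charts of the manifold\<close>

lemma UNIV_5: "(UNIV :: 5 set) = {1, 2, 3, 4, 5}"
  using exhaust_5 by auto

lemma inner_5: "x \<bullet> y = x $ 1 * y $ 1 + x $ 2 * y $ 2 + x $ 3 * y $ 3 + x $ 4 * y $ 4 + x $ 5 * y $ 5"
  for x y :: "real^5"
  unfolding inner_vec_def UNIV_5 by (simp add: ac_simps)

text \<open>
  Pointwise independence of the five members makes the map that collects their values surjective,
  and hence injective.
\<close>

lemma independent_one_forms_separate:
  fixes a :: "nat \<Rightarrow> real^5 \<Rightarrow> real"
  assumes lin: "\<And>i. i < 5 \<Longrightarrow> linear (a i)"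
    and indep: "\<And>r. (\<And>v. (\<Sum>i<5. r i * a i v) = 0) \<Longrightarrow> \<forall>i<5. r i = 0"
    and zero: "\<And>i. i < 5 \<Longrightarrow> a i v = 0"
  shows "v = 0"
proof (rule ccontr)
  assume "v \<noteq> 0"
  define L where "L u = (vector [a 0 u, a 1 u, a 2 u, a 3 u, a 4 u] :: real^5)" for u
  have lin': "linear (a 0)" "linear (a 1)" "linear (a 2)" "linear (a 3)" "linear (a 4)"
    by (auto intro: lin)
  have "linear L"
    unfolding linear_iff L_def
    using lin' by (simp add: vec_eq_iff forall_5 linear_add linear_cmul)
  moreover have "L v = L 0"
    using lin' zero by (simp add: L_def linear_0)
  then have "\<not> inj L" using \<open>v \<noteq> 0\<close> by (auto dest: injD)
  ultimately have "range L \<noteq> UNIV"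
    using linear_surjective_imp_injective by blast
  then have "span (range L) \<noteq> UNIV"
    using linear_subspace_image[OF \<open>linear L\<close> subspace_UNIV] span_eq_iff by blast
  then have "dim (range L) < DIM(real^5)"
    using dim_eq_full dim_subset_UNIV le_neq_implies_less by blast
  then obtain y where y: "y \<noteq> 0" "\<And>z. z \<in> span (range L) \<Longrightarrow> orthogonal y z"
    using orthogonal_to_subspace_exists by blast
  define r where "r i = (if i = 0 then y $ 1 else if i = 1 then y $ 2 else if i = 2 then y $ 3
    else if i = 3 then y $ 4 else y $ 5)" for i :: nat
  have sum5: "(\<Sum>i<5. f i) = f 0 + f 1 + f 2 + f 3 + f 4" for f :: "nat \<Rightarrow> real"
    by (simp add: eval_nat_numeral)
  have "(\<Sum>i<5. r i * a i u) = 0" for u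
  proof -
    have "y \<bullet> L u = 0"
      using y(2)[OF span_base[OF rangeI]] by (simp add: orthogonal_def)
    then show ?thesis unfolding inner_5 L_def vector_5 sum5 by (simp add: r_def)
  qed
  then have "\<forall>i<5. r i = 0" by (rule indep)
  from this[rule_format, of 0] this[rule_format, of 1] this[rule_format, of 2]
    this[rule_format, of 3] this[rule_format, of 4]
  have "y = 0" by (simp add: r_def vec_eq_iff forall_5)
  then show False using y(1) by simp
qed

lemma structured_coframeI:
  fixes U S :: "(real^5) set" and \<theta> :: "nat \<Rightarrow> (real^5) form"
  assumes S: "open S" and \<theta>: "\<And>i. i < 5 \<Longrightarrow> \<theta> i \<in> k_forms_on 1 S"
    and indep: "\<And>x r. x \<in> S \<Longrightarrow> (\<And>v. (\<Sum>i<5. r i * \<theta> i x [v]) = 0) \<Longrightarrow> \<forall>i<5. r i = 0"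
    and F: "smooth_on S F"
    and str: "structure_equations S \<theta> F"
  shows "structured_coframe S (\<lambda>i x v. \<theta> i x [v]) F"
proof -
  have lin: "linear (\<lambda>v. \<theta> i x [v])" if "i < 5" "x \<in> S" for i x
    using alternating_multilinear_linear[OF forms_on_alternating, of "\<theta> i" S x "[]" "[]"]
      \<theta>[OF that(1)] that(2) by (simp add: k_forms_on_def)
  have hom: "homogeneous 1 (\<theta> i x)" if "i < 5" "x \<in> S" for i x
    by (rule k_forms_on_homogeneous[OF \<theta>]) (use that in auto)
  have pair: "(\<theta> i \<and>\<^sub>w \<theta> j) x [v, w] = wedge_value (\<lambda>v. \<theta> i x [v]) (\<lambda>v. \<theta> j x [v]) v w"
    if "i < 5" "j < 5" "x \<in> S" for i j x v w
    by (rule wedge_one_pair[OF hom hom]) (use that in auto)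
  show ?thesis
  proof (rule structured_coframe.intro)
    show "v = 0" if "x \<in> S" "\<And>i. i < 5 \<Longrightarrow> \<theta> i x [v] = 0" for x v
      by (rule independent_one_forms_separate[of "\<lambda>i v. \<theta> i x [v]"]) (use that lin indep in auto)
    show "smooth_on S (\<lambda>x. \<theta> i x [v])" if "i < 5" for i v
      by (rule forms_on_smooth) (use \<theta>[OF that] in \<open>simp add: k_forms_on_def\<close>)
    fix x v w assume x: "x \<in> S"
    note eqs = str[unfolded structure_equations_def, rule_format, OF x]
    have scale_pair: "(f \<cdot> \<omega>) x vs = f x * \<omega> x vs" for f \<omega> vs
      by (simp add: scale_form_def)
    have add_pair: "(\<alpha> + \<beta>) x vs = \<alpha> x vs + \<beta> x vs" "(\<alpha> - \<beta>) x vs = \<alpha> x vs - \<beta> x vs"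
      "(- \<alpha>) x vs = - \<alpha> x vs" for \<alpha> \<beta> :: "(real^5) form" and vs
      by simp_all
    have F_ops: "(F + 1) x = F x + 1" "(F - 1) x = F x - 1" "(1 - F) x = 1 - F x"
      "(2 * F) x = 2 * F x" "(2 * F ^ 2) x = 2 * (F x)\<^sup>2" "(2 :: real^5 \<Rightarrow> real) x = 2"
      by (simp_all add: power2_eq_square)
    have wedge_linear: "(\<alpha> \<and>\<^sub>w (\<beta> + \<beta>')) x vs = (\<alpha> \<and>\<^sub>w \<beta>) x vs + (\<alpha> \<and>\<^sub>w \<beta>') x vs"
      "(\<alpha> \<and>\<^sub>w (\<beta> - \<beta>')) x vs = (\<alpha> \<and>\<^sub>w \<beta>) x vs - (\<alpha> \<and>\<^sub>w \<beta>') x vs"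
      "(\<alpha> \<and>\<^sub>w (f \<cdot> \<beta>)) x vs = f x * (\<alpha> \<and>\<^sub>w \<beta>) x vs"
      for \<alpha> \<beta> \<beta>' :: "(real^5) form" and f vs
    proof -
      show *: "(\<alpha> \<and>\<^sub>w (f \<cdot> \<beta>)) x vs = f x * (\<alpha> \<and>\<^sub>w \<beta>) x vs" for f \<beta>
        by (simp add: wedge_eq_ext_prod scale_form_def ext_prod_scale_right)
      show **: "(\<alpha> \<and>\<^sub>w (\<beta> + \<beta>')) x vs = (\<alpha> \<and>\<^sub>w \<beta>) x vs + (\<alpha> \<and>\<^sub>w \<beta>') x vs" for \<beta> \<beta>'
        by (simp add: wedge_add_right)
      have "\<beta> - \<beta>' = \<beta> + (\<lambda>_. - 1) \<cdot> \<beta>'" by (simp add: fun_eq_iff scale_form_def)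
      then show "(\<alpha> \<and>\<^sub>w (\<beta> - \<beta>')) x vs = (\<alpha> \<and>\<^sub>w \<beta>) x vs - (\<alpha> \<and>\<^sub>w \<beta>') x vs"
        by (simp only: ** *)
    qed
    note expand = add_pair scale_pair wedge_linear F_ops
    have pairs: "(\<theta> 0 \<and>\<^sub>w \<theta> j) x [v, w] = wedge_value (\<lambda>v. \<theta> 0 x [v]) (\<lambda>v. \<theta> j x [v]) v w"
      "(\<theta> 1 \<and>\<^sub>w \<theta> j) x [v, w] = wedge_value (\<lambda>v. \<theta> 1 x [v]) (\<lambda>v. \<theta> j x [v]) v w"
      "(\<theta> 2 \<and>\<^sub>w \<theta> j) x [v, w] = wedge_value (\<lambda>v. \<theta> 2 x [v]) (\<lambda>v. \<theta> j x [v]) v w"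
      "(\<theta> 3 \<and>\<^sub>w \<theta> j) x [v, w] = wedge_value (\<lambda>v. \<theta> 3 x [v]) (\<lambda>v. \<theta> j x [v]) v w"
      if "j = 2 \<or> j = 4 \<or> j = 1 \<or> j = 3" for j
      by (rule pair; use that x in auto)+
    note pairs = pairs[of 1, simplified] pairs[of 2, simplified] pairs[of 3, simplified] pairs[of 4, simplified]
    have "ext_d (zero_form F) x [v] = 2 * (F x)\<^sup>2 * (2 * \<theta> 0 x [v] - \<theta> 2 x [v] - \<theta> 4 x [v])
        + 2 * F x * (\<theta> 1 x [v] + \<theta> 3 x [v])"
      using eqs by (simp only: expand)
    then show "frechet_derivative F (at x) v = 2 * (F x)\<^sup>2 * (2 * \<theta> 0 x [v] - \<theta> 2 x [v] - \<theta> 4 x [v])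
        + 2 * F x * (\<theta> 1 x [v] + \<theta> 3 x [v])"
      by (simp add: differential_eq)
    have "ext_d (\<theta> i) x [v, w] = curl (\<lambda>y u. \<theta> i y [u]) x v w" for i
      by (rule ext_d_pair)
    note curls = this[symmetric]
    show "curl (\<lambda>y u. \<theta> 0 y [u]) x v w =
        2 * wedge_value (\<lambda>v. \<theta> 0 x [v]) (\<lambda>v. \<theta> 1 x [v]) v w
        - F x * wedge_value (\<lambda>v. \<theta> 0 x [v]) (\<lambda>v. \<theta> 2 x [v]) v w
        + 2 * wedge_value (\<lambda>v. \<theta> 0 x [v]) (\<lambda>v. \<theta> 3 x [v]) v w
        - F x * wedge_value (\<lambda>v. \<theta> 0 x [v]) (\<lambda>v. \<theta> 4 x [v]) v w
        + wedge_value (\<lambda>v. \<theta> 1 x [v]) (\<lambda>v. \<theta> 2 x [v]) v w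
        + wedge_value (\<lambda>v. \<theta> 3 x [v]) (\<lambda>v. \<theta> 4 x [v]) v w"
      unfolding curls eqs[THEN conjunct1] expand by (simp add: pairs)
    show "curl (\<lambda>y u. \<theta> 1 y [u]) x v w =
        - F x * wedge_value (\<lambda>v. \<theta> 0 x [v]) (\<lambda>v. \<theta> 2 x [v]) v w
        - F x * wedge_value (\<lambda>v. \<theta> 0 x [v]) (\<lambda>v. \<theta> 4 x [v]) v w
        - wedge_value (\<lambda>v. \<theta> 1 x [v]) (\<lambda>v. \<theta> 4 x [v]) v w
        + wedge_value (\<lambda>v. \<theta> 2 x [v]) (\<lambda>v. \<theta> 3 x [v]) v w
        + (F x + 1) * wedge_value (\<lambda>v. \<theta> 2 x [v]) (\<lambda>v. \<theta> 4 x [v]) v w"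
      unfolding curls eqs[THEN conjunct2, THEN conjunct1] expand by (simp add: pairs algebra_simps)
    show "curl (\<lambda>y u. \<theta> 2 y [u]) x v w =
        - 2 * F x * wedge_value (\<lambda>v. \<theta> 0 x [v]) (\<lambda>v. \<theta> 2 x [v]) v w
        - wedge_value (\<lambda>v. \<theta> 1 x [v]) (\<lambda>v. \<theta> 2 x [v]) v w
        - wedge_value (\<lambda>v. \<theta> 1 x [v]) (\<lambda>v. \<theta> 4 x [v]) v w
        + wedge_value (\<lambda>v. \<theta> 2 x [v]) (\<lambda>v. \<theta> 3 x [v]) v w
        + (1 - F x) * wedge_value (\<lambda>v. \<theta> 2 x [v]) (\<lambda>v. \<theta> 4 x [v]) v w
        + wedge_value (\<lambda>v. \<theta> 3 x [v]) (\<lambda>v. \<theta> 4 x [v]) v w"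
      unfolding curls eqs[THEN conjunct2, THEN conjunct2, THEN conjunct1] expand
      by (simp add: pairs algebra_simps)
    show "curl (\<lambda>y u. \<theta> 3 y [u]) x v w =
        F x * wedge_value (\<lambda>v. \<theta> 0 x [v]) (\<lambda>v. \<theta> 2 x [v]) v w
        + F x * wedge_value (\<lambda>v. \<theta> 0 x [v]) (\<lambda>v. \<theta> 4 x [v]) v w
        + wedge_value (\<lambda>v. \<theta> 1 x [v]) (\<lambda>v. \<theta> 4 x [v]) v w
        - wedge_value (\<lambda>v. \<theta> 2 x [v]) (\<lambda>v. \<theta> 3 x [v]) v w
        + (F x - 1) * wedge_value (\<lambda>v. \<theta> 2 x [v]) (\<lambda>v. \<theta> 4 x [v]) v w"
      unfolding curls eqs[THEN conjunct2, THEN conjunct2, THEN conjunct2, THEN conjunct1] expand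
      by (simp add: pairs algebra_simps)
    show "curl (\<lambda>y u. \<theta> 4 y [u]) x v w =
        - 2 * F x * wedge_value (\<lambda>v. \<theta> 0 x [v]) (\<lambda>v. \<theta> 4 x [v]) v w
        + wedge_value (\<lambda>v. \<theta> 1 x [v]) (\<lambda>v. \<theta> 2 x [v]) v w
        - wedge_value (\<lambda>v. \<theta> 1 x [v]) (\<lambda>v. \<theta> 4 x [v]) v w
        + wedge_value (\<lambda>v. \<theta> 2 x [v]) (\<lambda>v. \<theta> 3 x [v]) v w
        + (F x + 1) * wedge_value (\<lambda>v. \<theta> 2 x [v]) (\<lambda>v. \<theta> 4 x [v]) v w
        - wedge_value (\<lambda>v. \<theta> 3 x [v]) (\<lambda>v. \<theta> 4 x [v]) v w"
      unfolding curls eqs[THEN conjunct2, THEN conjunct2, THEN conjunct2, THEN conjunct2, THEN conjunct1] expand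
      by (simp add: pairs algebra_simps)
  qed (use S F lin in auto)
qed


theorem proposition6p6:
  fixes X :: "'m topology"
    and \<A> :: "('m, real^5) chart set"
    and \<theta> :: "nat \<Rightarrow> ('m, real^5) manifold_form"
    and F :: "'m \<Rightarrow> real"
  assumes "smooth_manifold X \<A>"
    and "coframing \<A> \<theta>"
    and "smooth_function \<A> F"
    and "\<forall>m\<in>topspace X. F m \<noteq> 0"
    and "\<forall>c\<in>\<A>. structure_equations (chart_image c) (\<lambda>i. \<theta> i c) (in_chart c F)"
  shows "corresponds_to_pde X \<A>
    {\<theta> 0, (\<lambda>c. \<theta> 1 c \<and>\<^sub>w \<theta> 2 c), (\<lambda>c. \<theta> 3 c \<and>\<^sub>w \<theta> 4 c)}
    {w. w $ 4 - w $ 2 \<noteq> 0 \<or> w $ 5 + w $ 1 \<noteq> 0}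
    (\<lambda>z u. let A = partial 1 z u - u $ 2; B = partial 2 z u + u $ 1 in
       (A\<^sup>2 - B\<^sup>2) * (partial 1 (partial 1 z) u - partial 2 (partial 2 z) u)
       + 4 * A * B * partial 2 (partial 1 z) u + (A\<^sup>2 + B\<^sup>2)\<^sup>2 = 0)"
proof -
  have charts: "fst c \<subseteq> topspace X" "open (chart_image c)" if "c \<in> \<A>" for c
    using assms(1) that by (auto simp: smooth_manifold_def)
  let ?W = "{w. w $ 4 - w $ 2 \<noteq> 0 \<or> w $ 5 + w $ 1 \<noteq> 0} :: (real^5) set"
  have "?W = - {w. w $ 4 - w $ 2 = 0} \<union> - {w. w $ 5 + w $ 1 = 0}" by auto
  moreover have "closed {w :: real^5. w $ 4 - w $ 2 = 0}" "closed {w :: real^5. w $ 5 + w $ 1 = 0}"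
    by (intro closed_Collect_eq continuous_intros)+
  ultimately have W: "open ?W" by (simp only: open_Un open_Compl)
  have "\<exists>c\<in>\<A>. \<exists>V g. m \<in> fst c \<and> snd c m \<in> V \<and> V \<subseteq> chart_image c \<and>
      g ` V \<subseteq> ?W \<and> diffeomorphism V (g ` V) g \<and>
      (\<forall>\<omega>\<in>forms_on (g ` V).
        \<omega> \<in> generated_ideal (g ` V) {contact_form, ext_d contact_form, pde_form} \<longleftrightarrow>
        pullback g \<omega> \<in> generated_ideal V
          ((\<lambda>\<gamma>. \<gamma> c) ` {\<theta> 0, (\<lambda>c. \<theta> 1 c \<and>\<^sub>w \<theta> 2 c), (\<lambda>c. \<theta> 3 c \<and>\<^sub>w \<theta> 4 c)}))"
    if m: "m \<in> topspace X" for m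
  proof -
    have "m \<in> (\<Union>c\<in>\<A>. fst c)" using assms(1) m by (simp add: smooth_manifold_def)
    then obtain c where c: "c \<in> \<A>" "m \<in> fst c" by blast
    define U where "U = chart_image c"
    define f where "f = in_chart c F"
    define x0 where "x0 = snd c m"
    have U: "open U" "x0 \<in> U"
      using charts(2)[OF c(1)] c(2) by (simp_all add: U_def x0_def chart_image_def)
    have smooth_f: "smooth_on U f"
      using assms(3) c(1) by (simp add: smooth_function_def U_def f_def)
    have f_nz: "f x \<noteq> 0" if "x \<in> U" for x
    proof -
      have "inv_into (fst c) (snd c) x \<in> fst c"
        using that by (intro inv_into_into) (simp add: U_def chart_image_def)
      then show ?thesis using assms(4) charts(1)[OF c(1)] by (auto simp: f_def in_chart_def)
    qed
    \<comment> \<open>A ball around the point on which the invariant keeps its sign.\<close>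
    define U' where "U' = {x \<in> U. 0 < f x * f x0}"
    have "open (U \<inter> (\<lambda>x. f x * f x0) -` {0<..})"
      by (intro continuous_open_preimage continuous_on_mult smooth_on_continuous_on[OF smooth_f]
          continuous_on_const U(1) open_greaterThan)
    then have "open U'"
      by (simp add: U'_def vimage_def Int_def)
    moreover have "x0 \<in> U'" using U(2) f_nz[OF U(2)] by (auto simp: U'_def zero_less_mult_iff)
    ultimately obtain e where e: "e > 0" "ball x0 e \<subseteq> U'" using openE by blast
    define S where "S = ball x0 e"
    have S: "open S" "convex S" "x0 \<in> S" "S \<subseteq> U"
      using e by (auto simp: S_def U'_def)
    have sign: "(\<forall>x\<in>S. 0 < f x) \<or> (\<forall>x\<in>S. f x < 0)"
    proof -
      have "0 < f x * f x0" if "x \<in> S" for x using e(2) that by (auto simp: S_def U'_def)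
      then show ?thesis
        unfolding zero_less_mult_iff by (cases "0 < f x0") auto
    qed
    have \<theta>: "\<theta> i c \<in> k_forms_on 1 S" if "i < 5" for i
    proof -
      have "\<theta> i c \<in> k_forms_on 1 U"
        using assms(2) c(1) that by (simp add: coframing_def manifold_k_forms_def U_def)
      then show ?thesis using forms_on_subset[OF _ S(4)] S(4) by (auto simp: k_forms_on_def)
    qed
    have "structured_coframe S (\<lambda>i x v. \<theta> i c x [v]) f"
    proof (rule structured_coframeI[OF S(1) \<theta>])
      show "\<forall>i<5. r i = 0" if x: "x \<in> S" and "\<And>v. (\<Sum>i<5. r i * \<theta> i c x [v]) = 0" for x r
        using assms(2) c(1) that S(4) by (auto simp: coframing_def U_def)
      show "smooth_on S f" by (rule smooth_on_subset[OF smooth_f S(4)])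
      have "structure_equations U (\<lambda>i. \<theta> i c) f"
        using assms(5) c(1) by (simp add: U_def f_def)
      then show "structure_equations S (\<lambda>i. \<theta> i c) f"
        using S(4) unfolding structure_equations_def by blast
    qed
    then show ?thesis
    proof (rule local_equivalence[OF _ \<theta> S(2,3) sign])
      fix V g assume V: "x0 \<in> V" "V \<subseteq> S" "g ` V \<subseteq> ?W" "diffeomorphism V (g ` V) g"
        and ideal: "\<And>\<omega>. \<omega> \<in> forms_on (g ` V) \<Longrightarrow>
          \<omega> \<in> generated_ideal (g ` V) {contact_form, ext_d contact_form, pde_form} \<longleftrightarrow>
          pullback g \<omega> \<in> generated_ideal V {\<theta> 0 c, \<theta> 1 c \<and>\<^sub>w \<theta> 2 c, \<theta> 3 c \<and>\<^sub>w \<theta> 4 c}"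
      show ?thesis
      proof (rule bexI[OF _ c(1)], rule exI[of _ V], rule exI[of _ g], intro conjI ballI)
        show "V \<subseteq> chart_image c" using V(2) S(4) by (simp add: U_def)
        show "\<omega> \<in> generated_ideal (g ` V) {contact_form, ext_d contact_form, pde_form} \<longleftrightarrow>
            pullback g \<omega> \<in> generated_ideal V
              ((\<lambda>\<gamma>. \<gamma> c) ` {\<theta> 0, (\<lambda>c. \<theta> 1 c \<and>\<^sub>w \<theta> 2 c), (\<lambda>c. \<theta> 3 c \<and>\<^sub>w \<theta> 4 c)})"
          if "\<omega> \<in> forms_on (g ` V)" for \<omega>
          using ideal[OF that] by simp
      qed (use c(2) V in \<open>simp_all add: x0_def\<close>)
    qed
  qed
  then show ?thesis
    unfolding corresponds_to_pde_def using pde_form_encodes[OF W] by blast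
qed


end
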